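(* Let $S$ be a sub-semifield of $\mathbb T$, let $\mathcal M$ be the toric monoid corresponding to the strongly convex rational polyhedral cone $\sigma\subseteq N_{\mathbb R}$, and let $I\subseteq S[\mathcal M]$ be the tropicalization of an ideal in $k[\mathcal M]$ for some valued field $k\to S$. Suppose that $V(I)$ is the closure of $V(I)\cap N_{\mathbb R}$ in the tropical toric variety $N_{\mathbb R}(\sigma)$. Then $S[\mathcal M]/\sqrt{\mathrm{Bend}(I)}$ is cancellative.
   Context: Semirings are commutative, with $0$ and $1$, and additively idempotent; they are partially ordered by $a\le b\iff a+b=b$. $\mathbb{T}=\mathbb{R}\cup\{-\infty\}$ is the tropical semifield (addition is max, multiplication is usual addition, $0_{\mathbb T}=-\infty$); $\log:\mathbb{T}\to\mathbb{R}\cup\{-\infty\}$ is the tautological identification, with $\log 0_{\mathbb T}=-\infty$. Toric data: $M$ is a finitely generated free abelian group, $M_{\mathbb R}=M\otimes\mathbb R$, $N_{\mathbb R}=\mathrm{Hom}(M,\mathbb R)$ with pairing $\langle v,u\rangle=v(u)$. For $\sigma\subseteq N_{\mathbb R}$ a strongly convex rational polyhedral cone, $\sigma^\vee=\{u\in M_{\mathbb R}:\langle v,u\rangle\le 0\ \forall v\in\sigma\}$, and the toric monoid corresponding to $\sigma$ is $\mathcal{M}=\sigma^\vee\cap M$. The tropical toric variety $N_{\mathbb R}(\sigma)$ is the set of monoid homomorphisms $\mathcal{M}\to(\mathbb R\cup\{-\infty\},+)$, with $\langle x,u\rangle=x(u)$, topologized as a subspace of the product $(\mathbb R\cup\{-\infty\})^{\mathcal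 M}$, where $\mathbb R\cup\{-\infty\}$ is given the topology of $[0,\infty)$ via $x\mapsto e^x$. $N_{\mathbb R}\subseteq N_{\mathbb R}(\sigma)$ is identified with the homomorphisms having only finite values. A valued field $k\to S$ is a field $k$ with a non-archimedean valuation $v:k\to S$: $v(a)=0_S$ iff $a=0$, $v(1)=1_S$, $v(ab)=v(a)v(b)$, $v(a+b)\le v(a)+v(b)$. For $F=\sum c_u\chi^u\in k[\mathcal M]$, $\mathrm{trop}(F)=\sum v(c_u)\chi^u\in S[\mathcal M]$; the tropicalization of an ideal $J$ is $\mathrm{trop}(J)=\{\mathrm{trop}(F):F\in J\}$. A congruence on a semiring is an equivalence relation respecting the operations. For $f\in S[\mathcal M]$ and $i\in\mathrm{supp}(f)$, $f_{\hat\imath}$ is $f$ with its $i$ term deleted; the bend relations of $f$ are the pairs $(f,f_{\hat\imath})$, $i\in\mathrm{supp}(f)$. $\mathrm{Bend}(I)$ is the congruence on $S[\mathcal M]$ generated by the bend relations of all $f\in I$. For $a\in N_{\mathbb R}(\sigma)$, $f(a)=\max_{u\in\mathrm{supp}(f)}(\log f_u+\langle a,u\rangle)$ ($-\infty$ if $f=0$). $V(I)=\{a\in N_{\mathbb R}(\sigma): f(a)=f_{\hat\imath}(a)\ \forall f\in I,\ i\in\mathrm{supp}(f)\}$ (i.e. every $f\in I$ tropically vanishes at $a$). A semiring is cancellative if every nonzero element $a$ satisfies $ab=ac\Rightarrow b=c$. A proper congruence $P$ on $A$ is prime if $A/P$ is totally ordered and cancellative. $\sqrt C$ is the intersection of all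 prime congruences containing the congruence $C$. *)

theory Defs
  imports
    "HOL-Analysis.Analysis"
    "HOL-Library.Poly_Mapping"
    "HOL-Algebra.Free_Abelian_Groups"
    "HOL-Algebra.Ideal"
begin

section \<open>The tropical semifield\<close>

typedef trop = "{x::ereal. x \<noteq> \<infinity>}"
  morphisms trop_log Abs_trop
  by (rule exI[of _ 0]) simp

setup_lifting type_definition_trop

instantiation trop :: comm_semiring_1
begin

lift_definition zero_trop :: trop is "- \<infinity>" by simp
lift_definition one_trop :: trop is "0" by simp
lift_definition plus_trop :: "trop \<Rightarrow> trop \<Rightarrow> trop" is max by (simp add: max_def)
lift_definition times_trop :: "trop \<Rightarrow> trop \<Rightarrow> trop" is "(+)" by simp

instance
proof
  fix a b c :: trop
  show "(a + b) * c = a * c + b * c"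
    by transfer (auto simp: max_def not_le intro: antisym add_right_mono less_imp_le)
qed (transfer; auto simp: ac_simps max_def)+

end

instantiation trop :: order
begin

definition less_eq_trop :: "trop \<Rightarrow> trop \<Rightarrow> bool"
  where "a \<le> b \<longleftrightarrow> a + b = (b::trop)"
definition less_trop :: "trop \<Rightarrow> trop \<Rightarrow> bool"
  where "a < b \<longleftrightarrow> a \<le> b \<and> \<not> b \<le> (a::trop)"

instance
  by standard (unfold less_trop_def less_eq_trop_def; transfer; auto simp: max_def split: if_splits)+

end

definition sub_semifield :: "trop set \<Rightarrow> bool"
  where "sub_semifield S \<longleftrightarrow>
    0 \<in> S \<and> 1 \<in> S \<and> (\<forall>a\<in>S. \<forall>b\<in>S. a + b \<in> S \<and> a * b \<in> S) \<and>
    (\<forall>a\<in>S. a \<noteq> 0 \<longrightarrow> (\<exists>b\<in>S. a * b = 1))"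

definition valuation_into :: "trop set \<Rightarrow> ('k::field \<Rightarrow> trop) \<Rightarrow> bool"
  where "valuation_into S v \<longleftrightarrow>
    range v \<subseteq> S \<and> (\<forall>a. v a = 0 \<longleftrightarrow> a = 0) \<and> v 1 = 1 \<and>
    (\<forall>a b. v (a * b) = v a * v b) \<and> (\<forall>a b. v (a + b) \<le> v a + v b)"

section \<open>Congruences and quotients of semirings\<close>

text \<open>Semirings are presented by the carrier-based records of \<open>HOL-Algebra\<close>.\<close>

definition congruence :: "('a, 'b) ring_scheme \<Rightarrow> ('a \<times> 'a) set \<Rightarrow> bool"
  where "congruence A C \<longleftrightarrow> equiv (carrier A) C \<and>
    (\<forall>(a, b)\<in>C. \<forall>(c, d)\<in>C. (a \<oplus>\<^bsub>A\<^esub> c, b \<oplus>\<^bsub>A\<^esub> d) \<in> C \<and> (a \<otimes>\<^bsub>A\<^esub> c, b \<otimes>\<^bsub>A\<^esub> d) \<in> C)"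

definition generated_congruence :: "('a, 'b) ring_scheme \<Rightarrow> ('a \<times> 'a) set \<Rightarrow> ('a \<times> 'a) set"
  where "generated_congruence A X = \<Inter>{C. congruence A C \<and> X \<subseteq> C}"

definition quotient_semiring :: "('a, 'b) ring_scheme \<Rightarrow> ('a \<times> 'a) set \<Rightarrow> 'a set ring"
  where "quotient_semiring A C =
    \<lparr>carrier = carrier A // C,
     mult = (\<lambda>X Y. \<Union>x\<in>X. \<Union>y\<in>Y. C `` {x \<otimes>\<^bsub>A\<^esub> y}),
     one = C `` {\<one>\<^bsub>A\<^esub>},
     zero = C `` {\<zero>\<^bsub>A\<^esub>},
     add = (\<lambda>X Y. \<Union>x\<in>X. \<Union>y\<in>Y. C `` {x \<oplus>\<^bsub>A\<^esub> y})\<rparr>"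

definition semiring_le :: "('a, 'b) ring_scheme \<Rightarrow> 'a \<Rightarrow> 'a \<Rightarrow> bool"
  where "semiring_le A a b \<longleftrightarrow> a \<oplus>\<^bsub>A\<^esub> b = b"

definition totally_ordered :: "('a, 'b) ring_scheme \<Rightarrow> bool"
  where "totally_ordered A \<longleftrightarrow>
    (\<forall>a\<in>carrier A. \<forall>b\<in>carrier A. semiring_le A a b \<or> semiring_le A b a)"

definition cancellative :: "('a, 'b) ring_scheme \<Rightarrow> bool"
  where "cancellative A \<longleftrightarrow>
    (\<forall>a\<in>carrier A. a \<noteq> \<zero>\<^bsub>A\<^esub> \<longrightarrow>
      (\<forall>b\<in>carrier A. \<forall>c\<in>carrier A. a \<otimes>\<^bsub>A\<^esub> b = a \<otimes>\<^bsub>A\<^esub> c \<longrightarrow> b = c))"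

definition prime_congruence :: "('a, 'b) ring_scheme \<Rightarrow> ('a \<times> 'a) set \<Rightarrow> bool"
  where "prime_congruence A P \<longleftrightarrow> congruence A P \<and> P \<noteq> carrier A \<times> carrier A \<and>
    totally_ordered (quotient_semiring A P) \<and> cancellative (quotient_semiring A P)"

text \<open>The intersection is taken inside \<open>carrier A \<times> carrier A\<close>, so that the empty
  intersection is the improper congruence.\<close>

definition radical_congruence :: "('a, 'b) ring_scheme \<Rightarrow> ('a \<times> 'a) set \<Rightarrow> ('a \<times> 'a) set"
  where "radical_congruence A C =
    (carrier A \<times> carrier A) \<inter> \<Inter>{P. prime_congruence A P \<and> C \<subseteq> P}"

section \<open>Monoid algebras, tropicalization and bend relations\<close>

text \<open>\<open>R[M]\<close> for a sub-semiring \<open>R\<close> of \<open>'a\<close> and a submonoid \<open>M\<close> of \<open>'m\<close>; multiplication of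
  finitely supported functions is convolution.\<close>

definition monoid_algebra ::
    "'a::comm_semiring_1 set \<Rightarrow> 'm::comm_monoid_add set \<Rightarrow> ('m \<Rightarrow>\<^sub>0 'a) ring"
  where "monoid_algebra R M =
    \<lparr>carrier = {f. Poly_Mapping.keys f \<subseteq> M \<and> range (Poly_Mapping.lookup f) \<subseteq> R},
     mult = (*), one = 1, zero = 0, add = (+)\<rparr>"

definition trop_ideal :: "('k::field \<Rightarrow> trop) \<Rightarrow> ('m \<Rightarrow>\<^sub>0 'k) set \<Rightarrow> ('m \<Rightarrow>\<^sub>0 trop) set"
  where "trop_ideal v J = Poly_Mapping.map v ` J"

definition delete_term :: "'m \<Rightarrow> ('m \<Rightarrow>\<^sub>0 trop) \<Rightarrow> ('m \<Rightarrow>\<^sub>0 trop)"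
  where "delete_term i f = Poly_Mapping.update i 0 f"

definition bend_relations :: "('m \<Rightarrow>\<^sub>0 trop) \<Rightarrow> (('m \<Rightarrow>\<^sub>0 trop) \<times> ('m \<Rightarrow>\<^sub>0 trop)) set"
  where "bend_relations f = {(f, delete_term i f) | i. i \<in> Poly_Mapping.keys f}"

definition Bend :: "trop set \<Rightarrow> 'm::comm_monoid_add set \<Rightarrow> ('m \<Rightarrow>\<^sub>0 trop) set
    \<Rightarrow> (('m \<Rightarrow>\<^sub>0 trop) \<times> ('m \<Rightarrow>\<^sub>0 trop)) set"
  where "Bend S M I = generated_congruence (monoid_algebra S M) (\<Union>f\<in>I. bend_relations f)"

section \<open>Toric data\<close>

text \<open>The lattice \<open>M\<close> is a whole type \<open>'m\<close>; it is free of finite rank when it is isomorphic to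
  the free abelian group on \<open>n\<close> generators for some \<open>n\<close>.\<close>

definition fg_free_abelian :: "'m::ab_group_add itself \<Rightarrow> bool"
  where "fg_free_abelian _ \<longleftrightarrow>
    (\<exists>n::nat. free_Abelian_group {..<n} \<cong> \<lparr>carrier = UNIV, monoid.mult = (+), one = (0::'m)\<rparr>)"

text \<open>\<open>N\<^sub>\<real>\<close> is the space of additive maps from \<open>M\<close> to the reals, with pairing \<open>\<langle>v, u\<rangle> = v u\<close>, and
  its lattice consists of the integer-valued ones.\<close>

definition N_real :: "('m::ab_group_add \<Rightarrow> real) set"
  where "N_real = {v. Modules.additive v}"

definition N_lattice :: "('m::ab_group_add \<Rightarrow> real) set"
  where "N_lattice = {v \<in> N_real. range v \<subseteq> \<int>}"

definition rational_polyhedral_cone :: "('m::ab_group_add \<Rightarrow> real) set \<Rightarrow> bool"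
  where "rational_polyhedral_cone \<sigma> \<longleftrightarrow>
    (\<exists>G. finite G \<and> G \<subseteq> N_lattice \<and>
      \<sigma> = {(\<lambda>u. \<Sum>w\<in>G. c w * w u) | c. \<forall>w\<in>G. 0 \<le> c w})"

definition strongly_convex :: "('m::ab_group_add \<Rightarrow> real) set \<Rightarrow> bool"
  where "strongly_convex \<sigma> \<longleftrightarrow> (\<forall>w\<in>\<sigma>. (\<lambda>u. - w u) \<in> \<sigma> \<longrightarrow> w = (\<lambda>u. 0))"

text \<open>The dual cone (with the sign convention \<open>\<langle>v, u\<rangle> \<le> 0\<close>) intersected with the lattice \<open>M\<close>;
  only lattice points occur, so \<open>M \<otimes> \<real>\<close> itself is not needed.\<close>

definition toric_monoid :: "('m::ab_group_add \<Rightarrow> real) set \<Rightarrow> 'm set"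
  where "toric_monoid \<sigma> = {u. \<forall>w\<in>\<sigma>. w u \<le> 0}"

text \<open>\<open>\<real> \<union> {-\<infinity>}\<close> with the topology transported from \<open>[0, \<infinity>)\<close> along the exponential map.\<close>

definition exp_ext :: "ereal \<Rightarrow> real"
  where "exp_ext x = (if x = - \<infinity> then 0 else exp (real_of_ereal x))"

definition ext_line_topology :: "ereal topology"
  where "ext_line_topology = pullback_topology {x. x \<noteq> \<infinity>} exp_ext euclidean"

text \<open>Homomorphisms out of the toric monoid are functions on the whole lattice that are
  \<open>undefined\<close> off the monoid (\<open>extensional\<close>), as required by \<open>product_topology\<close>.\<close>

definition trop_toric_variety :: "('m::ab_group_add \<Rightarrow> real) set \<Rightarrow> ('m \<Rightarrow> ereal) set"
  where "trop_toric_variety \<sigma> =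
    {x \<in> toric_monoid \<sigma> \<rightarrow>\<^sub>E {y. y \<noteq> \<infinity>}. x 0 = 0 \<and>
      (\<forall>u\<in>toric_monoid \<sigma>. \<forall>u'\<in>toric_monoid \<sigma>. x (u + u') = x u + x u')}"

definition trop_toric_topology :: "('m::ab_group_add \<Rightarrow> real) set \<Rightarrow> ('m \<Rightarrow> ereal) topology"
  where "trop_toric_topology \<sigma> =
    subtopology (product_topology (\<lambda>_. ext_line_topology) (toric_monoid \<sigma>)) (trop_toric_variety \<sigma>)"

text \<open>The image of \<open>N\<^sub>\<real>\<close> in the tropical toric variety.\<close>

definition trop_torus :: "('m::ab_group_add \<Rightarrow> real) set \<Rightarrow> ('m \<Rightarrow> ereal) set"
  where "trop_torus \<sigma> = {x \<in> trop_toric_variety \<sigma>. \<forall>u\<in>toric_monoid \<sigma>. x u \<noteq> - \<infinity>}"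

definition trop_eval :: "('m \<Rightarrow>\<^sub>0 trop) \<Rightarrow> ('m \<Rightarrow> ereal) \<Rightarrow> ereal"
  where "trop_eval f a =
    (if f = 0 then - \<infinity>
     else Max ((\<lambda>u. trop_log (Poly_Mapping.lookup f u) + a u) ` Poly_Mapping.keys f))"

definition trop_vanishing_locus ::
    "('m::ab_group_add \<Rightarrow> real) set \<Rightarrow> ('m \<Rightarrow>\<^sub>0 trop) set \<Rightarrow> ('m \<Rightarrow> ereal) set"
  where "trop_vanishing_locus \<sigma> I =
    {a \<in> trop_toric_variety \<sigma>.
      \<forall>f\<in>I. \<forall>i\<in>Poly_Mapping.keys f. trop_eval f a = trop_eval (delete_term i f) a}"

end

theory Submission
  imports Defs
begin

text \<open>Write \<open>V\<close> for the tropical vanishing locus. The heart of the matter is a Nullstellensatz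
(\<open>tropical_nullstellensatz\<close>): two elements of \<open>S[M]\<close> are congruent modulo the radical of the bend
congruence iff they take the same values on \<open>V\<close>. The corollary follows from it. If \<open>h f\<close> and \<open>h g\<close>
agree on \<open>V\<close> and \<open>h \<noteq> 0\<close>, then \<open>h\<close> is finite at every point of the torus, so \<open>f\<close> and \<open>g\<close> agree on the
part of \<open>V\<close> in the torus; evaluation is continuous and that part is dense in \<open>V\<close>, so they agree on
\<open>V\<close>.

One half of the Nullstellensatz is that every point of \<open>V\<close> defines a prime congruence containing
the bend relations. For the other half, let \<open>P\<close> be such a prime congruence and \<open>f\<close> strictly below \<open>g\<close>
modulo \<open>P\<close>; a point of \<open>V\<close> is needed at which \<open>f\<close> is smaller than \<open>g\<close>. The monomials that do not
vanish modulo \<open>P\<close> form a face of the monoid. On the terms \<open>(s, u)\<close>, with \<open>s\<close> the logarithm of a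
coefficient and \<open>u\<close> in the group \<open>H\<close> generated by the face, \<open>P\<close> induces an order, in general of higher
rank, and the ideal of the valued field restricts to the face and extends to a Laurent ideal on \<open>H\<close>,
all of whose elements bend. The order is turned into a real point in three steps.

First, \<open>P\<close> may identify all nonzero constants. A tropical form of Chevalley's extension theorem
(\<open>admissible_extends_to_bending_order\<close>) replaces the order by one that extends the order of the reals
on constants, keeps all strict inequalities, and still makes the ideal bend. This step supplies the
points of \<open>V\<close> that a Nullstellensatz has to produce.

Second, although the ideal imposes infinitely many conditions, finitely many comparisons between
terms ensure all of them (\<open>bending_finitely_determined\<close>). This is the finiteness of Groebner
theory: by Dickson's lemma finitely many elements carry all leading terms, a dimension count in each
degree shows that multiples of them span the ideal for every order with the same comparisons, and an
element that fails to bend for one such order yields one that fails for the other.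

Third, finitely many comparisons that hold in some order extending the reals hold for a real
functional, by Fourier--Motzkin elimination (\<open>fourier_motzkin\<close>). The functional on the face,
continued by minus infinity, is the desired point.\<close>

abbreviation coeff :: "('m \<Rightarrow>\<^sub>0 'a::zero) \<Rightarrow> 'm \<Rightarrow> 'a"
  where "coeff \<equiv> Poly_Mapping.lookup"

abbreviation supp :: "('m \<Rightarrow>\<^sub>0 'a::zero) \<Rightarrow> 'm set"
  where "supp \<equiv> Poly_Mapping.keys"

abbreviation monomial :: "'m \<Rightarrow> 'a::zero \<Rightarrow> 'm \<Rightarrow>\<^sub>0 'a"
  where "monomial \<equiv> Poly_Mapping.single"

section \<open>Dickson's lemma and subgroups of lattices\<close>

text \<open>Dickson's lemma for a family of vectors of naturals. Induction on the index set: a basis for the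
smaller index set also works for the elements whose new coordinate is large, and each of the
finitely many small values of that coordinate needs one further basis.\<close>

lemma dickson_finite_basis:
  fixes f :: "'x \<Rightarrow> 'e \<Rightarrow> nat"
  assumes "finite E"
  shows "\<exists>B. finite B \<and> B \<subseteq> X \<and> (\<forall>x\<in>X. \<exists>b\<in>B. \<forall>e\<in>E. f b e \<le> f x e)"
  using assms
proof (induction E arbitrary: X rule: finite_induct)
  case empty
  show ?case
  proof (cases "X = {}")
    case False
    then obtain x where "x \<in> X" by blast
    then show ?thesis by (intro exI[of _ "{x}"]) auto
  qed auto
next
  case (insert e E)
  obtain B0 where B0: "finite B0" "B0 \<subseteq> X" "\<forall>x\<in>X. \<exists>b\<in>B0. \<forall>e\<in>E. f b e \<le> f x e"
    using insert.IH[of X] by blast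
  have "\<exists>B. \<forall>k. finite (B k) \<and> B k \<subseteq> {x\<in>X. f x e = k} \<and>
      (\<forall>x\<in>{x\<in>X. f x e = k}. \<exists>b\<in>B k. \<forall>e\<in>E. f b e \<le> f x e)"
    using insert.IH by (intro choice allI) blast
  then obtain B where *: "\<forall>k. finite (B k) \<and> B k \<subseteq> {x\<in>X. f x e = k} \<and>
      (\<forall>x\<in>{x\<in>X. f x e = k}. \<exists>b\<in>B k. \<forall>e\<in>E. f b e \<le> f x e)" ..
  have B: "finite (B k)" "B k \<subseteq> {x\<in>X. f x e = k}"
    "\<forall>x\<in>{x\<in>X. f x e = k}. \<exists>b\<in>B k. \<forall>e\<in>E. f b e \<le> f x e" for k
    using * by simp_all
  define N where "N = Max (insert 0 ((\<lambda>b. f b e) ` B0))"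
  have N: "f b e \<le> N" if "b \<in> B0" for b
    unfolding N_def using that B0(1) by (intro Max_ge) auto
  show ?case
  proof (intro exI[of _ "B0 \<union> (\<Union>k<N. B k)"] conjI ballI)
    show "finite (B0 \<union> (\<Union>k<N. B k))" using B0(1) B(1) by simp
    show "B0 \<union> (\<Union>k<N. B k) \<subseteq> X" using B0(2) B(2) by fast
    fix x assume x: "x \<in> X"
    show "\<exists>b\<in>B0 \<union> (\<Union>k<N. B k). \<forall>e\<in>insert e E. f b e \<le> f x e"
    proof (cases "f x e < N")
      case True
      then obtain b where b: "b \<in> B (f x e)" "\<forall>e\<in>E. f b e \<le> f x e"
        using B(3)[of "f x e"] x by blast
      then have "f b e = f x e" using B(2)[of "f x e"] by blast
      then have "\<forall>e\<in>insert e E. f b e \<le> f x e" using b by simp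
      moreover have "b \<in> B0 \<union> (\<Union>k<N. B k)" using b True by blast
      ultimately show ?thesis by blast
    next
      case False
      obtain b where b: "b \<in> B0" "\<forall>e\<in>E. f b e \<le> f x e" using B0(3) x by blast
      then have "\<forall>e\<in>insert e E. f b e \<le> f x e" using N[of b] False by auto
      then show ?thesis using b by blast
    qed
  qed
qed

text \<open>The additive structure of a lattice enters only through an injective coordinate map.\<close>

definition coordinates :: "nat \<Rightarrow> ('m::ab_group_add \<Rightarrow> nat \<Rightarrow> int) \<Rightarrow> bool"
  where "coordinates n c \<longleftrightarrow>
    (\<forall>u w i. c (u + w) i = c u i + c w i) \<and> (\<forall>u. (\<forall>i<n. c u i = 0) \<longrightarrow> u = 0)"

lemma coordinates_add: "coordinates n c \<Longrightarrow> c (u + w) i = c u i + c w i"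
  by (simp add: coordinates_def)

lemma coordinates_zero: "coordinates n c \<Longrightarrow> c 0 i = 0"
  using coordinates_add[of n c 0 0 i] by simp

lemma coordinates_minus: "coordinates n c \<Longrightarrow> c (- u) i = - c u i"
  using coordinates_add[of n c u "- u" i] coordinates_zero[of n c i] by simp

lemma coordinates_diff: "coordinates n c \<Longrightarrow> c (u - w) i = c u i - c w i"
  using coordinates_add[of n c u "- w" i] coordinates_minus[of n c w i] by simp

lemma coordinates_eq_0: "coordinates n c \<Longrightarrow> (\<forall>i<n. c u i = 0) \<Longrightarrow> u = 0"
  by (simp add: coordinates_def)

text \<open>Coordinates are read off from the finitely supported functions that represent the free group.\<close>

lemma fg_free_abelian_coordinates:
  assumes "fg_free_abelian TYPE('m::ab_group_add)"
  obtains n and c :: "'m::ab_group_add \<Rightarrow> nat \<Rightarrow> int" where "coordinates n c"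
proof -
  obtain n :: nat where
    "free_Abelian_group {..<n} \<cong> \<lparr>carrier = UNIV, monoid.mult = (+), one = (0::'m)\<rparr>"
    using assms unfolding fg_free_abelian_def by blast
  then obtain h where h: "h \<in> iso (free_Abelian_group {..<n}) \<lparr>carrier = UNIV, monoid.mult = (+), one = (0::'m)\<rparr>"
    unfolding is_iso_def by blast
  let ?A = "carrier (free_Abelian_group {..<n})"
  have hom: "h (x + y) = h x + h y" if "x \<in> ?A" "y \<in> ?A" for x y
    using h that unfolding iso_def hom_def by auto
  have bij: "bij_betw h ?A UNIV" using h unfolding iso_def by auto
  define g where "g = inv_into ?A h"
  have gA: "g u \<in> ?A" for u
    unfolding g_def using bij by (metis bij_betw_imp_surj_on inv_into_into iso_tuple_UNIV_I)
  have hg: "h (g u) = u" for u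
    unfolding g_def using bij by (metis bij_betw_inv_into_right iso_tuple_UNIV_I)
  have gh: "g (h x) = x" if "x \<in> ?A" for x
    unfolding g_def using bij that by (metis bij_betw_inv_into_left)
  have plusA: "x + y \<in> ?A" if "x \<in> ?A" "y \<in> ?A" for x y
    using that Poly_Mapping.keys_add[of x y] by auto
  have gadd: "g (u + w) = g u + g w" for u w
    using gh[OF plusA[OF gA[of u] gA[of w]]] unfolding hom[OF gA gA] hg by simp
  have zA: "0 \<in> ?A" by simp
  have h0: "h 0 = 0" using hom[OF zA zA] by simp
  have "coordinates n (\<lambda>u. coeff (g u))"
    unfolding coordinates_def
  proof (intro conjI allI impI)
    fix u w i show "coeff (g (u + w)) i = coeff (g u) i + coeff (g w) i"
      by (simp add: gadd lookup_add)
  next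
    fix u assume "\<forall>i<n. coeff (g u) i = 0"
    moreover have "supp (g u) \<subseteq> {..<n}" using gA[of u] by simp
    ultimately have "coeff (g u) i = 0" for i
      by (metis in_keys_iff lessThan_iff subsetD)
    then have "g u = 0" by (intro poly_mapping_eqI) simp
    then show "u = 0" using hg[of u] h0 by simp
  qed
  then show ?thesis by (rule that)
qed

definition add_subgroup :: "'m::ab_group_add set \<Rightarrow> bool"
  where "add_subgroup H \<longleftrightarrow> 0 \<in> H \<and> (\<forall>u\<in>H. \<forall>w\<in>H. u + w \<in> H) \<and> (\<forall>u\<in>H. - u \<in> H)"

lemma add_subgroupD:
  assumes "add_subgroup H"
  shows "0 \<in> H" "u \<in> H \<Longrightarrow> w \<in> H \<Longrightarrow> u + w \<in> H" "u \<in> H \<Longrightarrow> - u \<in> H"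
    "u \<in> H \<Longrightarrow> w \<in> H \<Longrightarrow> u - w \<in> H"
  using assms unfolding add_subgroup_def
  by (auto, metis diff_conv_add_uminus)

text \<open>The sign of each coordinate is recorded by splitting it into its positive and its negative part.
If the split vector of \<open>b\<close> is below that of \<open>u\<close>, then subtracting \<open>b\<close> from \<open>u\<close> strictly decreases the
sum of the absolute values of the coordinates, so a Dickson basis generates the subgroup as a
monoid.\<close>

lemma subgroup_finitely_generated:
  assumes c: "coordinates n (c :: 'm::ab_group_add \<Rightarrow> nat \<Rightarrow> int)"
    and H: "add_subgroup (H :: 'm set)"
  obtains E where "finite E" "E \<subseteq> H" "0 \<in> E"
    "\<And>u. u \<in> H \<Longrightarrow> \<exists>A. set_mset A \<subseteq> E \<and> u = sum_mset A"
proof -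
  define f where "f u e = (if snd e then nat (c u (fst e)) else nat (- c u (fst e)))"
    for u :: 'm and e :: "nat \<times> bool"
  obtain B :: "'m set" where B: "finite B" "B \<subseteq> H - {0}"
    "\<forall>u\<in>H - {0}. \<exists>b\<in>B. \<forall>e\<in>{..<n} \<times> UNIV. f b e \<le> f u e"
    using dickson_finite_basis[of "{..<n} \<times> (UNIV::bool set)" "H - {0}" f] by auto
  define \<nu> where "\<nu> u = (\<Sum>i<n. \<bar>c u i\<bar>)" for u
  have gen: "\<exists>A. set_mset A \<subseteq> insert 0 B \<and> u = sum_mset A" if "u \<in> H" for u
    using that
  proof (induction "nat (\<nu> u)" arbitrary: u rule: less_induct)
    case less
    show ?case
    proof (cases "u = 0")
      case True
      then show ?thesis by (intro exI[of _ "{#}"]) auto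
    next
      case False
      then obtain b where b: "b \<in> B" and le: "\<forall>e\<in>{..<n} \<times> UNIV. f b e \<le> f u e"
        using B(3) less.prems by blast
      have abs: "\<bar>c (u - b) i\<bar> = \<bar>c u i\<bar> - \<bar>c b i\<bar>" if "i < n" for i
      proof -
        have "f b (i, True) \<le> f u (i, True)" "f b (i, False) \<le> f u (i, False)"
          using le that by auto
        then show ?thesis
          unfolding f_def using coordinates_diff[OF c, of u b i] by (auto split: if_splits)
      qed
      have "b \<noteq> 0" "b \<in> H" using B(2) b by auto
      then obtain j where j: "j < n" "c b j \<noteq> 0" using coordinates_eq_0[OF c] by blast
      have "\<nu> (u - b) = \<nu> u - \<nu> b"
        unfolding \<nu>_def by (simp add: abs sum_subtractf)
      moreover have "0 < \<nu> b" unfolding \<nu>_def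
        using j by (intro sum_pos2[of _ j]) auto
      moreover have "0 \<le> \<nu> (u - b)" unfolding \<nu>_def by (intro sum_nonneg) auto
      ultimately have "nat (\<nu> (u - b)) < nat (\<nu> u)" by linarith
      then obtain A where A: "set_mset A \<subseteq> insert 0 B" "u - b = sum_mset A"
        using less.hyps[of "u - b"] add_subgroupD(4)[OF H less.prems \<open>b \<in> H\<close>] by blast
      then have "set_mset (add_mset b A) \<subseteq> insert 0 B \<and> u = sum_mset (add_mset b A)"
        using b by (auto simp: algebra_simps)
      then show ?thesis by blast
    qed
  qed
  show ?thesis
    by (rule that[of "insert 0 B"]) (use B gen add_subgroupD(1)[OF H] in auto)
qed

section \<open>Tropical orders on the group of tropical terms\<close>

text \<open>A pair \<open>(s, u)\<close> stands for a term with exponent \<open>u\<close> whose coefficient has logarithm \<open>s\<close>, and \<open>W\<close> for the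
set of terms that are at most \<open>1\<close> in some totally ordered group receiving the terms with exponents
in \<open>H\<close>: one term is below another iff their difference lies in \<open>W\<close>. The last condition says that
constants are ordered as in the reals. Every real functional on \<open>H\<close> gives such a set, but orders of
higher rank are included, and no type for the ordered group is needed.\<close>

definition tropical_order :: "'m::ab_group_add set \<Rightarrow> (real \<times> 'm) set \<Rightarrow> bool"
  where "tropical_order H W \<longleftrightarrow> (\<forall>g\<in>W. snd g \<in> H) \<and> (\<forall>g\<in>W. \<forall>h\<in>W. g + h \<in> W) \<and>
    (\<forall>g. snd g \<in> H \<longrightarrow> g \<in> W \<or> - g \<in> W) \<and> (\<forall>s. (s, 0) \<in> W \<longleftrightarrow> s \<le> 0)"

definition strict :: "'g::ab_group_add set \<Rightarrow> 'g \<Rightarrow> bool"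
  where "strict W g \<longleftrightarrow> g \<in> W \<and> - g \<notin> W"

definition tie :: "'g::ab_group_add set \<Rightarrow> 'g \<Rightarrow> bool"
  where "tie W g \<longleftrightarrow> g \<in> W \<and> - g \<in> W"

definition order_of_functional :: "'m set \<Rightarrow> ('m \<Rightarrow> real) \<Rightarrow> (real \<times> 'm) set"
  where "order_of_functional H a = {(s, u). u \<in> H \<and> s + a u \<le> 0}"

lemma tropical_orderD:
  assumes "tropical_order H W"
  shows "g \<in> W \<Longrightarrow> snd g \<in> H" "g \<in> W \<Longrightarrow> h \<in> W \<Longrightarrow> g + h \<in> W"
    "snd g \<in> H \<Longrightarrow> g \<in> W \<or> - g \<in> W" "(s, 0) \<in> W \<longleftrightarrow> s \<le> 0" "0 \<in> W"
  using assms unfolding tropical_order_def zero_prod_def by blast+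

lemma strict_add:
  assumes "tropical_order H W" "strict W g" "h \<in> W"
  shows "strict W (g + h)"
proof -
  have "- g \<in> W" if "- (g + h) \<in> W"
    using tropical_orderD(2)[OF assms(1) that assms(3)] by simp
  then show ?thesis using assms tropical_orderD(2) unfolding strict_def by blast
qed

lemma tie_add:
  assumes "tropical_order H W" "tie W g" "tie W h"
  shows "tie W (g + h)"
  using tropical_orderD(2)[OF assms(1), of g h] tropical_orderD(2)[OF assms(1), of "- g" "- h"] assms(2,3)
  unfolding tie_def by simp

lemma tie_minus: "tie W (- g) \<longleftrightarrow> tie W g"
  unfolding tie_def by auto

lemma tie_diff:
  assumes "tropical_order H W" "tie W g" "tie W h"
  shows "tie W (g - h)"
  using tie_add[OF assms(1,2), of "- h"] assms(3) by (simp add: tie_minus)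

lemma in_order_cases: "g \<in> W \<longleftrightarrow> strict W g \<or> tie W g"
  unfolding strict_def tie_def by blast

lemma not_strict_tie: "tie W g \<Longrightarrow> \<not> strict W g"
  unfolding strict_def tie_def by blast

lemma strict_const: "tropical_order H W \<Longrightarrow> strict W (s, 0) \<longleftrightarrow> s < 0"
  unfolding strict_def using tropical_orderD(4)[of H W s] tropical_orderD(4)[of H W "- s"] by auto

lemma tie_const: "tropical_order H W \<Longrightarrow> tie W (s, 0) \<longleftrightarrow> s = 0"
  unfolding tie_def using tropical_orderD(4)[of H W s] tropical_orderD(4)[of H W "- s"] by auto

lemma strict_lower_value:
  assumes "tropical_order H W" "strict W (s, u)" "t \<le> s"
  shows "strict W (t, u)"
  using strict_add[OF assms(1,2), of "(t - s, 0)"] tropical_orderD(4)[OF assms(1), of "t - s"] assms(3)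
  by simp

lemma tropical_order_of_functional:
  assumes H: "add_subgroup H" and a: "\<And>u w. a (u + w) = a u + a w"
  shows "tropical_order H (order_of_functional H a)"
proof -
  have a0: "a 0 = 0" using a[of 0 0] by simp
  have am: "a (- u) = - a u" for u using a[of u "- u"] a0 by simp
  show ?thesis
    unfolding tropical_order_def order_of_functional_def
    using add_subgroupD(1-3)[OF H] by (auto simp: a a0 am)
qed

lemma strict_order_of_functional:
  assumes H: "add_subgroup H" and a: "\<And>u w. a (u + w) = a u + a w"
  shows "strict (order_of_functional H a) (s, u) \<longleftrightarrow> u \<in> H \<and> s + a u < 0"
proof -
  have a0: "a 0 = 0" using a[of 0 0] by simp
  have am: "a (- u) = - a u" using a[of u "- u"] a0 by simp
  show ?thesis
    unfolding strict_def order_of_functional_def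
    using add_subgroupD(3)[OF H] by (auto simp: am)
qed

primrec nmult :: "nat \<Rightarrow> 'g::ab_group_add \<Rightarrow> 'g"
  where "nmult 0 g = 0" | "nmult (Suc i) g = g + nmult i g"

lemma nmult_add: "nmult (i + j) g = nmult i g + nmult j g"
  by (induction i) (simp_all add: ac_simps)

lemma nmult_minus: "nmult i (- g) = - nmult i g"
  by (induction i) simp_all

lemma nmult_in_order: "tropical_order H W \<Longrightarrow> g \<in> W \<Longrightarrow> nmult i g \<in> W"
  by (induction i) (auto intro: tropical_orderD)

lemma nmult_strict:
  assumes "tropical_order H W" "strict W g" "0 < i"
  shows "strict W (nmult i g)"
  using assms(3) strict_add[OF assms(1,2) nmult_in_order[OF assms(1)]] assms(2)
  by (cases i) (auto simp: strict_def)

lemma fst_nmult: "fst (nmult i g) = real i * fst g"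
  by (induction i) (simp_all add: algebra_simps)

lemma snd_nmult: "snd (nmult i g) = nmult i (snd g)"
  by (induction i) simp_all

lemma coordinates_nmult:
  "coordinates n c \<Longrightarrow> c (nmult j u) i = int j * c u i"
  by (induction j) (simp_all add: coordinates_zero coordinates_add algebra_simps)

section \<open>Realizing finitely many order conditions by a real functional\<close>

text \<open>A condition is a pair of a term and a flag which says whether the term has to be
  strictly negative.\<close>

definition satisfies :: "'g::ab_group_add set \<Rightarrow> 'g \<times> bool \<Rightarrow> bool"
  where "satisfies W q \<longleftrightarrow> fst q \<in> W \<and> (snd q \<longrightarrow> - fst q \<notin> W)"

definition nonpos :: "real \<Rightarrow> bool \<Rightarrow> bool"
  where "nonpos x b \<longleftrightarrow> (if b then x < 0 else x \<le> 0)"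

lemma satisfies_add:
  assumes "tropical_order H W" "satisfies W (g, b)" "satisfies W (h, d)"
  shows "satisfies W (g + h, b \<or> d)"
proof -
  have "strict W (g + h)" if "b \<or> d"
    using that strict_add[OF assms(1), of g h] strict_add[OF assms(1), of h g] assms(2,3)
    by (auto simp: satisfies_def strict_def add.commute)
  then show ?thesis using assms tropical_orderD(2)[OF assms(1)]
    by (auto simp: satisfies_def strict_def)
qed

lemma satisfies_nmult:
  assumes "tropical_order H W" "satisfies W (g, b)" "0 < i"
  shows "satisfies W (nmult i g, b)"
  using nmult_in_order[OF assms(1), of g i] nmult_strict[OF assms(1) _ assms(3), of g] assms(2)
  by (auto simp: satisfies_def strict_def)

text \<open>One variable of Fourier--Motzkin elimination. When the largest lower bound meets the smallest
  upper bound, pairwise compatibility forces every bound attained there to be weak.\<close>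

lemma between_bounds:
  assumes "finite L" "finite U"
    and LU: "\<And>l b r d. (l, b) \<in> L \<Longrightarrow> (r, d) \<in> U \<Longrightarrow> nonpos (l - r) (b \<or> d)"
  shows "\<exists>t::real. (\<forall>(l, b)\<in>L. nonpos (l - t) b) \<and> (\<forall>(r, d)\<in>U. nonpos (t - r) d)"
proof (cases "L = {} \<or> U = {}")
  case True
  define ml where "ml = Max (insert 0 (fst ` L))"
  define mu where "mu = Min (insert 0 (fst ` U))"
  have ml: "l \<le> ml" if "(l, b) \<in> L" for l b
    unfolding ml_def using that assms(1) by (intro Max_ge) (auto intro: rev_image_eqI)
  have mu: "mu \<le> r" if "(r, d) \<in> U" for r d
    unfolding mu_def using that assms(2) by (intro Min_le) (auto intro: rev_image_eqI)
  show ?thesis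
  proof (cases "L = {}")
    case True
    then show ?thesis using mu by (intro exI[of _ "mu - 1"]) (fastforce simp: nonpos_def)
  next
    case False
    then have "U = {}" using True by blast
    then show ?thesis using ml by (intro exI[of _ "ml + 1"]) (fastforce simp: nonpos_def)
  qed
next
  case False
  define ml where "ml = Max (fst ` L)"
  define mu where "mu = Min (fst ` U)"
  have "ml \<in> fst ` L" "mu \<in> fst ` U"
    unfolding ml_def mu_def using False assms(1,2) by (intro Max_in Min_in; simp)+
  then obtain b0 d0 where bd: "(ml, b0) \<in> L" "(mu, d0) \<in> U" by auto
  have ml: "l \<le> ml" if "(l, b) \<in> L" for l b
    unfolding ml_def using that assms(1) by (intro Max_ge) (auto intro: rev_image_eqI)
  have mu: "mu \<le> r" if "(r, d) \<in> U" for r d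
    unfolding mu_def using that assms(2) by (intro Min_le) (auto intro: rev_image_eqI)
  have le: "ml \<le> mu" using LU[OF bd] by (auto simp: nonpos_def split: if_splits)
  have "nonpos (l - (ml + mu) / 2) b" if "(l, b) \<in> L" for l b
    using LU[OF that bd(2)] ml[OF that] le by (auto simp: nonpos_def split: if_splits)
  moreover have "nonpos ((ml + mu) / 2 - r) d" if "(r, d) \<in> U" for r d
    using LU[OF bd(1) that] mu[OF that] le by (auto simp: nonpos_def split: if_splits)
  ultimately show ?thesis by blast
qed

text \<open>Eliminating a coordinate replaces the conditions by nonnegative combinations of pairs. Since the
coordinates are integers, the multipliers are natural numbers, so the new conditions still hold in
\<open>W\<close>, which is closed under addition. After the last coordinate only constants are left, and on them
\<open>W\<close> is the order of the reals.\<close>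

lemma fourier_motzkin:
  fixes W :: "(real \<times> 'm::ab_group_add) set" and c :: "'m \<Rightarrow> nat \<Rightarrow> int"
    and X :: "((real \<times> 'm) \<times> bool) set"
  assumes W: "tropical_order H W" and c: "coordinates n c"
    and "finite X" "\<And>q. q \<in> X \<Longrightarrow> satisfies W q"
  obtains a :: "'m \<Rightarrow> real" where "\<And>u w. a (u + w) = a u + a w"
    "\<And>s u b. ((s, u), b) \<in> X \<Longrightarrow> nonpos (s + a u) b"
proof -
  have "\<exists>\<alpha>. \<forall>((s, u), b)\<in>X. nonpos (s + (\<Sum>i<k. \<alpha> i * real_of_int (c u i))) b"
    if "k \<le> n" "finite X" "\<And>q. q \<in> X \<Longrightarrow> satisfies W q"
      "\<And>s u b i. ((s, u), b) \<in> X \<Longrightarrow> k \<le> i \<Longrightarrow> i < n \<Longrightarrow> c u i = 0"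
    for k and X :: "((real \<times> 'm) \<times> bool) set"
    using that
  proof (induction k arbitrary: X)
    case 0
    have "nonpos s b" if q: "((s, u), b) \<in> X" for s u b
    proof -
      have "u = 0" using coordinates_eq_0[OF c] "0.prems"(4)[OF q] by simp
      then show ?thesis
        using "0.prems"(3)[OF q] tropical_orderD(4)[OF W, of s] tropical_orderD(4)[OF W, of "- s"]
        by (auto simp: satisfies_def nonpos_def)
    qed
    then show ?case by auto
  next
    case (Suc k)
    define e where "e q = c (snd (fst q)) k" for q :: "(real \<times> 'm) \<times> bool"
    \<comment> \<open>cancels the \<open>k\<close>-th coordinate of a pair of conditions with opposite signs there\<close>
    define cmb where "cmb q r = (nmult (nat (- e r)) (fst q) + nmult (nat (e q)) (fst r), snd q \<or> snd r)"
      for q r :: "(real \<times> 'm) \<times> bool"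
    define Y where "Y = {q\<in>X. e q = 0} \<union> (\<Union>q\<in>{q\<in>X. e q > 0}. cmb q ` {r\<in>X. e r < 0})"
    have Y_cases: "(q \<in> X \<and> e q = 0) \<or>
        (\<exists>p\<in>X. \<exists>r\<in>X. e p > 0 \<and> e r < 0 \<and> q = cmb p r)" if "q \<in> Y" for q
      using that unfolding Y_def by blast
    have finY: "finite Y" unfolding Y_def using Suc.prems(2) by auto
    have satY: "satisfies W q" if "q \<in> Y" for q
    proof -
      have "satisfies W (cmb p r)" if "p \<in> X" "r \<in> X" "e p > 0" "e r < 0" for p r
        unfolding cmb_def using that Suc.prems(3)[of p] Suc.prems(3)[of r]
        by (intro satisfies_add[OF W] satisfies_nmult[OF W]) auto
      then show ?thesis using Y_cases[OF that] Suc.prems(3) by blast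
    qed
    have coordY: "c u i = 0" if "((s, u), b) \<in> Y" "k \<le> i" "i < n" for s u b i
    proof -
      have X0: "c (snd (fst q)) i = 0" if "q \<in> X" "i \<noteq> k" for q
        using Suc.prems(4)[of "fst (fst q)" "snd (fst q)" "snd q" i] that \<open>k \<le> i\<close> \<open>i < n\<close> by simp
      have cmb0: "c (snd (fst (cmb p r))) i = 0" if "p \<in> X" "r \<in> X" "e p > 0" "e r < 0" for p r
        using X0[OF that(1)] X0[OF that(2)] that(3,4) unfolding cmb_def e_def
        by (cases "i = k") (simp_all add: snd_nmult coordinates_nmult[OF c]
            coordinates_add[OF c])
      have "c (snd (fst q)) i = 0" if "q \<in> Y" for q
        using Y_cases[OF that] X0[of q] cmb0 e_def by metis
      from this[OF that(1)] show ?thesis by simp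
    qed
    have "\<exists>\<alpha>. \<forall>((s, u), b)\<in>Y. nonpos (s + (\<Sum>i<k. \<alpha> i * real_of_int (c u i))) b"
    proof (rule Suc.IH[OF _ finY satY])
      show "k \<le> n" using Suc.prems(1) by simp
      fix s u b i assume "((s, u), b) \<in> Y" "k \<le> i" "i < n"
      then show "c u i = 0" by (rule coordY)
    qed
    then obtain \<alpha> where \<alpha>: "\<forall>((s, u), b)\<in>Y. nonpos (s + (\<Sum>i<k. \<alpha> i * real_of_int (c u i))) b" ..
    define val where "val q = fst (fst q) + (\<Sum>i<k. \<alpha> i * real_of_int (c (snd (fst q)) i))"
      for q :: "(real \<times> 'm) \<times> bool"
    have valY: "nonpos (val q) (snd q)" if "q \<in> Y" for q
      using \<alpha> that unfolding val_def by (cases q) auto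
    have val_cmb: "val (cmb q r) = real_of_int (- e r) * val q + real_of_int (e q) * val r"
      if "e q > 0" "e r < 0" for q r
      unfolding val_def cmb_def using that
      by (simp add: fst_nmult snd_nmult coordinates_nmult[OF c] coordinates_add[OF c]
          sum.distrib sum_distrib_left distrib_left algebra_simps sum_subtractf sum_negf)
    define L where "L = (\<lambda>r. (- val r / e r, snd r)) ` {r\<in>X. e r < 0}"
    define U where "U = (\<lambda>q. (- val q / e q, snd q)) ` {q\<in>X. e q > 0}"
    have "nonpos (l - r) (b \<or> d)" if lb: "(l, b) \<in> L" and rd: "(r, d) \<in> U" for l b r d
    proof -
      obtain p where p: "p \<in> X" "e p < 0" "l = - val p / e p" "b = snd p"
        using lb unfolding L_def by blast
      obtain q where q: "q \<in> X" "e q > 0" "r = - val q / e q" "d = snd q"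
        using rd unfolding U_def by blast
      have "cmb q p \<in> Y" using p q unfolding Y_def by blast
      from valY[OF this] have "nonpos (- e p * val q + e q * val p) (b \<or> d)"
        using val_cmb[OF q(2) p(2)] p(4) q(4) unfolding cmb_def by (simp add: disj_commute)
      moreover have "val p = - l * e p" "val q = - r * e q"
        using p(2,3) q(2,3) by (simp_all add: field_simps)
      then have "l - r = (- e p * val q + e q * val p) * (1 / (real_of_int (- e p) * e q))"
        using p(2) q(2) by (simp add: field_simps)
      moreover have "0 < 1 / (real_of_int (- e p) * e q)"
        using p(2) q(2) by (simp add: mult_neg_pos)
      ultimately show ?thesis unfolding nonpos_def
        by (metis mult_neg_pos mult_nonpos_nonneg less_imp_le)
    qed
    moreover have "finite L" "finite U" unfolding L_def U_def using Suc.prems(2) by auto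
    ultimately obtain t where t: "\<forall>(l, b)\<in>L. nonpos (l - t) b" "\<forall>(r, d)\<in>U. nonpos (t - r) d"
      using between_bounds[of L U] by blast
    have main: "nonpos (val q + t * e q) (snd q)" if "q \<in> X" for q
    proof (cases "e q" "0::int" rule: linorder_cases)
      case less
      then have "(- val q / e q, snd q) \<in> L" unfolding L_def using that by blast
      then have "nonpos (- val q / e q - t) (snd q)" using t(1) by blast
      then show ?thesis unfolding nonpos_def using less by (auto simp: field_simps)
    next
      case equal
      then have "q \<in> Y" unfolding Y_def using that by auto
      then show ?thesis using valY[of q] equal by simp
    next
      case greater
      then have "(- val q / e q, snd q) \<in> U" unfolding U_def using that by blast
      then have "nonpos (t - - val q / e q) (snd q)" using t(2) by blast
      then show ?thesis unfolding nonpos_def using greater by (auto simp: field_simps)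
    qed
    show ?case
    proof (intro exI[of _ "\<alpha>(k := t)"] ballI, clarify)
      fix s u b assume "((s, u), b) \<in> X"
      from main[OF this] show "nonpos (s + (\<Sum>i<Suc k. (\<alpha>(k := t)) i * real_of_int (c u i))) b"
        unfolding val_def e_def by (simp add: algebra_simps)
    qed
  qed
  from this[of n X] obtain \<alpha> where \<alpha>: "\<forall>((s, u), b)\<in>X. nonpos (s + (\<Sum>i<n. \<alpha> i * real_of_int (c u i))) b"
    using assms(3,4) by auto
  show ?thesis
  proof (rule that[of "\<lambda>u. \<Sum>i<n. \<alpha> i * real_of_int (c u i)"])
    show "(\<Sum>i<n. \<alpha> i * real_of_int (c (u + w) i)) = (\<Sum>i<n. \<alpha> i * real_of_int (c u i)) + (\<Sum>i<n. \<alpha> i * real_of_int (c w i))" for u w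
      by (simp add: coordinates_add[OF c] sum.distrib distrib_left)
    fix s u b assume "((s, u), b) \<in> X"
    then show "nonpos (s + (\<Sum>i<n. \<alpha> i * real_of_int (c u i))) b" using \<alpha> by blast
  qed
qed

section \<open>Polynomials with bounded tropical terms\<close>

lemma lookup_single_mult:
  fixes F :: "'m::ab_group_add \<Rightarrow>\<^sub>0 'a::comm_semiring_1"
  shows "coeff (monomial u c * F) w = c * coeff F (w - u)"
proof -
  have eq: "(w = u + q) = (q = w - u)" for q by (auto simp: algebra_simps)
  have "coeff (monomial u c * F) w
    = (\<Sum>l. (c * (\<Sum>q. coeff F q when w = l + q) when u = l))"
    by (simp add: lookup_mult lookup_single when_mult)
  also have "\<dots> = c * (\<Sum>q. coeff F q when q = w - u)"
    by (simp add: eq)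
  finally show ?thesis by simp
qed

lemma poly_mapping_sum_monomials:
  fixes F :: "'m \<Rightarrow>\<^sub>0 'a::comm_monoid_add"
  shows "F = (\<Sum>u\<in>supp F. monomial u (coeff F u))"
  by (rule poly_mapping_eqI) (simp add: lookup_sum lookup_single when_def in_keys_iff)

lemma poly_mapping_induct:
  fixes F :: "'m \<Rightarrow>\<^sub>0 'a::comm_monoid_add"
  assumes "P 0" "\<And>u. u \<in> supp F \<Longrightarrow> P (monomial u (coeff F u))"
    "\<And>G H. P G \<Longrightarrow> P H \<Longrightarrow> P (G + H)"
  shows "P F"
proof -
  have "P (\<Sum>u\<in>A. monomial u (coeff F u))"
    if "finite A" "A \<subseteq> supp F" for A
    using that by (induction A rule: finite_induct) (auto intro: assms)
  then show ?thesis using poly_mapping_sum_monomials[of F] by (metis finite_keys order_refl)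
qed

lift_definition restrict_poly :: "'m set \<Rightarrow> ('m \<Rightarrow>\<^sub>0 'a::zero) \<Rightarrow> ('m \<Rightarrow>\<^sub>0 'a)"
  is "\<lambda>A f u. if u \<in> A then f u else 0"
  by (rule finite_subset[of _ "{x. _ x \<noteq> 0}"]) auto

locale nonarchimedean =
  fixes lv :: "'k::field \<Rightarrow> real"
  assumes lv_mult: "x \<noteq> 0 \<Longrightarrow> y \<noteq> 0 \<Longrightarrow> lv (x * y) = lv x + lv y"
    and lv_add: "x \<noteq> 0 \<Longrightarrow> y \<noteq> 0 \<Longrightarrow> x + y \<noteq> 0 \<Longrightarrow> lv (x + y) \<le> max (lv x) (lv y)"
begin

lemma lv_1 [simp]: "lv 1 = 0"
  using lv_mult[of 1 1] by simp

lemma lv_uminus [simp]: "lv (- x) = lv x"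
proof (cases "x = 0")
  case False
  have "lv (- 1) = 0" using lv_mult[of "-1" "-1"] by simp
  then show ?thesis using lv_mult[of "-1" x] False by simp
qed simp

definition below :: "'k \<Rightarrow> real \<Rightarrow> bool"
  where "below x s \<longleftrightarrow> x = 0 \<or> lv x < s"

lemma below_add: "below x s \<Longrightarrow> below y s \<Longrightarrow> below (x + y) s"
  using lv_add[of x y] by (cases "x = 0 \<or> y = 0 \<or> x + y = 0") (auto simp: below_def)

lemma below_uminus: "below (- x) s \<longleftrightarrow> below x s"
  by (simp add: below_def)

lemma below_sum: "(\<And>i. i \<in> A \<Longrightarrow> below (f i) s) \<Longrightarrow> below (\<Sum>i\<in>A. f i) s"
  by (induction A rule: infinite_finite_induct) (auto intro: below_add simp: below_def[of 0])

text \<open>The largest summand determines the value: otherwise subtracting the smaller summand again would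
violate the ultrametric inequality.\<close>

lemma lv_add_below:
  assumes "x \<noteq> 0" "below y (lv x)"
  shows "x + y \<noteq> 0 \<and> lv (x + y) = lv x"
proof (cases "y = 0")
  case False
  have y: "lv y < lv x" using assms(2) False by (simp add: below_def)
  have nz: "x + y \<noteq> 0"
  proof
    assume "x + y = 0"
    then have "y = - x" by (simp add: eq_neg_iff_add_eq_0 add.commute)
    then show False using y by simp
  qed
  have "lv x \<le> max (lv (x + y)) (lv y)"
    using lv_add[of "x + y" "- y"] nz assms(1) False by simp
  then show ?thesis using nz y lv_add[OF assms(1) False nz] by linarith
qed (use assms in auto)

definition tterm :: "('m \<Rightarrow>\<^sub>0 'k) \<Rightarrow> 'm \<Rightarrow> real \<times> 'm"
  where "tterm F u = (lv (coeff F u), u)"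

definition terms_in :: "(real \<times> 'm) set \<Rightarrow> ('m \<Rightarrow>\<^sub>0 'k) \<Rightarrow> bool"
  where "terms_in Q F \<longleftrightarrow> (\<forall>u\<in>supp F. tterm F u \<in> Q)"

definition bends :: "(real \<times> 'm::ab_group_add) set \<Rightarrow> ('m \<Rightarrow>\<^sub>0 'k) \<Rightarrow> bool"
  where "bends W F \<longleftrightarrow> \<not> (\<exists>u\<in>supp F.
    \<forall>w\<in>supp F - {u}. strict W (tterm F w - tterm F u))"

end

definition value_closed :: "(real \<times> 'm) set \<Rightarrow> bool"
  where "value_closed Q \<longleftrightarrow> (\<forall>s u t. (s, u) \<in> Q \<longrightarrow> t \<le> s \<longrightarrow> (t, u) \<in> Q)"

context nonarchimedean
begin

lemma terms_in_mono: "terms_in Q F \<Longrightarrow> Q \<subseteq> Q' \<Longrightarrow> terms_in Q' F"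
  by (auto simp: terms_in_def)

lemma terms_in_0 [simp]: "terms_in Q 0"
  by (simp add: terms_in_def)

lemma terms_in_uminus: "terms_in Q (- F) \<longleftrightarrow> terms_in Q F"
  by (simp add: terms_in_def tterm_def in_keys_iff)

lemma terms_in_add:
  assumes "value_closed Q" "terms_in Q F" "terms_in Q G"
  shows "terms_in Q (F + G)"
  unfolding terms_in_def
proof
  fix u assume u: "u \<in> supp (F + G)"
  let ?x = "coeff F u" and ?y = "coeff G u"
  have nz: "?x + ?y \<noteq> 0" using u by (simp add: in_keys_iff lookup_add)
  have x: "(lv ?x, u) \<in> Q" if "?x \<noteq> 0" using assms(2) that by (simp add: terms_in_def tterm_def in_keys_iff)
  have y: "(lv ?y, u) \<in> Q" if "?y \<noteq> 0" using assms(3) that by (simp add: terms_in_def tterm_def in_keys_iff)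
  have "(lv (?x + ?y), u) \<in> Q"
  proof (cases "?x = 0 \<or> ?y = 0")
    case True
    then show ?thesis using nz x y by auto
  next
    case False
    then have "(max (lv ?x) (lv ?y), u) \<in> Q" using x y by (simp add: max_def)
    then show ?thesis using lv_add[of ?x ?y] False nz assms(1) unfolding value_closed_def by blast
  qed
  then show "tterm (F + G) u \<in> Q" by (simp add: tterm_def lookup_add)
qed

lemma terms_in_diff: "value_closed Q \<Longrightarrow> terms_in Q F \<Longrightarrow> terms_in Q G \<Longrightarrow> terms_in Q (F - G)"
  using terms_in_add[of Q F "- G"] by (simp add: terms_in_uminus)

text \<open>Multiplying by one term of \<open>F\<close> only shifts the terms of \<open>G\<close>; passing to sums of such products can only
lower values, which is why \<open>Q\<close> has to be closed downwards.\<close>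

lemma terms_in_mult:
  fixes F G :: "'m::ab_group_add \<Rightarrow>\<^sub>0 'k"
  assumes Q: "value_closed Q" and AB: "\<And>g h. g \<in> A \<Longrightarrow> h \<in> B \<Longrightarrow> g + h \<in> Q"
    and F: "terms_in A F" and G: "terms_in B G"
  shows "terms_in Q (F * G)"
proof (rule poly_mapping_induct[of "\<lambda>F. terms_in Q (F * G)"])
  fix u assume u: "u \<in> supp F"
  show "terms_in Q (monomial u (coeff F u) * G)"
    unfolding terms_in_def
  proof
    fix w assume w: "w \<in> supp (monomial u (coeff F u) * G)"
    then have nz: "coeff F u \<noteq> 0" "coeff G (w - u) \<noteq> 0"
      by (auto simp: in_keys_iff lookup_single_mult)
    then have "tterm F u \<in> A" "tterm G (w - u) \<in> B"
      using F G by (auto simp: terms_in_def in_keys_iff)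
    from AB[OF this] show "tterm (monomial u (coeff F u) * G) w \<in> Q"
      using nz by (simp add: tterm_def lookup_single_mult lv_mult)
  qed
qed (auto simp: distrib_right intro: terms_in_add[OF Q])

lemma terms_in_split:
  assumes "terms_in (A \<union> B) F"
  obtains G H where "F = G + H" "terms_in A G" "terms_in B H"
proof
  let ?G = "restrict_poly {u. tterm F u \<in> A} F" and ?H = "restrict_poly {u. tterm F u \<notin> A} F"
  show "F = ?G + ?H" by (rule poly_mapping_eqI) (simp add: lookup_add restrict_poly.rep_eq)
  show "terms_in A ?G"
    by (auto simp: terms_in_def tterm_def in_keys_iff restrict_poly.rep_eq split: if_splits)
  show "terms_in B ?H"
    using assms by (auto simp: terms_in_def tterm_def in_keys_iff restrict_poly.rep_eq split: if_splits)
qed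

end

definition laurent_ideal :: "'m::ab_group_add set \<Rightarrow> ('m \<Rightarrow>\<^sub>0 'k::field) set \<Rightarrow> bool"
  where "laurent_ideal H J \<longleftrightarrow> 0 \<in> J \<and> (\<forall>F\<in>J. supp F \<subseteq> H) \<and> (\<forall>F\<in>J. \<forall>G\<in>J. F + G \<in> J) \<and>
    (\<forall>F\<in>J. \<forall>u\<in>H. \<forall>x. monomial u x * F \<in> J)"

lemma laurent_idealD:
  assumes "laurent_ideal H J"
  shows "0 \<in> J" "F \<in> J \<Longrightarrow> u \<in> supp F \<Longrightarrow> u \<in> H" "F \<in> J \<Longrightarrow> G \<in> J \<Longrightarrow> F + G \<in> J"
    "F \<in> J \<Longrightarrow> u \<in> H \<Longrightarrow> monomial u x * F \<in> J"
  using assms unfolding laurent_ideal_def by blast+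

lemma laurent_ideal_mult:
  assumes "laurent_ideal H J" "F \<in> J" "supp p \<subseteq> H"
  shows "p * F \<in> J"
proof (rule poly_mapping_induct[of "\<lambda>p. p * F \<in> J"])
  show "monomial u (coeff p u) * F \<in> J" if "u \<in> supp p" for u
    using that assms(2,3) laurent_idealD(4)[OF assms(1)] by blast
qed (use laurent_idealD[OF assms(1)] in \<open>auto simp: distrib_right\<close>)

lemma laurent_ideal_diff:
  assumes "laurent_ideal H J" "add_subgroup H" "F \<in> J" "G \<in> J"
  shows "F - G \<in> J"
proof -
  have "monomial 0 (- 1) * G \<in> J"
    using laurent_idealD(4)[OF assms(1,4)] add_subgroupD(1)[OF assms(2)] by blast
  then have "- G \<in> J" by (simp add: single_uminus)
  then show ?thesis using laurent_idealD(3)[OF assms(1,3)] by fastforce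
qed

section \<open>Extending a strict cone to a tropical order\<close>

text \<open>If \<open>Q\<close> plays the role of a maximal ideal, \<open>shifts n g Q\<close> contains the terms of the polynomials of
degree at most \<open>n\<close> in the term \<open>g\<close> with coefficients in that ideal. The term \<open>g\<close> may have any real value,
also one that no element of the field has, so it is represented by a shift and not by a polynomial.\<close>

definition shift :: "nat \<Rightarrow> 'g::ab_group_add \<Rightarrow> 'g set \<Rightarrow> 'g set"
  where "shift i g Q = (\<lambda>q. q + nmult i g) ` Q"

definition shifts :: "nat \<Rightarrow> 'g::ab_group_add \<Rightarrow> 'g set \<Rightarrow> 'g set"
  where "shifts n g Q = (\<Union>i\<le>n. shift i g Q)"

lemma shift_0: "shift 0 g Q = Q"
  by (simp add: shift_def)

lemma shifts_0: "shifts 0 g Q = Q"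
  by (simp add: shifts_def shift_0)

lemma shifts_Suc: "shifts (Suc n) g Q = shifts n g Q \<union> shift (Suc n) g Q"
  by (auto simp: shifts_def atMost_Suc)

lemma shifts_mono: "m \<le> n \<Longrightarrow> shifts m g Q \<subseteq> shifts n g Q"
  by (force simp: shifts_def)

lemma shift_add_shift:
  assumes "\<And>q r. q \<in> Q \<Longrightarrow> r \<in> Q \<Longrightarrow> q + r \<in> Q" "a \<in> shift i g Q" "b \<in> shift j g Q"
  shows "a + b \<in> shift (i + j) g Q"
proof -
  obtain q r where "q \<in> Q" "r \<in> Q" "a = q + nmult i g" "b = r + nmult j g"
    using assms(2,3) by (auto simp: shift_def)
  moreover from this have "a + b = (q + r) + nmult (i + j) g" by (simp add: nmult_add ac_simps)
  ultimately show ?thesis using assms(1) unfolding shift_def by blast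
qed

lemma value_closed_shift: "value_closed Q \<Longrightarrow> value_closed (shift i g Q)"
  unfolding value_closed_def
proof (intro allI impI)
  fix s u t assume *: "\<forall>s u t. (s, u) \<in> Q \<longrightarrow> t \<le> s \<longrightarrow> (t, u) \<in> Q" "(s, u) \<in> shift i g Q" "t \<le> (s::real)"
  then obtain q where q: "q \<in> Q" "(s, u) = q + nmult i g" by (auto simp: shift_def)
  then have "(fst q + (t - s), snd q) \<in> Q" using *(1,3) by (cases q) auto
  moreover have "(t, u) = (fst q + (t - s), snd q) + nmult i g"
    using q(2) by (cases q, cases "nmult i g") auto
  ultimately show "(t, u) \<in> shift i g Q" unfolding shift_def by blast
qed

lemma value_closed_UN: "(\<And>i. i \<in> I \<Longrightarrow> value_closed (Q i)) \<Longrightarrow> value_closed (\<Union>i\<in>I. Q i)"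
  unfolding value_closed_def by blast

lemma value_closed_shifts: "value_closed Q \<Longrightarrow> value_closed (shifts n g Q)"
  unfolding shifts_def by (intro value_closed_UN value_closed_shift)

context nonarchimedean
begin

text \<open>A candidate for the set of terms strictly below \<open>1\<close>. The last condition is the tropical counterpart
of \<open>1\<close> not lying in the maximal ideal of a local ring dominating the valuation ring.\<close>

definition admissible :: "'m::ab_group_add set \<Rightarrow> ('m \<Rightarrow>\<^sub>0 'k) set \<Rightarrow> (real \<times> 'm) set \<Rightarrow> bool"
  where "admissible H J Q \<longleftrightarrow> (\<forall>q\<in>Q. snd q \<in> H) \<and> (\<forall>q\<in>Q. \<forall>r\<in>Q. q + r \<in> Q) \<and>
    (\<forall>s<0. (s, 0) \<in> Q) \<and> value_closed Q \<and> \<not> (\<exists>F\<in>J. terms_in Q (F - 1))"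

lemma admissibleD:
  assumes "admissible H J Q"
  shows "q \<in> Q \<Longrightarrow> snd q \<in> H" "q \<in> Q \<Longrightarrow> r \<in> Q \<Longrightarrow> q + r \<in> Q" "s < 0 \<Longrightarrow> (s, 0) \<in> Q"
    "value_closed Q" "F \<in> J \<Longrightarrow> \<not> terms_in Q (F - 1)"
  using assms unfolding admissible_def by blast+

lemma admissible_no_zero:
  assumes "admissible H J Q" "laurent_ideal H J"
  shows "0 \<notin> Q"
proof
  assume "0 \<in> Q"
  then have "terms_in Q (0 - 1)"
    by (simp add: terms_in_uminus) (simp add: terms_in_def tterm_def zero_prod_def)
  then show False using admissibleD(5)[OF assms(1)] laurent_idealD(1)[OF assms(2)] by blast
qed

lemma nmult_in_subgroup: "add_subgroup H \<Longrightarrow> u \<in> H \<Longrightarrow> nmult i u \<in> H"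
  by (induction i) (auto intro: add_subgroupD)

lemma shifts_in_subgroup:
  assumes "add_subgroup H" "admissible H J Q" "snd g \<in> H" "q \<in> shifts n g Q"
  shows "snd q \<in> H"
  using assms(4) admissibleD(1)[OF assms(2)] nmult_in_subgroup[OF assms(1,3)] add_subgroupD(2)[OF assms(1)]
  by (auto simp: shifts_def shift_def snd_nmult)

lemma keys_of_terms_in:
  assumes "terms_in Q F" "\<And>q. q \<in> Q \<Longrightarrow> snd q \<in> H"
  shows "supp F \<subseteq> H"
  using assms by (force simp: terms_in_def tterm_def)

text \<open>The cancellation step of Chevalley's extension theorem. Write \<open>F = 1 + a + p\<close> with \<open>p\<close> of top degree
  in \<open>g\<close> and \<open>G = 1 + b + r\<close> with the terms of \<open>r\<close> in \<open>B\<close>. In \<open>(1 + b) F - p G\<close> the summand \<open>p\<close> cancels and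
  leaves \<open>p r\<close>, which has smaller degree by the assumption on \<open>B\<close>. So \<open>n\<close> was not minimal.\<close>

lemma admissible_degree_reduction:
  fixes J :: "('m::ab_group_add \<Rightarrow>\<^sub>0 'k) set"
  assumes H: "add_subgroup H" and J: "laurent_ideal H J" and Q: "admissible H J Q"
    and g: "snd g \<in> H"
    and F: "F \<in> J" "terms_in (shifts n g Q) (F - 1)"
    and min: "\<And>m F. m < n \<Longrightarrow> F \<in> J \<Longrightarrow> \<not> terms_in (shifts m g Q) (F - 1)"
    and G: "G \<in> J" "terms_in (Q \<union> B) (G - 1)"
    and B: "\<And>q b. 0 < n \<Longrightarrow> q \<in> shift n g Q \<Longrightarrow> b \<in> B \<Longrightarrow> q + b \<in> shifts (n - 1) g Q"
  shows False
proof -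
  obtain m where n: "n = Suc m"
    using F admissibleD(5)[OF Q F(1)] by (cases n) (auto simp: shifts_0)
  obtain a p where ap: "F - 1 = a + p" "terms_in (shifts m g Q) a" "terms_in (shift n g Q) p"
    using terms_in_split F(2) unfolding n shifts_Suc by blast
  obtain b r where br: "G - 1 = b + r" "terms_in Q b" "terms_in B r"
    using terms_in_split G(2) by blast
  let ?F = "(1 + b) * F - p * G"
  have "supp b \<subseteq> H" using keys_of_terms_in[OF br(2)] admissibleD(1)[OF Q] by blast
  then have "supp (1 + b) \<subseteq> H"
    using Poly_Mapping.keys_add[of 1 b] add_subgroupD(1)[OF H] by auto
  moreover have "shift n g Q \<subseteq> shifts n g Q" by (auto simp: shifts_def)
  then have "supp p \<subseteq> H"
    using keys_of_terms_in[OF ap(3), of H] shifts_in_subgroup[OF H Q g] by blast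
  ultimately have "?F \<in> J"
    using laurent_ideal_diff[OF J H] laurent_ideal_mult[OF J] F(1) G(1) by blast
  moreover have "?F - 1 = a + b + b * a - p * r"
  proof -
    have "F = 1 + a + p" "G = 1 + b + r" using ap(1) br(1) by (simp_all add: algebra_simps)
    then show ?thesis by (simp add: algebra_simps)
  qed
  moreover have vc: "value_closed (shifts m g Q)" by (rule value_closed_shifts[OF admissibleD(4)[OF Q]])
  have "terms_in (shifts m g Q) b"
    using br(2) shifts_mono[of 0 m g Q] by (auto simp: shifts_0 intro: terms_in_mono)
  moreover have "terms_in (shifts m g Q) (b * a)"
  proof (rule terms_in_mult[OF vc _ br(2) ap(2)])
    fix q s assume q: "q \<in> Q" and s: "s \<in> shifts m g Q"
    then obtain i where i: "i \<le> m" "s \<in> shift i g Q" by (auto simp: shifts_def)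
    have "q + s \<in> shift (0 + i) g Q"
      using shift_add_shift[OF admissibleD(2)[OF Q], of q 0 g s i] q i by (simp add: shift_0)
    then show "q + s \<in> shifts m g Q" using i by (auto simp: shifts_def)
  qed
  moreover have "terms_in (shifts m g Q) (p * r)"
    by (rule terms_in_mult[OF vc _ ap(3) br(3)]) (use B n in auto)
  ultimately have "terms_in (shifts m g Q) (?F - 1)"
    using ap(2) by (auto intro!: terms_in_add[OF vc] terms_in_diff[OF vc])
  then show False using min[of m ?F] \<open>?F \<in> J\<close> n by simp
qed

lemma terms_in_Union_shifts:
  assumes "terms_in (\<Union>n. shifts n g Q) F"
  shows "\<exists>n. terms_in (shifts n g Q) F"
proof -
  have "\<forall>u\<in>supp F. \<exists>n. tterm F u \<in> shifts n g Q"
    using assms by (auto simp: terms_in_def)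
  then obtain d where d: "\<And>u. u \<in> supp F \<Longrightarrow> tterm F u \<in> shifts (d u) g Q" by metis
  have "tterm F u \<in> shifts (Max (d ` supp F)) g Q" if "u \<in> supp F" for u
    using d[OF that] shifts_mono[of "d u" "Max (d ` supp F)" g Q] that by auto
  then show ?thesis by (auto simp: terms_in_def)
qed

text \<open>A tropical form of Chevalley's extension theorem for valuations. Let \<open>Q\<close> be a maximal admissible
  set and \<open>W\<close> its stabilizer. If neither \<open>g\<close> nor \<open>- g\<close> stabilized \<open>Q\<close>, adjoining either of them would
  destroy admissibility, and the two resulting elements of \<open>J\<close> contradict the reduction step; so \<open>W\<close> is
  total. The same step shows that the strictly negative elements of \<open>W\<close> are exactly those of \<open>Q\<close>. An
  element of \<open>J\<close> that does not bend becomes, after division by its dominant term, an element of the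
  form \<open>1\<close> plus terms in \<open>Q\<close>, which admissibility excludes.\<close>

theorem admissible_extends_to_bending_order:
  fixes J :: "('m::ab_group_add \<Rightarrow>\<^sub>0 'k) set"
  assumes H: "add_subgroup H" and J: "laurent_ideal H J" and Q0: "admissible H J Q0"
  obtains W where "tropical_order H W" "\<And>g. g \<in> Q0 \<Longrightarrow> strict W g" "\<And>F. F \<in> J \<Longrightarrow> bends W F"
proof -
  let ?\<A> = "{Q. admissible H J Q \<and> Q0 \<subseteq> Q}"
  have "\<exists>Q\<in>?\<A>. \<forall>R\<in>?\<A>. Q \<subseteq> R \<longrightarrow> R = Q"
  proof (rule subset_Zorn_nonempty)
    show "?\<A> \<noteq> {}" using Q0 by blast
    fix \<C> assume ne: "\<C> \<noteq> {}" and chain: "subset.chain ?\<A> \<C>"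
    have adm: "\<And>Q. Q \<in> \<C> \<Longrightarrow> admissible H J Q" "\<And>Q. Q \<in> \<C> \<Longrightarrow> Q0 \<subseteq> Q"
      and lin: "\<And>Q R. Q \<in> \<C> \<Longrightarrow> R \<in> \<C> \<Longrightarrow> Q \<subseteq> R \<or> R \<subseteq> Q"
      using chain unfolding subset_chain_def by blast+
    have "admissible H J (\<Union>\<C>)"
      unfolding admissible_def
    proof (intro conjI)
      show "\<forall>q\<in>\<Union>\<C>. snd q \<in> H" using admissibleD(1)[OF adm(1)] by blast
      show "\<forall>q\<in>\<Union>\<C>. \<forall>r\<in>\<Union>\<C>. q + r \<in> \<Union>\<C>"
      proof (intro ballI)
        fix q r assume "q \<in> \<Union>\<C>" "r \<in> \<Union>\<C>"
        then obtain A B where AB: "A \<in> \<C>" "B \<in> \<C>" "q \<in> A" "r \<in> B" by blast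
        then obtain C where "C \<in> \<C>" "q \<in> C" "r \<in> C" using lin[OF AB(1,2)] by blast
        then show "q + r \<in> \<Union>\<C>" using admissibleD(2)[OF adm(1), of C q r] by blast
      qed
      show "\<forall>s<0. (s, 0) \<in> \<Union>\<C>" using admissibleD(3)[OF adm(1)] ne by blast
      show "value_closed (\<Union>\<C>)"
        using value_closed_UN[of \<C> id] admissibleD(4)[OF adm(1)] by simp
      show "\<not> (\<exists>F\<in>J. terms_in (\<Union>\<C>) (F - 1))"
      proof
        assume "\<exists>F\<in>J. terms_in (\<Union>\<C>) (F - 1)"
        then obtain F where F: "F \<in> J" "terms_in (\<Union>\<C>) (F - 1)" by blast
        have "tterm (F - 1) ` supp (F - 1) \<subseteq> \<Union>\<C>" using F(2) by (auto simp: terms_in_def)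
        then obtain Q where "Q \<in> \<C>" "tterm (F - 1) ` supp (F - 1) \<subseteq> Q"
          by (rule finite_subset_Union_chain[OF finite_imageI[OF finite_keys] _ ne chain])
        then have "Q \<in> \<C>" "terms_in Q (F - 1)" by (auto simp: terms_in_def)
        then show False using admissibleD(5)[OF adm(1) F(1)] by blast
      qed
    qed
    then show "\<Union>\<C> \<in> ?\<A>" using adm(2) ne by blast
  qed
  then obtain Q where Q: "admissible H J Q" and Q0Q: "Q0 \<subseteq> Q"
    and "\<forall>R\<in>?\<A>. Q \<subseteq> R \<longrightarrow> R = Q" by blast
  then have max: "R = Q" if "admissible H J R" "Q \<subseteq> R" for R using that by blast
  note QD = admissibleD[OF Q]
  define W where "W = {g. snd g \<in> H \<and> (\<forall>q\<in>Q. q + g \<in> Q)}"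
  have zQ: "0 \<notin> Q" by (rule admissible_no_zero[OF Q J])
  have W_add: "g + h \<in> W" if "g \<in> W" "h \<in> W" for g h
  proof -
    have "q + (g + h) \<in> Q" if "q \<in> Q" for q
      using that \<open>g \<in> W\<close> \<open>h \<in> W\<close> unfolding W_def by (simp add: add.assoc[symmetric])
    then show ?thesis using that add_subgroupD(2)[OF H] by (simp add: W_def)
  qed
  have QW: "Q \<subseteq> W" using QD(1,2) unfolding W_def by blast
  \<comment> \<open>adjoining an element outside \<open>W\<close> to \<open>Q\<close> destroys admissibility\<close>
  have adjoin: "\<exists>n. \<exists>F\<in>J. terms_in (shifts n g Q) (F - 1)" if g: "snd g \<in> H" "g \<notin> W" for g
  proof (rule ccontr)
    assume no: "\<nexists>n. \<exists>F\<in>J. terms_in (shifts n g Q) (F - 1)"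
    let ?R = "\<Union>n. shifts n g Q"
    have QR: "Q \<subseteq> ?R" using shifts_0[of g Q] by blast
    have "admissible H J ?R"
      unfolding admissible_def
    proof (intro conjI ballI)
      show "snd q \<in> H" if "q \<in> ?R" for q using that shifts_in_subgroup[OF H Q g(1)] by blast
      show "q + r \<in> ?R" if qr: "q \<in> ?R" "r \<in> ?R" for q r
      proof -
        obtain i j where "q \<in> shift i g Q" "r \<in> shift j g Q" using qr by (auto simp: shifts_def)
        then have "q + r \<in> shift (i + j) g Q" using shift_add_shift[OF QD(2)] by blast
        then show ?thesis by (auto simp: shifts_def)
      qed
      show "\<forall>s<0. (s, 0) \<in> ?R" using QD(3) QR by blast
      show "value_closed ?R" by (intro value_closed_UN value_closed_shifts QD(4))
      show "\<not> (\<exists>F\<in>J. terms_in ?R (F - 1))" using no terms_in_Union_shifts by blast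
    qed
    then have "?R = Q" using max QR by blast
    moreover have "q + g \<in> ?R" if "q \<in> Q" for q
      using that by (auto simp: shifts_def shift_def intro!: exI[of _ 1] bexI[of _ 1] image_eqI[of _ _ q])
    ultimately have "g \<in> W" using g(1) unfolding W_def by blast
    then show False using g(2) by blast
  qed
  define bad where "bad g n \<longleftrightarrow> (\<exists>F\<in>J. terms_in (shifts n g Q) (F - 1))" for g n
  have total: "g \<in> W \<or> - g \<in> W" if g: "snd g \<in> H" for g
  proof (rule ccontr)
    assume no: "\<not> (g \<in> W \<or> - g \<in> W)"
    have gm: "snd (- g) \<in> H" using g add_subgroupD(3)[OF H] by simp
    have ex: "\<exists>n. bad g n" "\<exists>n. bad (- g) n" using adjoin[OF g] adjoin[OF gm] no by (auto simp: bad_def)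
    have *: False if h: "snd h \<in> H" and n: "bad h n" "\<And>k. k < n \<Longrightarrow> \<not> bad h k"
      and m: "bad (- h) m" "m \<le> n" for h n m
    proof -
      obtain F where F: "F \<in> J" "terms_in (shifts n h Q) (F - 1)" using n(1) by (auto simp: bad_def)
      obtain G where G: "G \<in> J" "terms_in (shifts m (- h) Q) (G - 1)" using m(1) by (auto simp: bad_def)
      \<comment> \<open>the terms of positive degree in \<open>- h\<close>, each of which lowers the degree in \<open>h\<close>\<close>
      let ?B = "\<Union>i\<in>{1..m}. shift i (- h) Q"
      have "shifts m (- h) Q \<subseteq> Q \<union> ?B"
      proof
        fix x assume "x \<in> shifts m (- h) Q"
        then obtain i where "i \<le> m" "x \<in> shift i (- h) Q" by (auto simp: shifts_def)
        then show "x \<in> Q \<union> ?B" by (cases i) (auto simp: shift_0 intro!: bexI[of _ i])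
      qed
      then have G': "terms_in (Q \<union> ?B) (G - 1)" using G(2) terms_in_mono by blast
      show False
      proof (rule admissible_degree_reduction[OF H J Q h F _ G(1) G'])
        show "\<not> terms_in (shifts k h Q) (F - 1)" if "k < n" "F \<in> J" for k F
          using n(2)[OF that(1)] that(2) by (auto simp: bad_def)
        fix q b assume "q \<in> shift n h Q" "b \<in> ?B"
        then obtain q' b' i where q: "q' \<in> Q" "q = q' + nmult n h"
          and b: "b' \<in> Q" "b = b' + nmult i (- h)" and i: "1 \<le> i" "i \<le> m"
          by (auto simp: shift_def)
        have "nmult n h = nmult (n - i) h + nmult i h" using nmult_add[of "n - i" i h] i m(2) by simp
        then have "q + b = (q' + b') + nmult (n - i) h" using q b by (simp add: nmult_minus)
        moreover have "q' + b' \<in> Q" using QD(2) q b by blast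
        moreover have "n - i \<le> n - 1" using i by simp
        ultimately show "q + b \<in> shifts (n - 1) h Q" by (auto simp: shifts_def shift_def)
      qed
    qed
    let ?n = "LEAST n. bad g n" and ?m = "LEAST n. bad (- g) n"
    have l: "bad g ?n" "bad (- g) ?m" using ex by (metis LeastI)+
    show False
    proof (cases "?m \<le> ?n")
      case True
      then show False using *[OF g l(1) _ l(2)] not_less_Least by blast
    next
      case False
      then show False using *[OF gm l(2), of ?n] l(1) not_less_Least by fastforce
    qed
  qed
  have strictQ: "g \<in> Q" if g: "g \<in> W" "- g \<notin> W" for g
  proof (rule ccontr)
    assume gQ: "g \<notin> Q"
    have gH: "snd g \<in> H" "snd (- g) \<in> H" using g(1) add_subgroupD(3)[OF H] by (auto simp: W_def)
    \<comment> \<open>the terms divisible by \<open>g\<close>, each of which lowers the degree in \<open>- g\<close>\<close>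
    let ?B = "(\<lambda>w. g + w) ` W"
    have z: "0 \<in> W" using add_subgroupD(1)[OF H] by (simp add: W_def)
    then have gB: "g \<in> ?B" by (auto intro!: image_eqI[of _ _ 0])
    have sW: "(s, 0) \<in> W" if "s \<le> 0" for s
      using that QD(4) add_subgroupD(1)[OF H] unfolding W_def value_closed_def by fastforce
    have "\<not> admissible H J (Q \<union> ?B)" using max[of "Q \<union> ?B"] gB gQ by blast
    moreover have "snd q \<in> H" if "q \<in> Q \<union> ?B" for q
      using that QD(1)[of q] gH(1) add_subgroupD(2)[OF H] by (auto simp: W_def)
    moreover have "q + r \<in> Q \<union> ?B" if "q \<in> Q \<union> ?B" "r \<in> Q \<union> ?B" for q r
    proof -
      have BW: "?B \<subseteq> W" using W_add g(1) by blast
      have *: "q + r \<in> Q \<union> ?B" if qr: "q \<in> Q \<union> ?B" "r \<in> W" for q r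
      proof (cases "q \<in> Q")
        case True
        then show ?thesis using qr(2) by (auto simp: W_def)
      next
        case False
        then obtain w where "w \<in> W" "q = g + w" using qr(1) by blast
        then have "q + r = g + (w + r)" "w + r \<in> W" using W_add qr(2) by (auto simp: add.assoc)
        then show ?thesis by blast
      qed
      show ?thesis using *[OF that(1)] that(2) QW BW by blast
    qed
    moreover have "\<forall>s<0. (s, 0) \<in> Q \<union> ?B" using QD(3) by blast
    moreover have "value_closed (Q \<union> ?B)"
      unfolding value_closed_def
    proof (intro allI impI)
      fix s u t assume su: "(s, u) \<in> Q \<union> ?B" and t: "t \<le> (s::real)"
      show "(t, u) \<in> Q \<union> ?B"
      proof (cases "(s, u) \<in> Q")
        case True
        then show ?thesis using QD(4) t unfolding value_closed_def by blast
      next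
        case False
        then obtain w where w: "w \<in> W" "(s, u) = g + w" using su by blast
        have "(t, u) = (s, u) + (t - s, 0)" by simp
        then have "(t, u) = g + (w + (t - s, 0))" using w(2) by (simp add: add.assoc)
        moreover have "w + (t - s, 0) \<in> W" using W_add[OF w(1) sW] t by simp
        ultimately show ?thesis by blast
      qed
    qed
    ultimately obtain G where G: "G \<in> J" "terms_in (Q \<union> ?B) (G - 1)" unfolding admissible_def by blast
    have ex: "\<exists>n. bad (- g) n" using adjoin[OF gH(2) g(2)] by (auto simp: bad_def)
    let ?n = "LEAST n. bad (- g) n"
    have "bad (- g) ?n" using ex by (metis LeastI)
    then obtain F where F: "F \<in> J" "terms_in (shifts ?n (- g) Q) (F - 1)" by (auto simp: bad_def)
    show False
    proof (rule admissible_degree_reduction[OF H J Q gH(2) F _ G])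
      show "\<not> terms_in (shifts k (- g) Q) (F - 1)" if "k < ?n" "F \<in> J" for k F
        using not_less_Least[OF that(1)] that(2) by (auto simp: bad_def)
      fix q b assume n: "0 < ?n" and "q \<in> shift ?n (- g) Q" "b \<in> ?B"
      then obtain q' w where q: "q' \<in> Q" "q = q' + nmult ?n (- g)" and w: "w \<in> W" "b = g + w"
        by (auto simp: shift_def)
      have "nmult ?n (- g) = - g + nmult (?n - 1) (- g)" using n by (cases ?n) auto
      then have "q + b = (q' + w) + nmult (?n - 1) (- g)" using q w by simp
      moreover have "q' + w \<in> Q" using q w by (auto simp: W_def)
      ultimately show "q + b \<in> shifts (?n - 1) (- g) Q" unfolding shifts_def shift_def by blast
    qed
  qed
  have Qstrict: "strict W g" if "g \<in> Q" for g
  proof -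
    have "- g \<notin> W" using that zQ by (force simp: W_def)
    then show ?thesis using that QW by (auto simp: strict_def)
  qed
  show ?thesis
  proof (rule that[of W])
    show "tropical_order H W"
      unfolding tropical_order_def
    proof (intro conjI allI impI ballI)
      show "snd g \<in> H" if "g \<in> W" for g using that by (simp add: W_def)
      show "g + h \<in> W" if "g \<in> W" "h \<in> W" for g h using W_add that .
      show "g \<in> W \<or> - g \<in> W" if "snd g \<in> H" for g using total that .
      fix s :: real
      show "(s, 0) \<in> W \<longleftrightarrow> s \<le> 0"
      proof
        show "s \<le> 0" if "(s, 0) \<in> W"
        proof (rule ccontr)
          assume "\<not> s \<le> 0"
          then have "(- s, 0) \<in> Q" by (intro QD(3)) simp
          then have "(- s, 0) + (s, 0) \<in> Q" using that unfolding W_def by blast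
          then show False using zQ by (simp add: zero_prod_def)
        qed
        show "(s, 0) \<in> W" if "s \<le> 0"
          using that QD(4) add_subgroupD(1)[OF H] unfolding W_def value_closed_def by fastforce
      qed
    qed
    show "strict W g" if "g \<in> Q0" for g using that Q0Q Qstrict by blast
    fix F assume F: "F \<in> J"
    show "bends W F"
      unfolding bends_def
    proof
      assume "\<exists>u\<in>supp F. \<forall>w\<in>supp F - {u}. strict W (tterm F w - tterm F u)"
      then obtain u where u: "u \<in> supp F"
        and dom: "\<And>w. w \<in> supp F \<Longrightarrow> w \<noteq> u \<Longrightarrow> strict W (tterm F w - tterm F u)" by blast
      let ?c = "coeff F u"
      let ?G = "monomial (- u) (inverse ?c) * F"
      have c: "?c \<noteq> 0" using u by (simp add: in_keys_iff)
      have "- u \<in> H" using u laurent_idealD(2)[OF J F] add_subgroupD(3)[OF H] by blast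
      then have "?G \<in> J" using laurent_idealD(4)[OF J F] by blast
      moreover have "terms_in Q (?G - 1)"
        unfolding terms_in_def
      proof
        fix w assume w: "w \<in> supp (?G - 1)"
        have l: "coeff (?G - 1) w = inverse ?c * coeff F (w + u) - (1 when w = 0)"
          by (simp add: lookup_minus lookup_single_mult lookup_one)
        have w0: "w \<noteq> 0" using w l c by (auto simp: in_keys_iff)
        then have nz: "coeff F (w + u) \<noteq> 0" using w l by (auto simp: in_keys_iff)
        have lvi: "lv (inverse ?c) = - lv ?c" using lv_mult[of ?c "inverse ?c"] c by simp
        have "tterm (?G - 1) w = tterm F (w + u) - tterm F u"
          unfolding tterm_def l using w0 c nz by (simp add: lv_mult lvi)
        moreover have "strict W (tterm F (w + u) - tterm F u)"
          using dom[of "w + u"] nz w0 by (simp add: in_keys_iff)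
        ultimately show "tterm (?G - 1) w \<in> Q" using strictQ by (auto simp: strict_def)
      qed
      ultimately show False using QD(5) by blast
    qed
  qed
qed

end

section \<open>Refining a tropical order by a tie breaker\<close>

text \<open>The negative cone of a translation invariant total order, which makes leading terms unique.\<close>

definition tie_breaker :: "'m::ab_group_add set \<Rightarrow> bool"
  where "tie_breaker N \<longleftrightarrow> 0 \<notin> N \<and> (\<forall>u\<in>N. \<forall>w\<in>N. u + w \<in> N) \<and> (\<forall>u. u \<noteq> 0 \<longrightarrow> u \<in> N \<or> - u \<in> N)"

lemma tie_breakerD:
  assumes "tie_breaker N"
  shows "0 \<notin> N" "u \<in> N \<Longrightarrow> w \<in> N \<Longrightarrow> u + w \<in> N" "u \<noteq> 0 \<Longrightarrow> u \<in> N \<or> - u \<in> N"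
  using assms unfolding tie_breaker_def by blast+

lemma lexicographic_tie_breaker:
  assumes c: "coordinates n c"
  shows "tie_breaker {u. \<exists>i<n. c u i < 0 \<and> (\<forall>j<i. c u j = 0)}" (is "tie_breaker ?N")
  unfolding tie_breaker_def
proof (intro conjI ballI allI impI)
  show "0 \<notin> ?N" by (simp add: coordinates_zero[OF c])
  show "u + w \<in> ?N" if uw: "u \<in> ?N" "w \<in> ?N" for u w
  proof -
    obtain i where i: "i < n" "c u i < 0" "\<forall>k<i. c u k = 0" using uw(1) by blast
    obtain j where j: "j < n" "c w j < 0" "\<forall>k<j. c w k = 0" using uw(2) by blast
    have "c (u + w) (min i j) < 0"
      using i j by (cases i j rule: linorder_cases) (simp_all add: coordinates_add[OF c])
    moreover have "\<forall>k<min i j. c (u + w) k = 0" using i j by (simp add: coordinates_add[OF c])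
    ultimately show ?thesis using i(1) by (auto intro!: exI[of _ "min i j"])
  qed
  fix u :: 'a assume "u \<noteq> 0"
  then have ex: "\<exists>i. i < n \<and> c u i \<noteq> 0" using coordinates_eq_0[OF c] by blast
  define i where "i = (LEAST i. i < n \<and> c u i \<noteq> 0)"
  have i: "i < n" "c u i \<noteq> 0" unfolding i_def using LeastI_ex[OF ex] by auto
  have z: "c u j = 0" if "j < i" for j using not_less_Least[of j "\<lambda>i. i < n \<and> c u i \<noteq> 0"] that i(1) unfolding i_def by auto
  show "u \<in> ?N \<or> - u \<in> ?N"
  proof (cases "c u i < 0")
    case True
    then have "u \<in> ?N" using i(1) z by blast
    then show ?thesis ..
  next
    case False
    then have "c (- u) i < 0" "\<forall>j<i. c (- u) j = 0" using i(2) z by (auto simp: coordinates_minus[OF c])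
    then have "- u \<in> ?N" using i(1) by blast
    then show ?thesis ..
  qed
qed

definition refine :: "(real \<times> 'm::ab_group_add) set \<Rightarrow> 'm set \<Rightarrow> (real \<times> 'm) set"
  where "refine W N = {g. strict W g \<or> (tie W g \<and> snd g \<in> N)}"

lemma refine_subset: "refine W N \<subseteq> W"
  by (auto simp: refine_def strict_def tie_def)

lemma refine_add:
  assumes "tropical_order H W" "tie_breaker N" "g \<in> refine W N" "h \<in> refine W N"
  shows "g + h \<in> refine W N"
proof (cases "strict W g \<or> strict W h")
  case True
  then have "strict W (g + h)"
    using strict_add[OF assms(1), of g h] strict_add[OF assms(1), of h g] assms(3,4) refine_subset[of W N]
    by (auto simp: add.commute)
  then show ?thesis by (simp add: refine_def)
next
  case False
  then show ?thesis using assms(3,4) tie_add[OF assms(1)] tie_breakerD(2)[OF assms(2)]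
    by (auto simp: refine_def)
qed

lemma refine_const:
  assumes "tropical_order H W" "tie_breaker N"
  shows "(s, 0) \<in> refine W N \<longleftrightarrow> s < 0"
  using strict_const[OF assms(1)] tie_breakerD(1)[OF assms(2)] by (auto simp: refine_def)

lemma refine_total:
  assumes H: "add_subgroup H" and W: "tropical_order H W" and N: "tie_breaker N"
    and g: "snd g \<in> H" "g \<noteq> 0"
  shows "g \<in> refine W N \<or> - g \<in> refine W N"
proof -
  have "strict W g \<or> strict W (- g) \<or> tie W g" using tropical_orderD(3)[OF W g(1)] by (auto simp: strict_def tie_def)
  moreover have "snd g \<noteq> 0" if "tie W g"
    using that g(2) tie_const[OF W, of "fst g"] by (cases g) (auto simp: zero_prod_def)
  ultimately show ?thesis using tie_breakerD(3)[OF N, of "snd g"] by (auto simp: refine_def tie_minus)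
qed

lemma refine_max:
  assumes H: "add_subgroup H" and W: "tropical_order H W" and N: "tie_breaker N"
    and "finite A" "A \<noteq> {}" "\<And>x. x \<in> A \<Longrightarrow> snd x \<in> H"
  shows "\<exists>m\<in>A. \<forall>x\<in>A. x \<noteq> m \<longrightarrow> x - m \<in> refine W N"
  using assms(4-6)
proof (induction A rule: finite_ne_induct)
  case (insert a A)
  then obtain m where m: "m \<in> A" "\<forall>x\<in>A. x \<noteq> m \<longrightarrow> x - m \<in> refine W N" by blast
  have "snd (a - m) \<in> H" "a - m \<noteq> 0"
    using insert m add_subgroupD(4)[OF H] by auto
  from refine_total[OF H W N this] consider "a - m \<in> refine W N" | "m - a \<in> refine W N" by auto
  then show ?case
  proof cases
    case 1
    then show ?thesis using m by blast
  next
    case 2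
    have "x - a \<in> refine W N" if "x \<in> A" for x
      using refine_add[OF W N, of "x - m" "m - a"] m(2) that 2 by (cases "x = m") auto
    then show ?thesis by blast
  qed
qed auto

section \<open>Linear algebra of leading terms\<close>

text \<open>Gaussian elimination on the set of equations.\<close>

lemma ex_nontrivial_relation:
  fixes x :: "'i \<Rightarrow> 'm \<Rightarrow> 'k::field"
  assumes "finite L" "finite I" "card L < card I"
  shows "\<exists>c. (\<exists>i\<in>I. c i \<noteq> 0) \<and> (\<forall>l\<in>L. (\<Sum>i\<in>I. c i * x i l) = 0)"
  using assms
proof (induction L arbitrary: I x rule: finite_induct)
  case empty
  then obtain i where "i \<in> I" by (metis card.empty ex_in_conv less_irrefl)
  then show ?case by (intro exI[of _ "\<lambda>_. 1"]) auto
next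
  case (insert a L)
  show ?case
  proof (cases "\<forall>i\<in>I. x i a = 0")
    case True
    have "card L < card I" using insert by simp
    then obtain c where "\<exists>i\<in>I. c i \<noteq> 0" "\<forall>l\<in>L. (\<Sum>i\<in>I. c i * x i l) = 0"
      using insert.IH[OF insert.prems(1), of x] by blast
    then show ?thesis using True by (intro exI[of _ c]) simp
  next
    case False
    then obtain p where p: "p \<in> I" "x p a \<noteq> 0" by blast
    define y where "y i l = x i l - x i a / x p a * x p l" for i l
    have "card L < card (I - {p})" using insert p by simp
    then obtain c where c: "\<exists>i\<in>I - {p}. c i \<noteq> 0" "\<forall>l\<in>L. (\<Sum>i\<in>I - {p}. c i * y i l) = 0"
      using insert.IH[of "I - {p}" y] insert.prems(1) by blast
    define d where "d = c(p := - (\<Sum>i\<in>I - {p}. c i * x i a / x p a))"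
    have sum: "(\<Sum>i\<in>I. d i * x i l) = (\<Sum>i\<in>I - {p}. c i * y i l)" for l
    proof -
      have "(\<Sum>i\<in>I. d i * x i l) = d p * x p l + (\<Sum>i\<in>I - {p}. d i * x i l)"
        using p(1) insert.prems(1) by (simp add: sum.remove)
      also have "(\<Sum>i\<in>I - {p}. d i * x i l) = (\<Sum>i\<in>I - {p}. c i * x i l)"
        by (intro sum.cong) (auto simp: d_def)
      also have "d p * x p l = - (\<Sum>i\<in>I - {p}. c i * (x i a / x p a * x p l))"
        by (simp add: d_def sum_distrib_right mult.assoc)
      finally show ?thesis by (simp add: y_def right_diff_distrib sum_subtractf)
    qed
    have "(\<Sum>i\<in>I. d i * x i a) = 0" unfolding sum y_def using p(2) by simp
    moreover have "\<exists>i\<in>I. d i \<noteq> 0" using c(1) by (auto simp: d_def)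
    ultimately show ?thesis using c(2) sum by (intro exI[of _ d]) simp
  qed
qed

definition lincomb :: "'m::ab_group_add set \<Rightarrow> ('m \<Rightarrow> 'k::field) \<Rightarrow> ('m \<Rightarrow> 'm \<Rightarrow>\<^sub>0 'k) \<Rightarrow> 'm \<Rightarrow>\<^sub>0 'k"
  where "lincomb L c h = (\<Sum>b\<in>L. monomial 0 (c b) * h b)"

lemma lookup_lincomb: "coeff (lincomb L c h) w = (\<Sum>b\<in>L. c b * coeff (h b) w)"
  by (simp add: lincomb_def lookup_sum lookup_single_mult)

text \<open>A dimension count. The map to the coordinates in \<open>L\<close> is injective on the span of \<open>F\<close> and the \<open>h b\<close>, so
these card \<open>L\<close> + 1 elements are dependent; as the \<open>h b\<close> are independent, \<open>F\<close> occurs in the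
relation.\<close>

lemma ex_lincomb:
  fixes F :: "'m::ab_group_add \<Rightarrow>\<^sub>0 'k::field"
  assumes fin: "finite L"
    and inj: "\<And>x c. \<forall>b\<in>L. coeff (monomial 0 x * F + lincomb L c h) b = 0 \<Longrightarrow>
      monomial 0 x * F + lincomb L c h = 0"
    and indep: "\<And>c. \<exists>b\<in>L. c b \<noteq> 0 \<Longrightarrow> lincomb L c h \<noteq> 0"
  shows "\<exists>c. F = lincomb L c h"
proof -
  define x where "x i = (case i of None \<Rightarrow> coeff F | Some b \<Rightarrow> coeff (h b))" for i
  let ?I = "insert None (Some ` L)"
  have "card L < card ?I" using fin by (simp add: card_image)
  then obtain c where c: "\<exists>i\<in>?I. c i \<noteq> 0" "\<forall>l\<in>L. (\<Sum>i\<in>?I. c i * x i l) = 0"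
    using ex_nontrivial_relation[OF fin, of ?I x] fin by auto
  let ?d = "\<lambda>b. c (Some b)"
  have "coeff (monomial 0 (c None) * F + lincomb L ?d h) l = (\<Sum>i\<in>?I. c i * x i l)" for l
    using fin by (simp add: lookup_add lookup_single_mult lookup_lincomb sum.reindex x_def)
  then have z: "monomial 0 (c None) * F + lincomb L ?d h = 0" using inj[of "c None" ?d] c(2) by simp
  have n: "c None \<noteq> 0"
  proof
    assume "c None = 0"
    then show False using z indep[of ?d] c(1) by auto
  qed
  have "F = lincomb L (\<lambda>b. - ?d b / c None) h"
  proof (rule poly_mapping_eqI)
    fix w
    have "coeff (monomial 0 (c None) * F + lincomb L ?d h) w = 0" using z by simp
    then have "c None * coeff F w = - (\<Sum>b\<in>L. ?d b * coeff (h b) w)"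
      by (simp add: lookup_add lookup_single_mult lookup_lincomb eq_neg_iff_add_eq_0)
    then have "coeff F w = - (\<Sum>b\<in>L. ?d b * coeff (h b) w) / c None"
      using n by (simp add: field_simps)
    also have "\<dots> = coeff (lincomb L (\<lambda>b. - ?d b / c None) h) w"
      by (simp add: lookup_lincomb sum_divide_distrib sum_negf)
    finally show "coeff F w = coeff (lincomb L (\<lambda>b. - ?d b / c None) h) w" .
  qed
  then show ?thesis by blast
qed

context nonarchimedean
begin

definition leading :: "(real \<times> 'm::ab_group_add) set \<Rightarrow> ('m \<Rightarrow>\<^sub>0 'k) \<Rightarrow> 'm \<Rightarrow> bool"
  where "leading R F u \<longleftrightarrow> u \<in> supp F \<and> (\<forall>w\<in>supp F - {u}. tterm F w - tterm F u \<in> R)"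

lemma ex_leading:
  assumes "add_subgroup H" "tropical_order H W" "tie_breaker N"
    and "F \<noteq> 0" "supp F \<subseteq> H"
  obtains u where "leading (refine W N) F u"
proof -
  have "\<exists>m\<in>tterm F ` supp F. \<forall>x\<in>tterm F ` supp F. x \<noteq> m \<longrightarrow> x - m \<in> refine W N"
    using assms(4,5) by (intro refine_max[OF assms(1-3)]) (auto simp: tterm_def)
  then obtain u where "u \<in> supp F"
    "\<forall>w\<in>supp F. tterm F w \<noteq> tterm F u \<longrightarrow> tterm F w - tterm F u \<in> refine W N" by auto
  then show ?thesis by (intro that[of u]) (auto simp: leading_def tterm_def)
qed

text \<open>Elements with distinct leading terms cannot cancel each other's largest term. The consequence in
terms of \<open>W\<close> is that a combination dominates all of its summands.\<close>

lemma lincomb_leading: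
  assumes H: "add_subgroup H" and W: "tropical_order H W" and N: "tie_breaker N"
    and L: "finite L" "L \<subseteq> H" and ex: "\<exists>b\<in>L. c b \<noteq> 0"
    and one: "\<And>b. b \<in> L \<Longrightarrow> coeff (h b) b = 1"
    and lead: "\<And>b. b \<in> L \<Longrightarrow> leading (refine W N) (h b) b"
  obtains m where "m \<in> L" "c m \<noteq> 0" "\<And>b. b \<in> L \<Longrightarrow> c b \<noteq> 0 \<Longrightarrow> (lv (c b), b) - (lv (c m), m) \<in> W"
    "coeff (lincomb L c h) m \<noteq> 0"
    "lv (coeff (lincomb L c h) m) = lv (c m)"
proof -
  let ?R = "refine W N" and ?S = "{b\<in>L. c b \<noteq> 0}"
  have "\<exists>m\<in>(\<lambda>b. (lv (c b), b)) ` ?S. \<forall>x\<in>(\<lambda>b. (lv (c b), b)) ` ?S. x \<noteq> m \<longrightarrow> x - m \<in> ?R"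
    using L ex by (intro refine_max[OF H W N]) auto
  then obtain m where m: "m \<in> L" "c m \<noteq> 0"
    and dom: "\<And>b. b \<in> L \<Longrightarrow> c b \<noteq> 0 \<Longrightarrow> b \<noteq> m \<Longrightarrow> (lv (c b), b) - (lv (c m), m) \<in> ?R" by auto
  have bel: "below (c b * coeff (h b) m) (lv (c m))" if b: "b \<in> L - {m}" for b
  proof (cases "c b * coeff (h b) m = 0")
    case False
    then have nz: "c b \<noteq> 0" "coeff (h b) m \<noteq> 0" by auto
    have "tterm (h b) m - tterm (h b) b \<in> ?R"
      using lead[of b] b nz(2) by (auto simp: leading_def in_keys_iff)
    from refine_add[OF W N dom[of b] this] b nz(1)
    have "(lv (c b * coeff (h b) m) - lv (c m), 0) \<in> ?R"
      using one[of b] by (simp add: tterm_def lv_mult[OF nz] algebra_simps)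
    then show ?thesis by (simp add: refine_const[OF W N] below_def)
  qed (simp add: below_def)
  have "coeff (lincomb L c h) m = c m + (\<Sum>b\<in>L - {m}. c b * coeff (h b) m)"
    using m(1) L(1) one by (simp add: lookup_lincomb sum.remove)
  moreover have "below (\<Sum>b\<in>L - {m}. c b * coeff (h b) m) (lv (c m))"
    using bel by (rule below_sum)
  ultimately have lm: "coeff (lincomb L c h) m \<noteq> 0"
    "lv (coeff (lincomb L c h) m) = lv (c m)"
    using lv_add_below[OF m(2)] by auto
  have "(lv (c b), b) - (lv (c m), m) \<in> W" if "b \<in> L" "c b \<noteq> 0" for b
  proof (cases "b = m")
    case True
    then show ?thesis using tropical_orderD(5)[OF W] by (simp add: zero_prod_def)
  next
    case False
    then show ?thesis using dom[OF that] refine_subset[of W N] by blast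
  qed
  from that[OF m this lm] show ?thesis by simp
qed

section \<open>Bending is determined by finitely many comparisons\<close>

definition agree :: "(real \<times> 'm::ab_group_add) set \<Rightarrow> (real \<times> 'm) set \<Rightarrow> ('m \<Rightarrow>\<^sub>0 'k) \<Rightarrow> 'm \<Rightarrow> bool"
  where "agree W W' F u \<longleftrightarrow> (\<forall>w\<in>supp F - {u}.
    strict W (tterm F w - tterm F u) \<and> strict W' (tterm F w - tterm F u) \<or>
    tie W (tterm F w - tterm F u) \<and> tie W' (tterm F w - tterm F u))"

lemma agree_leading:
  assumes "agree W W' F u" "leading (refine W N) F u"
  shows "leading (refine W' N) F u"
proof -
  have "tterm F w - tterm F u \<in> refine W' N" if w: "w \<in> supp F - {u}" for w
  proof -
    let ?d = "tterm F w - tterm F u"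
    have "strict W ?d \<and> strict W' ?d \<or> tie W ?d \<and> tie W' ?d"
      using assms(1) w unfolding agree_def by (rule bspec)
    moreover have "?d \<in> refine W N" using assms(2) w by (simp only: leading_def)
    ultimately show ?thesis using not_strict_tie[of W ?d] by (auto simp: refine_def)
  qed
  then show ?thesis using assms(2) unfolding leading_def by simp
qed

lemma tterm_monomial_mult:
  fixes F :: "'m::ab_group_add \<Rightarrow>\<^sub>0 'k"
  assumes "x \<noteq> 0" "w \<in> supp F"
  shows "tterm (monomial t x * F) (w + t) = tterm F w + (lv x, t)"
  using assms by (simp add: tterm_def lookup_single_mult lv_mult in_keys_iff)

lemma keys_monomial_mult:
  fixes F :: "'m::ab_group_add \<Rightarrow>\<^sub>0 'k"
  assumes "x \<noteq> 0"
  shows "supp (monomial t x * F) = (\<lambda>w. w + t) ` supp F"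
proof -
  have "w \<in> (\<lambda>w. w + t) ` supp F" if "w - t \<in> supp F" for w
    using that by (auto intro!: image_eqI[of _ _ "w - t"])
  then show ?thesis using assms by (auto simp: in_keys_iff lookup_single_mult)
qed

lemma monomial_mult_differences:
  fixes F :: "'m::ab_group_add \<Rightarrow>\<^sub>0 'k"
  assumes "x \<noteq> 0" "u \<in> supp F"
    and P: "\<forall>w\<in>supp F - {u}. P (tterm F w - tterm F u)"
  shows "\<forall>w\<in>supp (monomial t x * F) - {u + t}.
    P (tterm (monomial t x * F) w - tterm (monomial t x * F) (u + t))"
proof
  fix w assume "w \<in> supp (monomial t x * F) - {u + t}"
  then obtain w' where w': "w' \<in> supp F" "w = w' + t" "w' \<noteq> u"
    unfolding keys_monomial_mult[OF assms(1)] by blast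
  have "tterm (monomial t x * F) w - tterm (monomial t x * F) (u + t)
    = tterm F w' - tterm F u"
    unfolding w'(2) tterm_monomial_mult[OF assms(1) w'(1)] tterm_monomial_mult[OF assms(1,2)] by simp
  then show "P (tterm (monomial t x * F) w - tterm (monomial t x * F) (u + t))"
    using P w' by simp
qed

lemma agree_monomial_mult:
  assumes "agree W W' F u" "x \<noteq> 0" "u \<in> supp F"
  shows "agree W W' (monomial t x * F) (u + t)"
  using assms(1) unfolding agree_def by (rule monomial_mult_differences[OF assms(2,3)])

lemma leading_monomial_mult:
  assumes "leading R F u" "x \<noteq> 0"
  shows "leading R (monomial t x * F) (u + t)"
proof -
  have u: "u \<in> supp F"
    and *: "\<forall>w\<in>supp F - {u}. tterm F w - tterm F u \<in> R"
    using assms(1) unfolding leading_def by blast+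
  have "u + t \<in> supp (monomial t x * F)"
    unfolding keys_monomial_mult[OF assms(2)] using u by (rule imageI)
  then show ?thesis
    unfolding leading_def
    using monomial_mult_differences[where P = "\<lambda>g. g \<in> R", OF assms(2) u *] by (rule conjI)
qed

text \<open>Let \<open>u\<close> dominate the combination \<open>F\<close> with respect to \<open>W'\<close>. No summand exceeds the term of \<open>F\<close> at \<open>u\<close> there, by
\<open>lincomb_leading\<close>. Let \<open>G\<close> consist of those summands whose leading term ties with the dominant term
in both orders. At an exponent where \<open>G\<close> has a contribution that ties with the dominant term, both
orders prescribe the same coefficient value for a tie; every discarded summand lies strictly below
that value, since a discarded summand attaining it would have had to be kept. So \<open>F\<close> and \<open>G\<close> differ
there by something small, and \<open>G\<close> inherits from \<open>F\<close> that \<open>u\<close> dominates. At the other exponents all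
contributions to \<open>G\<close> are strictly smaller with respect to \<open>W\<close> because the orders agree on each \<open>h b\<close>.\<close>

lemma bends_transfer:
  fixes h :: "'m::ab_group_add \<Rightarrow> 'm \<Rightarrow>\<^sub>0 'k"
  assumes H: "add_subgroup H" and W: "tropical_order H W" and W': "tropical_order H W'"
    and N: "tie_breaker N" and L: "finite L" "L \<subseteq> H"
    and one: "\<And>b. b \<in> L \<Longrightarrow> coeff (h b) b = 1"
    and lead: "\<And>b. b \<in> L \<Longrightarrow> leading (refine W N) (h b) b"
    and agree: "\<And>b. b \<in> L \<Longrightarrow> agree W W' (h b) b"
    and nb: "\<not> bends W' (lincomb L c h)"
  shows "\<exists>Z\<subseteq>L. \<not> bends W (lincomb Z c h)"
proof -
  let ?F = "lincomb L c h"
  obtain u where u: "u \<in> supp ?F"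
    and "\<forall>w\<in>supp ?F - {u}. strict W' (tterm ?F w - tterm ?F u)"
    using nb unfolding bends_def not_not by (rule bexE)
  then have dom: "strict W' (tterm ?F w - tterm ?F u)"
    if "w \<in> supp ?F" "w \<noteq> u" for w using that by simp
  define \<gamma> where "\<gamma> = tterm ?F u"
  define pos where "pos b = (lv (c b), b) - \<gamma>" for b
  define \<delta> where "\<delta> b w = tterm (h b) w - tterm (h b) b" for b w
  define y where "y b w = c b * coeff (h b) w" for b w
  define Z where "Z = {b\<in>L. c b \<noteq> 0 \<and> tie W' (pos b) \<and> tie W (pos b)}"
  let ?G = "lincomb Z c h"
  have ZL: "Z \<subseteq> L" by (auto simp: Z_def)
  have z: "tie W 0" "tie W' 0" using tropical_orderD(5)[OF W] tropical_orderD(5)[OF W'] by (auto simp: tie_def)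
  have ynz: "c b \<noteq> 0 \<and> w \<in> supp (h b)" if "y b w \<noteq> 0" for b w
    using that by (auto simp: y_def in_keys_iff)
  have \<delta>: "strict W (\<delta> b w) \<and> strict W' (\<delta> b w) \<or> tie W (\<delta> b w) \<and> tie W' (\<delta> b w)"
    if "b \<in> L" "y b w \<noteq> 0" for b w
    using agree[OF that(1)] ynz[OF that(2)] z unfolding agree_def \<delta>_def by (cases "w = b") auto
  have y: "(lv (y b w), w) - \<gamma> = pos b + \<delta> b w" if "b \<in> L" "y b w \<noteq> 0" for b w
    using that one[of b] by (simp add: y_def pos_def \<delta>_def tterm_def lv_mult)
  have pos: "pos b \<in> W'" if b: "b \<in> L" "c b \<noteq> 0" for b
  proof -
    obtain m where m: "m \<in> L" "\<And>b. b \<in> L \<Longrightarrow> c b \<noteq> 0 \<Longrightarrow> (lv (c b), b) - (lv (c m), m) \<in> W'"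
      "coeff ?F m \<noteq> 0" "lv (coeff ?F m) = lv (c m)"
      using lincomb_leading[OF H W' N L _ one agree_leading[OF agree lead], of c] b by blast
    have "tterm ?F m - \<gamma> \<in> W'"
      using dom[of m] m(3) z unfolding \<gamma>_def by (cases "m = u") (auto simp: strict_def tie_def in_keys_iff)
    moreover have "pos b = ((lv (c b), b) - (lv (c m), m)) + (tterm ?F m - \<gamma>)"
      using m(4) by (simp add: pos_def tterm_def)
    ultimately show ?thesis using tropical_orderD(2)[OF W' m(2)[OF b]] by simp
  qed
  have below_diff: "below (coeff ?F w - coeff ?G w) t"
    if t: "tie W ((t, w) - \<gamma>)" "tie W' ((t, w) - \<gamma>)" for t w
  proof -
    have "coeff ?F w - coeff ?G w = (\<Sum>b\<in>L - Z. y b w)"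
      using sum_diff[OF L(1) ZL, of "\<lambda>b. y b w"] by (simp add: lookup_lincomb y_def)
    moreover have "below (y b w) t" if b: "b \<in> L - Z" for b
    proof (cases "y b w = 0")
      case False
      let ?D = "(lv (y b w), w) - \<gamma>"
      have D: "?D = pos b + \<delta> b w" using y[of b w] b False by simp
      have eq: "(lv (y b w) - t, 0) = ?D + - ((t, w) - \<gamma>)" by simp
      have d: "strict W (\<delta> b w) \<and> strict W' (\<delta> b w) \<or> tie W (\<delta> b w) \<and> tie W' (\<delta> b w)"
        using \<delta>[of b w] b False by simp
      have p: "pos b \<in> W'" using pos[of b] b ynz[OF False] by simp
      show ?thesis
      proof (cases "strict W' ?D")
        case True
        then have "strict W' (lv (y b w) - t, 0)"
          unfolding eq using t(2) by (intro strict_add[OF W']) (auto simp: tie_def)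
        then show ?thesis by (simp add: strict_const[OF W'] below_def)
      next
        case nD: False
        have "\<not> strict W' (pos b)"
          using nD d strict_add[OF W', of "pos b" "\<delta> b w"] unfolding D by (auto simp: in_order_cases)
        then have tp: "tie W' (pos b)" using p by (auto simp: in_order_cases)
        have "\<not> strict W' (\<delta> b w)"
          using nD strict_add[OF W', of "\<delta> b w" "pos b"] p unfolding D by (auto simp: add.commute)
        then have td: "tie W (\<delta> b w)" "tie W' (\<delta> b w)" using d by auto
        have "tie W' (lv (y b w) - t, 0)"
          unfolding eq D using tie_add[OF W' tie_add[OF W' tp td(2)]] t(2) by (simp only: tie_minus)
        then have "lv (y b w) = t" by (simp add: tie_const[OF W'])
        then have "tie W (pos b + \<delta> b w)" using t(1) D by simp
        from tie_diff[OF W this td(1)] have "tie W (pos b)" by simp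
        then have "b \<in> Z" using b tp ynz[OF False] by (simp add: Z_def)
        then show ?thesis using b by simp
      qed
    qed (simp add: below_def)
    ultimately show ?thesis using below_sum[of "L - Z" "\<lambda>b. y b w" t] by simp
  qed
  have Fu: "coeff ?F u \<noteq> 0" using u by (simp add: in_keys_iff)
  have "below (- (coeff ?F u - coeff ?G u)) (lv (coeff ?F u))"
    unfolding below_uminus using z by (intro below_diff) (simp_all add: \<gamma>_def tterm_def zero_prod_def)
  from lv_add_below[OF Fu this] have Gu: "coeff ?G u \<noteq> 0" "tterm ?G u = \<gamma>"
    by (simp_all add: \<gamma>_def tterm_def)
  have "strict W (tterm ?G w - \<gamma>)" if w: "w \<in> supp ?G" "w \<noteq> u" for w
  proof (cases "\<exists>b\<in>Z. y b w \<noteq> 0 \<and> tie W (\<delta> b w)")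
    case True
    then obtain b where b: "b \<in> Z" "y b w \<noteq> 0" "tie W (\<delta> b w)" by blast
    define t where "t = lv (y b w)"
    have "tie W' (\<delta> b w)" using \<delta>[of b w] b ZL not_strict_tie by blast
    then have t: "tie W ((t, w) - \<gamma>)" "tie W' ((t, w) - \<gamma>)"
      using tie_add[OF W, of "pos b" "\<delta> b w"] tie_add[OF W', of "pos b" "\<delta> b w"] b y[of b w]
      unfolding t_def by (auto simp: Z_def)
    have "below (coeff ?F w) t"
    proof (cases "coeff ?F w = 0")
      case False
      then have "strict W' (tterm ?F w - \<gamma>)" using dom[of w] w(2) unfolding \<gamma>_def by (simp add: in_keys_iff)
      then have "strict W' ((tterm ?F w - \<gamma>) + - ((t, w) - \<gamma>))"
        using t(2) by (intro strict_add[OF W']) (auto simp: tie_def)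
      then show ?thesis by (simp add: tterm_def strict_const[OF W'] below_def)
    qed (simp add: below_def)
    moreover have "below (- (coeff ?F w - coeff ?G w)) t"
      using below_diff[OF t] by (simp only: below_uminus)
    ultimately have "below (coeff ?F w + - (coeff ?F w - coeff ?G w)) t"
      by (rule below_add)
    then have lt: "lv (coeff ?G w) < t" using w(1) by (simp add: below_def in_keys_iff)
    have "strict W ((lv (coeff ?G w) - t, 0) + ((t, w) - \<gamma>))"
      using lt t(1) by (intro strict_add[OF W]) (auto simp: strict_const[OF W] tie_def)
    then show ?thesis by (cases \<gamma>) (simp add: tterm_def algebra_simps)
  next
    case False
    have st: "strict W ((lv (y b w), w) - \<gamma>)" if b: "b \<in> Z" "y b w \<noteq> 0" for b
    proof -
      have "strict W (\<delta> b w)" using \<delta>[of b w] b ZL False by blast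
      then have "strict W (\<delta> b w + pos b)"
        using b by (intro strict_add[OF W]) (auto simp: Z_def tie_def)
      then show ?thesis using y[of b w] b ZL by (simp add: add.commute subset_iff)
    qed
    have "(\<Sum>b\<in>A. y b w) = 0 \<or> strict W ((lv (\<Sum>b\<in>A. y b w), w) - \<gamma>)" if "finite A" "A \<subseteq> Z" for A
      using that
    proof (induction A rule: finite_induct)
      case (insert b A)
      let ?x = "y b w" and ?s = "\<Sum>b\<in>A. y b w"
      have x: "?x = 0 \<or> strict W ((lv ?x, w) - \<gamma>)" using st insert.prems by blast
      have s: "?s = 0 \<or> strict W ((lv ?s, w) - \<gamma>)" using insert by blast
      have "?x + ?s = 0 \<or> strict W ((lv (?x + ?s), w) - \<gamma>)"
      proof (cases "?x = 0 \<or> ?s = 0 \<or> ?x + ?s = 0")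
        case False
        then have "strict W (max (lv ?x) (lv ?s) - fst \<gamma>, w - snd \<gamma>)"
          using x s by (cases \<gamma>) (auto simp: max_def)
        moreover have "lv (?x + ?s) \<le> max (lv ?x) (lv ?s)" using lv_add False by blast
        ultimately have "strict W (lv (?x + ?s) - fst \<gamma>, w - snd \<gamma>)"
          by (elim strict_lower_value[OF W]) simp
        then show ?thesis by (cases \<gamma>) simp
      qed (use x s in auto)
      then show ?case using insert.hyps by simp
    qed simp
    from this[of Z] have "strict W ((lv (\<Sum>b\<in>Z. y b w), w) - \<gamma>)"
      using w(1) finite_subset[OF ZL L(1)] by (simp add: in_keys_iff lookup_lincomb y_def)
    then show ?thesis by (simp add: tterm_def lookup_lincomb y_def)
  qed
  then have "\<forall>w\<in>supp ?G - {u}. strict W (tterm ?G w - tterm ?G u)" using Gu(2) by simp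
  moreover have "u \<in> supp ?G" using Gu(1) by (simp add: in_keys_iff)
  ultimately have "\<not> bends W ?G" unfolding bends_def by blast
  then show ?thesis using ZL by blast
qed

text \<open>The filtration of the group by word length replaces homogenization: polynomials with exponents in
  \<open>degs E d\<close> form finite-dimensional spaces, and multiplication by a generator raises \<open>d\<close> by one.\<close>

definition degs :: "'m::ab_group_add set \<Rightarrow> nat \<Rightarrow> 'm set"
  where "degs E d = {sum_mset A | A. size A = d \<and> set_mset A \<subseteq> E}"

lemma finite_degs: "finite E \<Longrightarrow> finite (degs E d)"
proof (induction d)
  case 0
  have "degs E 0 \<subseteq> {0}" by (auto simp: degs_def)
  then show ?case by (rule finite_subset) simp
next
  case (Suc d)
  have "degs E (Suc d) \<subseteq> (\<lambda>(a, b). a + b) ` (E \<times> degs E d)"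
  proof
    fix u assume "u \<in> degs E (Suc d)"
    then obtain A where A: "size A = Suc d" "set_mset A \<subseteq> E" "u = sum_mset A" by (auto simp: degs_def)
    then obtain a B where "A = add_mset a B" by (cases A) auto
    then show "u \<in> (\<lambda>(a, b). a + b) ` (E \<times> degs E d)"
      using A by (auto simp: degs_def intro!: image_eqI[of _ _ "(a, sum_mset B)"])
  qed
  then show ?case by (rule finite_subset) (use Suc in auto)
qed

lemma degs_add: "u \<in> degs E d \<Longrightarrow> w \<in> degs E d' \<Longrightarrow> u + w \<in> degs E (d + d')"
  unfolding degs_def
  by (auto, metis size_union sum_mset.union set_mset_union Un_subset_iff)

lemma degs_mono:
  assumes "0 \<in> E" "d \<le> d'"
  shows "degs E d \<subseteq> degs E d'"
proof
  fix u assume u: "u \<in> degs E d"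
  have z: "sum_mset (replicate_mset n (0::'a)) = 0" for n by (induction n) auto
  have "0 \<in> degs E (d' - d)"
    unfolding degs_def using assms(1) z
    by (auto intro!: exI[of _ "replicate_mset (d' - d) 0"] split: if_splits)
  from degs_add[OF u this] assms(2) show "u \<in> degs E d'" by simp
qed

lemma degs_subgroup:
  assumes "add_subgroup H" "E \<subseteq> H"
  shows "degs E d \<subseteq> H"
proof -
  have "sum_mset A \<in> H" if "set_mset A \<subseteq> E" for A
    using that assms by (induction A) (auto intro: add_subgroupD)
  then show ?thesis by (auto simp: degs_def)
qed

lemma ex_degs:
  assumes "finite K" "0 \<in> E" "\<And>u. u \<in> K \<Longrightarrow> \<exists>A. set_mset A \<subseteq> E \<and> u = sum_mset A"
  shows "\<exists>d. K \<subseteq> degs E d"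
  using assms(1,3)
proof (induction K rule: finite_induct)
  case (insert u K)
  then obtain d where d: "K \<subseteq> degs E d" by blast
  obtain A where "set_mset A \<subseteq> E" "u = sum_mset A" using insert.prems by blast
  then have "u \<in> degs E (size A)" by (auto simp: degs_def)
  then have "insert u K \<subseteq> degs E (max d (size A))"
    using d degs_mono[OF assms(2), of d "max d (size A)"] degs_mono[OF assms(2), of "size A" "max d (size A)"]
    by auto
  then show ?case by blast
qed simp

text \<open>The pairs of a degree and a leading exponent are closed under multiplication by generators, so
Dickson's lemma applies to the multisets of generators that represent them.\<close>

lemma finite_leading_generators:
  fixes J :: "('m::ab_group_add \<Rightarrow>\<^sub>0 'k) set"
  assumes E: "finite E"
  obtains B where "finite B"
    "\<And>A G. (A, G) \<in> B \<Longrightarrow> G \<in> J \<and> supp G \<subseteq> degs E (size A) \<and> leading R G (sum_mset A)"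
    "\<And>d F u. F \<in> J \<Longrightarrow> supp F \<subseteq> degs E d \<Longrightarrow> leading R F u \<Longrightarrow>
      \<exists>A G t. (A, G) \<in> B \<and> size A \<le> d \<and> t \<in> degs E (d - size A) \<and> u = sum_mset A + t"
proof -
  define ok where "ok A G \<longleftrightarrow> G \<in> J \<and> supp G \<subseteq> degs E (size A) \<and> leading R G (sum_mset A)"
    for A and G :: "'m \<Rightarrow>\<^sub>0 'k"
  let ?X = "{A. set_mset A \<subseteq> E \<and> (\<exists>G. ok A G)}"
  obtain B0 where B0: "finite B0" "B0 \<subseteq> ?X" "\<forall>A\<in>?X. \<exists>A0\<in>B0. \<forall>e\<in>E. count A0 e \<le> count A e"
    using dickson_finite_basis[OF E, of ?X count] by blast
  define g where "g A = (SOME G. ok A G)" for A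
  have g: "ok A (g A)" if "A \<in> B0" for A
  proof -
    have "\<exists>G. ok A G" using that B0(2) by blast
    then show ?thesis unfolding g_def by (rule someI_ex)
  qed
  show ?thesis
  proof (rule that[of "(\<lambda>A. (A, g A)) ` B0"])
    show "finite ((\<lambda>A. (A, g A)) ` B0)" using B0(1) by simp
    show "G \<in> J \<and> supp G \<subseteq> degs E (size A) \<and> leading R G (sum_mset A)"
      if "(A, G) \<in> (\<lambda>A. (A, g A)) ` B0" for A G
      using that g by (auto simp: ok_def)
    fix d F u assume F: "F \<in> J" "supp F \<subseteq> degs E d" "leading R F u"
    then have "u \<in> degs E d" by (auto simp: leading_def)
    then obtain A where A: "size A = d" "set_mset A \<subseteq> E" "u = sum_mset A" by (auto simp: degs_def)
    then have "A \<in> ?X" using F by (auto simp: ok_def)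
    then obtain A0 where A0: "A0 \<in> B0" "\<forall>e\<in>E. count A0 e \<le> count A e" using B0(3) by blast
    have "set_mset A0 \<subseteq> E" using A0(1) B0(2) by blast
    then have sub: "A0 \<subseteq># A"
      using A0(2) by (intro mset_subset_eqI) (metis count_eq_zero_iff le0 subsetD)
    then have "size A0 \<le> d" using A(1) size_mset_mono by blast
    moreover have "sum_mset (A - A0) \<in> degs E (d - size A0)"
      using A(1,2) sub by (auto simp: degs_def size_Diff_submset intro!: exI[of _ "A - A0"] dest: in_diffD)
    moreover have "u = sum_mset A0 + sum_mset (A - A0)"
      using sub A(3) by (metis subset_mset.add_diff_inverse sum_mset.union)
    ultimately show "\<exists>A G t. (A, G) \<in> (\<lambda>A. (A, g A)) ` B0 \<and> size A \<le> d \<and> t \<in> degs E (d - size A)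
        \<and> u = sum_mset A + t"
      using A0(1) by blast
  qed
qed

text \<open>The conditions compare, in each of finitely many elements carrying all leading terms, every term
with the leading one. An order \<open>W'\<close> satisfying them has the same leading exponents on monomial
multiples of these elements. In each degree there are as many such multiples as leading exponents
with respect to \<open>W\<close>, that is, as the dimension of the space, so the multiples form a basis; thus the
representation of an element that does not bend for \<open>W'\<close> can be transferred to \<open>W\<close>.\<close>

theorem bending_finitely_determined:
  fixes J :: "('m::ab_group_add \<Rightarrow>\<^sub>0 'k) set" and N :: "'m set"
  assumes H: "add_subgroup H" and W: "tropical_order H W" and N: "tie_breaker N"
    and E: "finite E" "E \<subseteq> H" "0 \<in> E" "\<And>u. u \<in> H \<Longrightarrow> \<exists>A. set_mset A \<subseteq> E \<and> u = sum_mset A"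
    and J: "laurent_ideal H J" and bend: "\<And>F. F \<in> J \<Longrightarrow> bends W F"
  obtains X where "finite X" "\<And>q. q \<in> X \<Longrightarrow> satisfies W q"
    "\<And>W' F. tropical_order H W' \<Longrightarrow> (\<And>q. q \<in> X \<Longrightarrow> satisfies W' q) \<Longrightarrow> F \<in> J \<Longrightarrow> bends W' F"
proof -
  let ?R = "refine W N"
  obtain B where finB: "finite B"
    and B: "\<And>A G. (A, G) \<in> B \<Longrightarrow> G \<in> J \<and> supp G \<subseteq> degs E (size A) \<and> leading ?R G (sum_mset A)"
    and gen: "\<And>d F u. F \<in> J \<Longrightarrow> supp F \<subseteq> degs E d \<Longrightarrow> leading ?R F u \<Longrightarrow>
      \<exists>A G t. (A, G) \<in> B \<and> size A \<le> d \<and> t \<in> degs E (d - size A) \<and> u = sum_mset A + t"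
    using finite_leading_generators[OF E(1), of J ?R] by metis
  \<comment> \<open>a tie is recorded as two weak conditions, so that it has to remain a tie\<close>
  define conds :: "real \<times> 'm \<Rightarrow> ((real \<times> 'm) \<times> bool) set"
    where "conds g = (if strict W g then {(g, True)} else {(g, False), (- g, False)})" for g
  define X where "X = (\<Union>(A, G)\<in>B. \<Union>w\<in>supp G - {sum_mset A}. conds (tterm G w - tterm G (sum_mset A)))"
  have finX: "finite X" unfolding X_def using finB by (auto simp: conds_def)
  have satX: "satisfies W q" if q: "q \<in> X" for q
  proof -
    obtain A G w where AG: "(A, G) \<in> B" "w \<in> supp G - {sum_mset A}"
      "q \<in> conds (tterm G w - tterm G (sum_mset A))" using q unfolding X_def by blast
    have "tterm G w - tterm G (sum_mset A) \<in> ?R"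
      using B[OF AG(1)] AG(2) unfolding leading_def by blast
    then show ?thesis using AG(3) unfolding conds_def refine_def
      by (auto simp: satisfies_def strict_def tie_def split: if_splits)
  qed
  have "bends W' F"
    if W': "tropical_order H W'" and sat: "\<And>q. q \<in> X \<Longrightarrow> satisfies W' q" and F: "F \<in> J" for W' F
  proof (rule ccontr)
    assume nb: "\<not> bends W' F"
    have agreeB: "agree W W' G (sum_mset A)" if AG: "(A, G) \<in> B" for A G
      unfolding agree_def
    proof
      fix w assume w: "w \<in> supp G - {sum_mset A}"
      let ?g = "tterm G w - tterm G (sum_mset A)"
      have sub: "conds ?g \<subseteq> X" unfolding X_def using AG w by blast
      have "?g \<in> ?R" using B[OF AG] w unfolding leading_def by blast
      then show "strict W ?g \<and> strict W' ?g \<or> tie W ?g \<and> tie W' ?g"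
        using sub sat[of "(?g, True)"] sat[of "(?g, False)"] sat[of "(- ?g, False)"]
        unfolding conds_def refine_def satisfies_def by (auto simp: strict_def tie_def split: if_splits)
    qed
    obtain d where d: "supp F \<subseteq> degs E d"
      using ex_degs[OF finite_keys E(3,4), of F] laurent_idealD(2)[OF J F] by blast
    define V where "V = {G \<in> J. supp G \<subseteq> degs E d}"
    \<comment> \<open>the leading exponents in degree \<open>d\<close>, and then a multiple \<open>h b\<close> of a generator for each of them\<close>
    define L where "L = {u. \<exists>G\<in>V. leading ?R G u}"
    have degsH: "degs E n \<subseteq> H" for n by (rule degs_subgroup[OF H E(2)])
    have "L \<subseteq> degs E d" unfolding L_def V_def leading_def by blast
    then have L: "finite L" "L \<subseteq> H" using finite_degs[OF E(1)] degsH finite_subset by blast+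
    have "\<exists>G. G \<in> V \<and> coeff G b = 1 \<and> leading ?R G b \<and> agree W W' G b" if b: "b \<in> L" for b
    proof -
      obtain G0 where "G0 \<in> V" "leading ?R G0 b" using b unfolding L_def by blast
      then obtain A G t where AG: "(A, G) \<in> B" "size A \<le> d" "t \<in> degs E (d - size A)" "b = sum_mset A + t"
        using gen[of G0 d b] unfolding V_def by blast
      let ?x = "inverse (coeff G (sum_mset A))"
      let ?G = "monomial t ?x * G"
      note BG = B[OF AG(1)]
      have k: "sum_mset A \<in> supp G" using BG unfolding leading_def by blast
      then have x: "?x \<noteq> 0" by (simp add: in_keys_iff)
      have "?G \<in> J" using BG laurent_idealD(4)[OF J] AG(3) degsH by blast
      moreover have "supp ?G \<subseteq> degs E d"
        unfolding keys_monomial_mult[OF x] using BG degs_add[OF _ AG(3), of _ "size A"] AG(2) by auto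
      ultimately have "?G \<in> V" by (simp add: V_def)
      moreover have "coeff ?G b = 1" using k by (simp add: AG(4) lookup_single_mult in_keys_iff)
      moreover have "leading ?R ?G b" unfolding AG(4) using BG x by (intro leading_monomial_mult) auto
      moreover have "agree W W' ?G b" unfolding AG(4) by (rule agree_monomial_mult[OF agreeB[OF AG(1)] x k])
      ultimately show ?thesis by blast
    qed
    then obtain h where h: "\<And>b. b \<in> L \<Longrightarrow> h b \<in> V" "\<And>b. b \<in> L \<Longrightarrow> coeff (h b) b = 1"
      "\<And>b. b \<in> L \<Longrightarrow> leading ?R (h b) b" "\<And>b. b \<in> L \<Longrightarrow> agree W W' (h b) b" by metis
    have scale: "monomial 0 x * G \<in> V" if "G \<in> V" for x G
    proof -
      have "supp (monomial 0 x * G) \<subseteq> supp G"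
        by (auto simp: in_keys_iff lookup_single_mult)
      then show ?thesis using that laurent_idealD(4)[OF J] add_subgroupD(1)[OF H] unfolding V_def by blast
    qed
    have add: "G + G' \<in> V" if "G \<in> V" "G' \<in> V" for G G'
      using that laurent_idealD(3)[OF J] Poly_Mapping.keys_add[of G G'] unfolding V_def by blast
    have comb: "lincomb Z c h \<in> V" if "Z \<subseteq> L" for Z c
    proof -
      have "finite Z" using that L(1) finite_subset by blast
      then show ?thesis using that unfolding lincomb_def
        by (induction Z rule: finite_induct)
          (auto intro!: add scale h(1) simp: V_def[THEN eqset_imp_iff, of 0] laurent_idealD(1)[OF J])
    qed
    have "\<exists>c. F = lincomb L c h"
    proof (rule ex_lincomb[OF L(1)])
      fix x c
      let ?G = "monomial 0 x * F + lincomb L c h"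
      assume z: "\<forall>b\<in>L. coeff ?G b = 0"
      have G: "?G \<in> V" using F d by (intro add scale comb) (auto simp: V_def)
      show "?G = 0"
      proof (rule ccontr)
        assume "?G \<noteq> 0"
        then obtain u where u: "leading ?R ?G u"
          using ex_leading[OF H W N] G degsH unfolding V_def by blast
        have "\<exists>G\<in>V. leading ?R G u" using u G by blast
        then have "u \<in> L" by (simp add: L_def)
        moreover have "coeff ?G u \<noteq> 0" using u by (simp add: leading_def in_keys_iff)
        ultimately show False using z by blast
      qed
    next
      fix c :: "'m \<Rightarrow> 'k" assume "\<exists>b\<in>L. c b \<noteq> 0"
      from lincomb_leading[OF H W N L this h(2,3)]
      show "lincomb L c h \<noteq> 0" by (metis lookup_zero)
    qed
    then obtain c where "F = lincomb L c h" by blast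
    then obtain Z where "Z \<subseteq> L" "\<not> bends W (lincomb Z c h)"
      using bends_transfer[OF H W W' N L h(2,3,4), of c] nb by blast
    then show False using bend comb unfolding V_def by blast
  qed
  then show ?thesis using that finX satX by blast
qed

end

section \<open>Prime congruences and quotients\<close>

definition closed_structure :: "('a, 'b) ring_scheme \<Rightarrow> bool"
  where "closed_structure A \<longleftrightarrow> \<zero>\<^bsub>A\<^esub> \<in> carrier A \<and>
    (\<forall>x\<in>carrier A. \<forall>y\<in>carrier A. x \<oplus>\<^bsub>A\<^esub> y \<in> carrier A \<and> x \<otimes>\<^bsub>A\<^esub> y \<in> carrier A)"

lemma congruenceD:
  assumes "congruence A C"
  shows "equiv (carrier A) C" "(a, b) \<in> C \<Longrightarrow> (c, d) \<in> C \<Longrightarrow> (a \<oplus>\<^bsub>A\<^esub> c, b \<oplus>\<^bsub>A\<^esub> d) \<in> C"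
    "(a, b) \<in> C \<Longrightarrow> (c, d) \<in> C \<Longrightarrow> (a \<otimes>\<^bsub>A\<^esub> c, b \<otimes>\<^bsub>A\<^esub> d) \<in> C"
    "a \<in> carrier A \<Longrightarrow> (a, a) \<in> C" "(a, b) \<in> C \<Longrightarrow> (b, a) \<in> C"
    "(a, b) \<in> C \<Longrightarrow> (b, c) \<in> C \<Longrightarrow> (a, c) \<in> C" "(a, b) \<in> C \<Longrightarrow> a \<in> carrier A \<and> b \<in> carrier A"
proof -
  have e: "equiv (carrier A) C" and ops: "\<forall>(a, b)\<in>C. \<forall>(c, d)\<in>C.
      (a \<oplus>\<^bsub>A\<^esub> c, b \<oplus>\<^bsub>A\<^esub> d) \<in> C \<and> (a \<otimes>\<^bsub>A\<^esub> c, b \<otimes>\<^bsub>A\<^esub> d) \<in> C"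
    using assms unfolding congruence_def by blast+
  show "equiv (carrier A) C" by (rule e)
  show "(a \<oplus>\<^bsub>A\<^esub> c, b \<oplus>\<^bsub>A\<^esub> d) \<in> C" "(a \<otimes>\<^bsub>A\<^esub> c, b \<otimes>\<^bsub>A\<^esub> d) \<in> C"
    if "(a, b) \<in> C" "(c, d) \<in> C" for a b c d
    using ops that by fast+
  show "(a, a) \<in> C" if "a \<in> carrier A" for a using e that unfolding equiv_def refl_on_def by blast
  show "(b, a) \<in> C" if "(a, b) \<in> C" for a b using e that unfolding equiv_def sym_def by blast
  show "(a, c) \<in> C" if "(a, b) \<in> C" "(b, c) \<in> C" for a b c
    using e that unfolding equiv_def trans_def by blast
  show "a \<in> carrier A \<and> b \<in> carrier A" if "(a, b) \<in> C" for a b using e that unfolding equiv_def by blast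
qed

lemma quotient_semiring_ops:
  assumes C: "congruence A C" and A: "closed_structure A" and xy: "x \<in> carrier A" "y \<in> carrier A"
  shows "C `` {x} \<oplus>\<^bsub>quotient_semiring A C\<^esub> C `` {y} = C `` {x \<oplus>\<^bsub>A\<^esub> y}"
    "C `` {x} \<otimes>\<^bsub>quotient_semiring A C\<^esub> C `` {y} = C `` {x \<otimes>\<^bsub>A\<^esub> y}"
proof -
  note D = congruenceD[OF C]
  have eqs: "C `` {x' \<oplus>\<^bsub>A\<^esub> y'} = C `` {x \<oplus>\<^bsub>A\<^esub> y}" "C `` {x' \<otimes>\<^bsub>A\<^esub> y'} = C `` {x \<otimes>\<^bsub>A\<^esub> y}"
    if "x' \<in> C `` {x}" "y' \<in> C `` {y}" for x' y'
    using that D(2)[of x x' y y'] D(3)[of x x' y y'] equiv_class_eq[OF D(1)] by auto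
  have "(\<Union>x'\<in>C `` {x}. \<Union>y'\<in>C `` {y}. C `` {x' \<oplus>\<^bsub>A\<^esub> y'}) = (\<Union>x'\<in>C `` {x}. \<Union>y'\<in>C `` {y}. C `` {x \<oplus>\<^bsub>A\<^esub> y})"
    "(\<Union>x'\<in>C `` {x}. \<Union>y'\<in>C `` {y}. C `` {x' \<otimes>\<^bsub>A\<^esub> y'}) = (\<Union>x'\<in>C `` {x}. \<Union>y'\<in>C `` {y}. C `` {x \<otimes>\<^bsub>A\<^esub> y})"
    by (rule SUP_cong[OF refl SUP_cong[OF refl eqs(1)]] SUP_cong[OF refl SUP_cong[OF refl eqs(2)]]; assumption)+
  moreover have "C `` {x} \<noteq> {}" "C `` {y} \<noteq> {}" using D(4) xy by blast+
  ultimately show "C `` {x} \<oplus>\<^bsub>quotient_semiring A C\<^esub> C `` {y} = C `` {x \<oplus>\<^bsub>A\<^esub> y}"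
    "C `` {x} \<otimes>\<^bsub>quotient_semiring A C\<^esub> C `` {y} = C `` {x \<otimes>\<^bsub>A\<^esub> y}"
    unfolding quotient_semiring_def by simp_all
qed

lemma class_eq_iff:
  assumes "congruence A C" "x \<in> carrier A" "y \<in> carrier A"
  shows "C `` {x} = C `` {y} \<longleftrightarrow> (x, y) \<in> C"
  using eq_equiv_class_iff[OF congruenceD(1)[OF assms(1)] assms(2,3)] .

lemma carrier_quotient_semiring: "carrier (quotient_semiring A C) = (\<lambda>x. C `` {x}) ` carrier A"
  unfolding quotient_semiring_def quotient_def by auto

lemma totally_ordered_quotient_iff:
  assumes C: "congruence A C" and A: "closed_structure A"
  shows "totally_ordered (quotient_semiring A C) \<longleftrightarrow>
    (\<forall>x\<in>carrier A. \<forall>y\<in>carrier A. (x \<oplus>\<^bsub>A\<^esub> y, y) \<in> C \<or> (y \<oplus>\<^bsub>A\<^esub> x, x) \<in> C)"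
proof -
  have "semiring_le (quotient_semiring A C) (C `` {x}) (C `` {y}) \<longleftrightarrow> (x \<oplus>\<^bsub>A\<^esub> y, y) \<in> C"
    if "x \<in> carrier A" "y \<in> carrier A" for x y
    unfolding semiring_le_def quotient_semiring_ops[OF C A that]
    using class_eq_iff[OF C, of "x \<oplus>\<^bsub>A\<^esub> y" y] A that by (auto simp: closed_structure_def)
  then show ?thesis unfolding totally_ordered_def carrier_quotient_semiring by auto
qed

lemma cancellative_quotient_iff:
  assumes C: "congruence A C" and A: "closed_structure A"
  shows "cancellative (quotient_semiring A C) \<longleftrightarrow>
    (\<forall>x\<in>carrier A. (x, \<zero>\<^bsub>A\<^esub>) \<notin> C \<longrightarrow> (\<forall>y\<in>carrier A. \<forall>z\<in>carrier A.
      (x \<otimes>\<^bsub>A\<^esub> y, x \<otimes>\<^bsub>A\<^esub> z) \<in> C \<longrightarrow> (y, z) \<in> C))"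
proof -
  have zero: "\<zero>\<^bsub>quotient_semiring A C\<^esub> = C `` {\<zero>\<^bsub>A\<^esub>}" by (simp add: quotient_semiring_def)
  have "C `` {x} = C `` {\<zero>\<^bsub>A\<^esub>} \<longleftrightarrow> (x, \<zero>\<^bsub>A\<^esub>) \<in> C" if "x \<in> carrier A" for x
    using class_eq_iff[OF C that] A by (simp add: closed_structure_def)
  moreover have "C `` {x} \<otimes>\<^bsub>quotient_semiring A C\<^esub> C `` {y} = C `` {x} \<otimes>\<^bsub>quotient_semiring A C\<^esub> C `` {z}
      \<longleftrightarrow> (x \<otimes>\<^bsub>A\<^esub> y, x \<otimes>\<^bsub>A\<^esub> z) \<in> C" if "x \<in> carrier A" "y \<in> carrier A" "z \<in> carrier A" for x y z
    unfolding quotient_semiring_ops[OF C A that(1,2)] quotient_semiring_ops[OF C A that(1,3)]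
    using class_eq_iff[OF C] A that by (simp add: closed_structure_def)
  ultimately show ?thesis
    unfolding cancellative_def carrier_quotient_semiring zero using class_eq_iff[OF C] by auto
qed

lemma congruence_Inter:
  assumes "\<And>P. P \<in> \<P> \<Longrightarrow> congruence A P" and A: "closed_structure A"
  shows "congruence A ((carrier A \<times> carrier A) \<inter> \<Inter>\<P>)"
proof -
  have "equiv (carrier A) ((carrier A \<times> carrier A) \<inter> \<Inter>\<P>)"
    unfolding equiv_def refl_on_def sym_def trans_def
    using congruenceD(4-6)[OF assms(1)] by blast
  then show ?thesis
    unfolding congruence_def using congruenceD(2,3)[OF assms(1)] A unfolding closed_structure_def by blast
qed

lemma Bend_subset_iff:
  assumes "congruence (monoid_algebra S M) P"
  shows "Bend S M I \<subseteq> P \<longleftrightarrow> (\<forall>f\<in>I. bend_relations f \<subseteq> P)"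
  unfolding Bend_def generated_congruence_def using assms by blast

section \<open>The tropical semifield and monoid algebras over it\<close>

abbreviation trop_real :: "trop \<Rightarrow> real"
  where "trop_real x \<equiv> real_of_ereal (trop_log x)"

lemma trop_log_0: "trop_log 0 = - \<infinity>" and trop_log_1: "trop_log 1 = 0"
  and trop_log_add: "trop_log (x + y) = max (trop_log x) (trop_log y)"
  and trop_log_mult: "trop_log (x * y) = trop_log x + trop_log y"
  by (simp_all add: zero_trop.rep_eq one_trop.rep_eq plus_trop.rep_eq times_trop.rep_eq)

lemma trop_log_not_PInf: "trop_log x \<noteq> \<infinity>"
  using trop_log[of x] by simp

lemma trop_log_eq_MInf: "trop_log x = - \<infinity> \<longleftrightarrow> x = 0"
  by (metis trop_log_0 trop_log_inject)

lemma trop_log_real: "x \<noteq> 0 \<Longrightarrow> trop_log x = ereal (trop_real x)"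
  using trop_log_not_PInf[of x] trop_log_eq_MInf[of x] by (cases "trop_log x") auto

lemma trop_le_iff: "x \<le> y \<longleftrightarrow> trop_log x \<le> trop_log y"
proof -
  have "x \<le> y \<longleftrightarrow> trop_log (x + y) = trop_log y" by (simp add: less_eq_trop_def trop_log_inject)
  then show ?thesis by (auto simp: trop_log_add max_def)
qed

lemma trop_no_zero_divisors: "(x::trop) * y = 0 \<longleftrightarrow> x = 0 \<or> y = 0"
  using trop_log_not_PInf[of x] trop_log_not_PInf[of y]
  by (cases "trop_log x"; cases "trop_log y")
    (auto simp: trop_log_eq_MInf[symmetric] trop_log_mult)

lemma trop_real_mult: "x \<noteq> 0 \<Longrightarrow> y \<noteq> 0 \<Longrightarrow> trop_real (x * y) = trop_real x + trop_real y"
  by (metis trop_log_real trop_log_mult plus_ereal.simps(1) real_of_ereal.simps(1))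

lemma trop_real_le_iff: "x \<noteq> 0 \<Longrightarrow> y \<noteq> 0 \<Longrightarrow> x \<le> y \<longleftrightarrow> trop_real x \<le> trop_real y"
  using trop_log_real[of x] trop_log_real[of y] by (metis trop_le_iff ereal_less_eq(3))

lemma trop_real_1: "trop_real 1 = 0"
  by (simp add: trop_log_1)

lemma trop_add_cases: "(x::trop) + y = y \<or> x + y = x"
  using trop_log_inject by (auto simp: max_def trop_log_add simp flip: trop_log_inject)

lemma trop_cancel:
  assumes "x \<noteq> 0" "(x::trop) * y = x * z"
  shows "y = z"
proof -
  have "trop_log x + trop_log y = trop_log x + trop_log z" using assms(2) by (metis trop_log_mult)
  moreover obtain r where "trop_log x = ereal r" using trop_log_real[OF assms(1)] by blast
  ultimately have "trop_log y = trop_log z" by (cases "trop_log y"; cases "trop_log z") auto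
  then show ?thesis by (simp add: trop_log_inject)
qed

lemma nonarchimedean_valuation:
  assumes "valuation_into S v"
  shows "nonarchimedean (\<lambda>x. trop_real (v x))"
proof -
  have nz: "v x \<noteq> 0" if "x \<noteq> 0" for x using assms that unfolding valuation_into_def by blast
  show ?thesis
  proof
    show "trop_real (v (x * y)) = trop_real (v x) + trop_real (v y)" if "x \<noteq> 0" "y \<noteq> 0" for x y
      using assms trop_real_mult[OF nz nz] that unfolding valuation_into_def by simp
    fix x y assume xy: "x \<noteq> 0" "y \<noteq> 0" "x + y \<noteq> (0::'a)"
    have le: "v (x + y) \<le> v x + v y" using assms unfolding valuation_into_def by blast
    have "v x + v y = v x \<or> v x + v y = v y" using trop_add_cases[of "v x" "v y"] by auto
    then have "v (x + y) \<le> v x \<or> v (x + y) \<le> v y" using le by auto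
    then show "trop_real (v (x + y)) \<le> max (trop_real (v x)) (trop_real (v y))"
      using trop_real_le_iff[OF nz nz] xy by (auto simp: le_max_iff_disj)
  qed
qed

definition additive_submonoid :: "'m::ab_group_add set \<Rightarrow> bool"
  where "additive_submonoid M \<longleftrightarrow> 0 \<in> M \<and> (\<forall>u\<in>M. \<forall>w\<in>M. u + w \<in> M)"

lemma toric_monoid_submonoid:
  assumes "rational_polyhedral_cone \<sigma>"
  shows "additive_submonoid (toric_monoid \<sigma>)"
proof -
  obtain G where G: "G \<subseteq> N_lattice" "\<sigma> = {(\<lambda>u. \<Sum>w\<in>G. c w * w u) | c. \<forall>w\<in>G. 0 \<le> c w}"
    using assms unfolding rational_polyhedral_cone_def by blast
  have add: "x (u + w) = x u + x w" if x: "x \<in> \<sigma>" for x u w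
  proof -
    obtain c where c: "x = (\<lambda>u. \<Sum>w\<in>G. c w * w u)" using x G(2) by blast
    have "y (u + w) = y u + y w" if "y \<in> G" for y
      using that G(1) additive.add unfolding N_lattice_def N_real_def by blast
    then have "(\<Sum>y\<in>G. c y * y (u + w)) = (\<Sum>y\<in>G. c y * y u + c y * y w)"
      by (intro sum.cong refl) (metis distrib_left)
    then show ?thesis by (simp add: c sum.distrib)
  qed
  have "x 0 \<le> 0" if "x \<in> \<sigma>" for x using add[OF that, of 0 0] by simp
  moreover have "x (u + w) \<le> 0" if "x \<in> \<sigma>" "x u \<le> 0" "x w \<le> 0" for x u w
    using add[OF that(1), of u w] that(2,3) by simp
  ultimately show ?thesis unfolding additive_submonoid_def toric_monoid_def by blast
qed

lemma monoid_algebra_sel: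
  "carrier (monoid_algebra R M) = {f. supp f \<subseteq> M \<and> (\<forall>u. coeff f u \<in> R)}"
  "mult (monoid_algebra R M) = (*)" "one (monoid_algebra R M) = 1"
  "zero (monoid_algebra R M) = 0" "add (monoid_algebra R M) = (+)"
  by (auto simp: monoid_algebra_def image_subset_iff)

lemma sub_semifieldD:
  assumes "sub_semifield S"
  shows "0 \<in> S" "1 \<in> S" "a \<in> S \<Longrightarrow> b \<in> S \<Longrightarrow> a + b \<in> S" "a \<in> S \<Longrightarrow> b \<in> S \<Longrightarrow> a * b \<in> S"
    "a \<in> S \<Longrightarrow> a \<noteq> 0 \<Longrightarrow> \<exists>b\<in>S. a * b = 1"
  using assms unfolding sub_semifield_def by blast+

lemma keys_mult_submonoid:
  assumes "additive_submonoid M" "supp f \<subseteq> M" "supp g \<subseteq> M"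
  shows "supp (f * g) \<subseteq> M"
proof
  fix w assume "w \<in> supp (f * g)"
  then obtain a b where "w = a + b" "a \<in> supp f" "b \<in> supp g"
    using Poly_Mapping.keys_mult[of f g] by blast
  then show "w \<in> M" using assms by (auto simp: additive_submonoid_def)
qed

lemma monoid_algebra_closed:
  assumes S: "sub_semifield S" and M: "additive_submonoid M"
  shows "closed_structure (monoid_algebra S M)" "1 \<in> carrier (monoid_algebra S M)"
    "u \<in> M \<Longrightarrow> s \<in> S \<Longrightarrow> monomial u s \<in> carrier (monoid_algebra S M)"
proof -
  let ?A = "carrier (monoid_algebra S M)"
  note SD = sub_semifieldD[OF S]
  have zero: "0 \<in> ?A" using SD(1) by (auto simp: monoid_algebra_sel)
  have single: "monomial u s \<in> ?A" if "u \<in> M" "s \<in> S" for u s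
    using that SD(1) by (auto simp: monoid_algebra_sel lookup_single when_def)
  have add: "f + g \<in> ?A" if "f \<in> ?A" "g \<in> ?A" for f g
    using that SD(3) Poly_Mapping.keys_add[of f g] by (auto simp: monoid_algebra_sel lookup_add)
  have mult: "f * g \<in> ?A" if f: "f \<in> ?A" and g: "g \<in> ?A" for f g
  proof (rule poly_mapping_induct[of "\<lambda>f. f * g \<in> ?A"])
    fix u assume "u \<in> supp f"
    then have u: "u \<in> M" "coeff f u \<in> S" using f by (auto simp: monoid_algebra_sel)
    have "supp (monomial u (coeff f u) * g) \<subseteq> M"
      using u(1) g by (intro keys_mult_submonoid[OF M]) (auto simp: monoid_algebra_sel(1))
    then show "monomial u (coeff f u) * g \<in> ?A"
      using g SD(4) u(2) by (auto simp: monoid_algebra_sel lookup_single_mult)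
  qed (use add zero in \<open>auto simp: distrib_right\<close>)
  show "closed_structure (monoid_algebra S M)"
    unfolding closed_structure_def using zero add mult by (auto simp: monoid_algebra_sel(2,4,5))
  show "1 \<in> ?A" using single[of 0 1] M SD(2) by (simp add: additive_submonoid_def)
  show "monomial u s \<in> ?A" if "u \<in> M" "s \<in> S" using single that .
qed

section \<open>Evaluation at points of the tropical toric variety\<close>

definition eval_trop :: "('m \<Rightarrow> trop) \<Rightarrow> ('m \<Rightarrow>\<^sub>0 trop) \<Rightarrow> trop"
  where "eval_trop \<phi> f = (\<Sum>u\<in>supp f. coeff f u * \<phi> u)"

lemma eval_trop_superset:
  assumes "finite K" "supp f \<subseteq> K"
  shows "eval_trop \<phi> f = (\<Sum>u\<in>K. coeff f u * \<phi> u)"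
  unfolding eval_trop_def using assms by (intro sum.mono_neutral_left) (auto simp: in_keys_iff)

lemma eval_trop_add: "eval_trop \<phi> (f + g) = eval_trop \<phi> f + eval_trop \<phi> g"
proof -
  let ?K = "supp f \<union> supp g"
  have "finite ?K" by simp
  then show ?thesis
    using Poly_Mapping.keys_add[of f g]
    by (simp add: eval_trop_superset[of ?K] lookup_add distrib_right sum.distrib)
qed

lemma eval_trop_mult:
  fixes \<phi> :: "'m::ab_group_add \<Rightarrow> trop"
  assumes M: "additive_submonoid M" and \<phi>: "\<And>u w. u \<in> M \<Longrightarrow> w \<in> M \<Longrightarrow> \<phi> (u + w) = \<phi> u * \<phi> w"
    and f: "supp f \<subseteq> M" and g: "supp g \<subseteq> M"
  shows "eval_trop \<phi> (f * g) = eval_trop \<phi> f * eval_trop \<phi> g"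
proof (rule poly_mapping_induct[of "\<lambda>f. eval_trop \<phi> (f * g) = eval_trop \<phi> f * eval_trop \<phi> g"])
  fix u assume u: "u \<in> supp f"
  let ?c = "coeff f u"
  let ?K = "(\<lambda>w. u + w) ` supp g"
  have "supp (monomial u ?c * g) \<subseteq> ?K"
    using Poly_Mapping.keys_mult[of "monomial u ?c" g] by (auto split: if_splits)
  then have "eval_trop \<phi> (monomial u ?c * g)
      = (\<Sum>w\<in>?K. coeff (monomial u ?c * g) w * \<phi> w)"
    by (intro eval_trop_superset) auto
  also have "\<dots> = (\<Sum>w\<in>supp g. ?c * coeff g w * \<phi> (u + w))"
    by (subst sum.reindex) (auto simp: lookup_single_mult)
  also have "\<dots> = (\<Sum>w\<in>supp g. ?c * \<phi> u * (coeff g w * \<phi> w))"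
    using u f g by (intro sum.cong refl) (auto simp: \<phi> subset_iff ac_simps)
  also have "\<dots> = eval_trop \<phi> (monomial u ?c) * eval_trop \<phi> g"
    using u by (simp add: eval_trop_def sum_distrib_left in_keys_iff)
  finally show "eval_trop \<phi> (monomial u ?c * g)
    = eval_trop \<phi> (monomial u ?c) * eval_trop \<phi> g" .
qed (simp_all add: eval_trop_add distrib_right eval_trop_def[of _ 0])

definition point_values :: "('m \<Rightarrow> ereal) \<Rightarrow> 'm \<Rightarrow> trop"
  where "point_values a u = Abs_trop (a u)"

lemma trop_log_sum:
  assumes "finite A" "A \<noteq> {}"
  shows "trop_log (\<Sum>i\<in>A. f i) = Max ((\<lambda>i. trop_log (f i)) ` A)"
  using assms by (induction A rule: finite_ne_induct) (simp_all add: trop_log_add)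

lemma trop_eval_eq:
  assumes "supp f \<subseteq> M" "\<And>u. u \<in> M \<Longrightarrow> a u \<noteq> \<infinity>"
  shows "trop_eval f a = trop_log (eval_trop (point_values a) f)"
proof (cases "f = 0")
  case False
  have "trop_log (coeff f u * point_values a u) = trop_log (coeff f u) + a u"
    if "u \<in> supp f" for u
    using that assms by (auto simp: trop_log_mult point_values_def Abs_trop_inverse subset_iff)
  then show ?thesis using False by (simp add: trop_eval_def eval_trop_def trop_log_sum)
qed (simp add: trop_eval_def eval_trop_def trop_log_0)

lemma trop_toric_varietyD:
  assumes "a \<in> trop_toric_variety \<sigma>"
  shows "u \<in> toric_monoid \<sigma> \<Longrightarrow> a u \<noteq> \<infinity>" "a 0 = 0"
    "u \<in> toric_monoid \<sigma> \<Longrightarrow> w \<in> toric_monoid \<sigma> \<Longrightarrow> a (u + w) = a u + a w"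
  using assms unfolding trop_toric_variety_def by auto

lemma point_values_mult:
  assumes "a \<in> trop_toric_variety \<sigma>" "u \<in> toric_monoid \<sigma>" "w \<in> toric_monoid \<sigma>"
  shows "point_values a (u + w) = point_values a u * point_values a w"
  using trop_toric_varietyD[OF assms(1)] assms(2,3)
  by (simp add: point_values_def trop_log_inject[symmetric] trop_log_mult Abs_trop_inverse)

lemma keys_delete_term: "supp (delete_term i f) = supp f - {i}"
  unfolding delete_term_def by (transfer) auto

lemma lookup_delete_term: "coeff (delete_term i f) u = (if u = i then 0 else coeff f u)"
  by (simp add: delete_term_def lookup_update)

definition point_congruence :: "trop set \<Rightarrow> 'm::ab_group_add set \<Rightarrow> ('m \<Rightarrow> ereal)
    \<Rightarrow> (('m \<Rightarrow>\<^sub>0 trop) \<times> ('m \<Rightarrow>\<^sub>0 trop)) set"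
  where "point_congruence S M a = {(f, g). f \<in> carrier (monoid_algebra S M) \<and> g \<in> carrier (monoid_algebra S M)
    \<and> trop_eval f a = trop_eval g a}"

text \<open>Evaluation is a homomorphism to the tropical semifield, which is totally ordered and cancellative.\<close>

lemma prime_point_congruence:
  assumes S: "sub_semifield S" and M: "additive_submonoid (toric_monoid \<sigma>)"
    and a: "a \<in> trop_toric_variety \<sigma>"
  shows "prime_congruence (monoid_algebra S (toric_monoid \<sigma>)) (point_congruence S (toric_monoid \<sigma>) a)"
proof -
  let ?M = "toric_monoid \<sigma>"
  let ?A = "monoid_algebra S ?M" and ?P = "point_congruence S ?M a" and ?e = "eval_trop (point_values a)"
  have keys: "supp f \<subseteq> ?M" if "f \<in> carrier ?A" for f using that by (simp add: monoid_algebra_sel)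
  have P: "(f, g) \<in> ?P \<longleftrightarrow> f \<in> carrier ?A \<and> g \<in> carrier ?A \<and> ?e f = ?e g" for f g
    unfolding point_congruence_def
    using trop_eval_eq[OF keys trop_toric_varietyD(1)[OF a]] by (auto simp: trop_log_inject)
  have mult: "?e (f * g) = ?e f * ?e g" if "f \<in> carrier ?A" "g \<in> carrier ?A" for f g
    using eval_trop_mult[OF M point_values_mult[OF a] keys keys] that by blast
  have A: "closed_structure ?A" by (rule monoid_algebra_closed[OF S M])
  have clo: "f + g \<in> carrier ?A" "f * g \<in> carrier ?A" if "f \<in> carrier ?A" "g \<in> carrier ?A" for f g
    using A that by (auto simp: closed_structure_def monoid_algebra_sel(2,5))
  have z: "0 \<in> carrier ?A" using A by (simp add: closed_structure_def monoid_algebra_sel(4))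
  have C: "congruence ?A ?P"
    unfolding congruence_def equiv_def refl_on_def sym_def trans_def
    by (auto simp: P clo mult eval_trop_add monoid_algebra_sel(2,5))
  have one: "1 \<in> carrier ?A" by (rule monoid_algebra_closed[OF S M])
  have "point_values a 0 = 1"
    using trop_toric_varietyD(2)[OF a] by (simp add: point_values_def one_trop_def)
  then have e1: "?e 1 = 1" "?e 0 = 0" by (simp_all add: eval_trop_def)
  have "(1, 0) \<notin> ?P" by (simp add: P e1)
  then have "?P \<noteq> carrier ?A \<times> carrier ?A" using one z by blast
  moreover have "totally_ordered (quotient_semiring ?A ?P)"
    unfolding totally_ordered_quotient_iff[OF C A]
  proof (intro ballI)
    fix x y assume "x \<in> carrier ?A" "y \<in> carrier ?A"
    then show "(x \<oplus>\<^bsub>?A\<^esub> y, y) \<in> ?P \<or> (y \<oplus>\<^bsub>?A\<^esub> x, x) \<in> ?P"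
      using trop_add_cases[of "?e x" "?e y"]
      by (simp add: P clo eval_trop_add monoid_algebra_sel(5) add.commute[of y x])
  qed
  moreover have "cancellative (quotient_semiring ?A ?P)"
    unfolding cancellative_quotient_iff[OF C A]
  proof (intro ballI impI)
    fix x y z assume xyz: "x \<in> carrier ?A" "y \<in> carrier ?A" "z \<in> carrier ?A"
      and x: "(x, \<zero>\<^bsub>?A\<^esub>) \<notin> ?P" and eq: "(x \<otimes>\<^bsub>?A\<^esub> y, x \<otimes>\<^bsub>?A\<^esub> z) \<in> ?P"
    have "?e x \<noteq> 0" using x xyz(1) z by (simp add: P e1 monoid_algebra_sel(4))
    moreover have "?e x * ?e y = ?e x * ?e z"
      using eq xyz by (simp add: P mult monoid_algebra_sel(2))
    ultimately have "?e y = ?e z" by (rule trop_cancel)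
    then show "(y, z) \<in> ?P" using xyz by (simp add: P)
  qed
  ultimately show ?thesis using C by (simp add: prime_congruence_def)
qed

section \<open>Continuity of evaluation\<close>

lemma exp_ext_trop:
  "exp_ext (trop_log (x + y)) = max (exp_ext (trop_log x)) (exp_ext (trop_log y))"
  "exp_ext (trop_log (x * y)) = exp_ext (trop_log x) * exp_ext (trop_log y)"
  "exp_ext (trop_log x) = exp_ext (trop_log y) \<longleftrightarrow> x = y"
proof -
  have e: "exp_ext (trop_log z) = (if z = 0 then 0 else exp (trop_real z))" for z
    by (simp add: exp_ext_def trop_log_eq_MInf)
  show "exp_ext (trop_log (x + y)) = max (exp_ext (trop_log x)) (exp_ext (trop_log y))"
  proof (cases "x = 0 \<or> y = 0")
    case False
    then have "trop_log x \<le> trop_log y \<longleftrightarrow> trop_real x \<le> trop_real y"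
      using trop_real_le_iff[of x y] trop_le_iff[of x y] by simp
    then show ?thesis using False by (simp add: trop_log_add exp_ext_def trop_log_eq_MInf max_def)
  next
    case True
    then have "x + y = y \<and> exp_ext (trop_log x) = 0 \<or> x + y = x \<and> exp_ext (trop_log y) = 0"
      by (auto simp: e)
    then show ?thesis using e[of x] e[of y] by (auto simp: max_def split: if_splits)
  qed
  show "exp_ext (trop_log (x * y)) = exp_ext (trop_log x) * exp_ext (trop_log y)"
    unfolding e using trop_real_mult[of x y] by (auto simp: trop_no_zero_divisors exp_add)
  show "exp_ext (trop_log x) = exp_ext (trop_log y) \<longleftrightarrow> x = y"
    unfolding e using trop_log_real[of x] trop_log_real[of y]
    by (auto simp: trop_log_inject[symmetric])
qed

lemma topspace_trop_toric_topology: "topspace (trop_toric_topology \<sigma>) = trop_toric_variety \<sigma>"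
  unfolding trop_toric_topology_def ext_line_topology_def trop_toric_variety_def
  by (auto simp: topspace_pullback_topology)

text \<open>On the exponential scale, evaluation is a maximum of multiples of coordinates.\<close>

lemma continuous_map_eval_trop:
  assumes "supp f \<subseteq> toric_monoid \<sigma>"
  shows "continuous_map (trop_toric_topology \<sigma>) euclideanreal (\<lambda>a. exp_ext (trop_eval f a))"
proof -
  let ?X = "trop_toric_topology \<sigma>"
  have coord: "continuous_map ?X euclideanreal (\<lambda>a. exp_ext (a u))" if "u \<in> toric_monoid \<sigma>" for u
  proof -
    have "continuous_map ext_line_topology euclideanreal (id \<circ> exp_ext)"
      unfolding ext_line_topology_def by (rule continuous_map_pullback) simp
    moreover have "continuous_map ?X ext_line_topology (\<lambda>a. a u)"
      unfolding trop_toric_topology_def using that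
      by (intro continuous_map_from_subtopology continuous_map_product_projection)
    ultimately have "continuous_map ?X euclideanreal ((id \<circ> exp_ext) \<circ> (\<lambda>a. a u))"
      by (rule continuous_map_compose[rotated])
    then show ?thesis by (simp add: o_def)
  qed
  have "continuous_map ?X euclideanreal
      (\<lambda>a. exp_ext (trop_log (\<Sum>u\<in>K. coeff f u * point_values a u)))"
    if "finite K" "K \<subseteq> toric_monoid \<sigma>" for K
    using that
  proof (induction K rule: finite_induct)
    case (insert u K)
    have "continuous_map ?X euclideanreal (\<lambda>a. max (exp_ext (trop_log (coeff f u)) * exp_ext (a u))
        (exp_ext (trop_log (\<Sum>u\<in>K. coeff f u * point_values a u))))"
      using insert coord by (intro continuous_map_real_max continuous_map_real_mult_left) auto
    moreover have "trop_log (point_values a u) = a u" if "a \<in> topspace ?X" for a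
      using that insert.prems trop_toric_varietyD(1)[of a \<sigma> u]
      by (simp add: topspace_trop_toric_topology point_values_def Abs_trop_inverse)
    ultimately show ?case
      using insert.hyps by (elim continuous_map_eq) (simp add: exp_ext_trop)
  qed simp
  from this[OF finite_keys assms] show ?thesis
  proof (rule continuous_map_eq)
    fix a assume "a \<in> topspace ?X"
    then have a: "a \<in> trop_toric_variety \<sigma>" by (simp add: topspace_trop_toric_topology)
    show "exp_ext (trop_log (\<Sum>u\<in>supp f. coeff f u * point_values a u))
        = exp_ext (trop_eval f a)"
      using trop_eval_eq[OF assms trop_toric_varietyD(1)[OF a]] by (simp add: eval_trop_def)
  qed
qed

lemma trop_eval_eq_on_closure:
  assumes f: "supp f \<subseteq> toric_monoid \<sigma>" and g: "supp g \<subseteq> toric_monoid \<sigma>"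
    and eq: "\<And>a. a \<in> T \<Longrightarrow> trop_eval f a = trop_eval g a"
    and T: "T \<subseteq> trop_toric_variety \<sigma>" and a: "a \<in> trop_toric_topology \<sigma> closure_of T"
  shows "trop_eval f a = trop_eval g a"
proof -
  let ?X = "trop_toric_topology \<sigma>"
  let ?E = "{a \<in> topspace ?X. exp_ext (trop_eval f a) = exp_ext (trop_eval g a)}"
  have "closedin ?X ?E"
    by (rule closedin_continuous_maps_eq[OF _ continuous_map_eval_trop[OF f] continuous_map_eval_trop[OF g]]) simp
  moreover have "T \<subseteq> ?E" using eq T by (auto simp: topspace_trop_toric_topology)
  ultimately have "a \<in> ?E" using a closure_of_minimal by blast
  then have a: "a \<in> trop_toric_variety \<sigma>" and eq: "exp_ext (trop_eval f a) = exp_ext (trop_eval g a)"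
    by (simp_all add: topspace_trop_toric_topology)
  have "trop_eval f a = trop_log (eval_trop (point_values a) f)"
    "trop_eval g a = trop_log (eval_trop (point_values a) g)"
    using trop_eval_eq[OF f, of a] trop_eval_eq[OF g, of a] trop_toric_varietyD(1)[OF a] by blast+
  then show ?thesis using eq exp_ext_trop(3) by metis
qed

section \<open>The total order defined by a prime congruence\<close>

locale tropical_prime =
  fixes S :: "trop set" and M :: "'m::ab_group_add set"
    and P :: "(('m \<Rightarrow>\<^sub>0 trop) \<times> ('m \<Rightarrow>\<^sub>0 trop)) set"
  assumes S: "sub_semifield S" and M: "additive_submonoid M"
    and prime: "prime_congruence (monoid_algebra S M) P"
begin

abbreviation A :: "('m \<Rightarrow>\<^sub>0 trop) set"
  where "A \<equiv> carrier (monoid_algebra S M)"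

definition le :: "('m \<Rightarrow>\<^sub>0 trop) \<Rightarrow> ('m \<Rightarrow>\<^sub>0 trop) \<Rightarrow> bool"
  where "le f g \<longleftrightarrow> (f + g, g) \<in> P"

lemma closed: "closed_structure (monoid_algebra S M)"
  by (rule monoid_algebra_closed[OF S M])

lemma add_A [intro]: "f \<in> A \<Longrightarrow> g \<in> A \<Longrightarrow> f + g \<in> A"
  and mult_A [intro]: "f \<in> A \<Longrightarrow> g \<in> A \<Longrightarrow> f * g \<in> A"
  and zero_A [simp]: "0 \<in> A"
  using closed by (auto simp: closed_structure_def monoid_algebra_sel(2,4,5))

lemma mono_A [intro]: "u \<in> M \<Longrightarrow> s \<in> S \<Longrightarrow> monomial u s \<in> A"
  by (rule monoid_algebra_closed(3)[OF S M])

lemma cong_P: "congruence (monoid_algebra S M) P"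
  using prime by (simp add: prime_congruence_def)

lemma P_in_A: "(f, g) \<in> P \<Longrightarrow> f \<in> A \<and> g \<in> A"
  by (rule congruenceD(7)[OF cong_P])

lemma P_refl: "f \<in> A \<Longrightarrow> (f, f) \<in> P"
  and P_sym: "(f, g) \<in> P \<Longrightarrow> (g, f) \<in> P"
  and P_trans: "(f, g) \<in> P \<Longrightarrow> (g, h) \<in> P \<Longrightarrow> (f, h) \<in> P"
  by (rule congruenceD(4-6)[OF cong_P], assumption+)+

lemma P_add: "(f, g) \<in> P \<Longrightarrow> (f', g') \<in> P \<Longrightarrow> (f + f', g + g') \<in> P"
  and P_mult: "(f, g) \<in> P \<Longrightarrow> (f', g') \<in> P \<Longrightarrow> (f * f', g * g') \<in> P"
  using congruenceD(2,3)[OF cong_P, of f g f' g'] by (simp_all add: monoid_algebra_sel(2,5))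

lemma P_cancel:
  assumes "(h, 0) \<notin> P" "h \<in> A" "f \<in> A" "g \<in> A" "(h * f, h * g) \<in> P"
  shows "(f, g) \<in> P"
proof -
  have "cancellative (quotient_semiring (monoid_algebra S M) P)"
    using prime unfolding prime_congruence_def by blast
  then have "\<forall>x\<in>A. (x, 0) \<notin> P \<longrightarrow> (\<forall>y\<in>A. \<forall>z\<in>A. (x * y, x * z) \<in> P \<longrightarrow> (y, z) \<in> P)"
    unfolding cancellative_quotient_iff[OF cong_P closed] monoid_algebra_sel(2,4) .
  then show ?thesis using assms by blast
qed

lemma le_total:
  assumes "f \<in> A" "g \<in> A"
  shows "le f g \<or> le g f"
proof -
  have "totally_ordered (quotient_semiring (monoid_algebra S M) P)"
    using prime unfolding prime_congruence_def by blast
  then have "\<forall>x\<in>A. \<forall>y\<in>A. (x + y, y) \<in> P \<or> (y + x, x) \<in> P"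
    unfolding totally_ordered_quotient_iff[OF cong_P closed] monoid_algebra_sel(5) .
  then show ?thesis using assms unfolding le_def by blast
qed

lemma idem: "(f :: 'm \<Rightarrow>\<^sub>0 trop) + f = f"
  by (rule poly_mapping_eqI) (use trop_add_cases in \<open>auto simp: lookup_add\<close>)

lemma le_refl: "f \<in> A \<Longrightarrow> le f f"
  by (simp add: le_def idem P_refl)

lemma le_in_A: "le f g \<Longrightarrow> g \<in> A"
  using P_in_A by (auto simp: le_def)

lemma le_trans:
  assumes "f \<in> A" "le f g" "le g h"
  shows "le f h"
proof -
  have h: "h \<in> A" using le_in_A assms by blast
  have "(f + h, f + (g + h)) \<in> P" using P_add[OF P_refl[OF assms(1)] P_sym] assms(3) by (simp add: le_def)
  moreover have "(f + (g + h), g + h) \<in> P"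
    using P_add[OF _ P_refl[OF h]] assms(2) by (simp add: le_def add.assoc[symmetric])
  moreover have "(g + h, h) \<in> P" using assms(3) by (simp add: le_def)
  ultimately have "(f + h, h) \<in> P" by (meson P_trans)
  then show ?thesis by (simp add: le_def)
qed

lemma le_antisym: "le f g \<Longrightarrow> le g f \<Longrightarrow> (f, g) \<in> P"
  unfolding le_def using P_trans P_sym by (metis add.commute)

lemma le_of_P: "(f, g) \<in> P \<Longrightarrow> le f g"
  using P_add[of f g g g] P_refl[of g] P_in_A[of f g] by (simp add: le_def idem)

lemma le_mult: "h \<in> A \<Longrightarrow> le f g \<Longrightarrow> le (h * f) (h * g)"
  using P_mult[OF P_refl] by (simp add: le_def distrib_left[symmetric])

lemma le_cancel: "(h, 0) \<notin> P \<Longrightarrow> h \<in> A \<Longrightarrow> f \<in> A \<Longrightarrow> g \<in> A \<Longrightarrow> le (h * f) (h * g) \<Longrightarrow> le f g"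
  unfolding le_def distrib_left[symmetric] by (rule P_cancel) auto

lemma zero_le: "f \<in> A \<Longrightarrow> le 0 f"
  by (simp add: le_def P_refl)

lemma le_add1: "f \<in> A \<Longrightarrow> g \<in> A \<Longrightarrow> le f (f + g)"
  by (auto simp: le_def add.assoc[symmetric] idem intro: P_refl)

lemma le_mono: "u \<in> M \<Longrightarrow> t \<in> S \<Longrightarrow> s \<le> t \<Longrightarrow> le (monomial u s) (monomial u t)"
  by (auto simp: le_def single_add[symmetric] less_eq_trop_def intro: P_refl)

lemma not_le_add:
  assumes "f \<in> A" "g \<in> A" "h \<in> A" "\<not> le h f" "\<not> le h g"
  shows "\<not> le h (f + g)"
proof
  assume *: "le h (f + g)"
  have "le (f + g) g \<or> le (f + g) f"
    using le_total[OF assms(1,2)] le_of_P[of "f + g" g] le_of_P[of "g + f" f]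
    unfolding le_def[of f g] le_def[of g f] add.commute[of g f] by blast
  then show False using le_trans[OF assms(3) *] assms(4,5) by blast
qed

lemma not_le_sum:
  assumes "finite K" "\<And>i. i \<in> K \<Longrightarrow> f i \<in> A" "h \<in> A" "\<not> le h 0" "\<And>i. i \<in> K \<Longrightarrow> \<not> le h (f i)"
  shows "\<not> le h (\<Sum>i\<in>K. f i) \<and> (\<Sum>i\<in>K. f i) \<in> A"
  using assms(1,2,5)
proof (induction K rule: finite_induct)
  case (insert i K)
  then show ?case using not_le_add[of "f i" "\<Sum>i\<in>K. f i" h] assms(3) by auto
qed (use assms(4) in auto)

lemma not_le_zero: "(h, 0) \<notin> P \<Longrightarrow> h \<in> A \<Longrightarrow> \<not> le h 0"
  by (simp add: le_def)

lemma one_not_zero: "(1, 0) \<notin> P"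
proof
  assume 1: "(1, 0) \<in> P"
  have z: "(f, 0) \<in> P" if "f \<in> A" for f using P_mult[OF P_refl[OF that] 1] by simp
  have "(f, g) \<in> P" if "f \<in> A" "g \<in> A" for f g using P_trans[OF z P_sym[OF z]] that .
  then have "P = A \<times> A" using P_in_A by auto
  then show False using prime by (simp add: prime_congruence_def)
qed

text \<open>The exponents of monomials outside the kernel of the quotient map. The kernel is prime by
cancellation, so this is a face of the monoid.\<close>

definition face :: "'m set"
  where "face = {u \<in> M. (monomial u 1, 0) \<notin> P}"

lemma face_subset: "u \<in> face \<Longrightarrow> u \<in> M"
  by (simp add: face_def)

lemma one_S: "1 \<in> S" and S_mult: "s \<in> S \<Longrightarrow> t \<in> S \<Longrightarrow> s * t \<in> S"
  using sub_semifieldD[OF S] by blast+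

lemma M_add: "u \<in> M \<Longrightarrow> w \<in> M \<Longrightarrow> u + w \<in> M"
  using M by (simp add: additive_submonoid_def)

lemma zero_face: "0 \<in> face"
  using M one_not_zero by (simp add: face_def additive_submonoid_def)

lemma face_add_iff:
  assumes "u \<in> M" "w \<in> M"
  shows "u + w \<in> face \<longleftrightarrow> u \<in> face \<and> w \<in> face"
proof -
  have m: "monomial (u + w) (1::trop) = monomial u 1 * monomial w 1" by (simp add: mult_single)
  have uA: "monomial u 1 \<in> A" "monomial w 1 \<in> A" using assms one_S by auto
  have "(monomial (u + w) 1, 0) \<in> P" if "(monomial u 1, 0) \<in> P"
    using P_mult[OF that P_refl[OF uA(2)]] m by simp
  moreover have "(monomial (u + w) 1, 0) \<in> P" if "(monomial w 1, 0) \<in> P"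
    using P_mult[OF P_refl[OF uA(1)] that] m by simp
  moreover have "(monomial w 1, 0) \<in> P" if "(monomial (u + w) 1, 0) \<in> P" "(monomial u 1, 0) \<notin> P"
    using P_cancel[OF that(2) uA zero_A] that(1) m by simp
  ultimately show ?thesis using assms M_add by (auto simp: face_def)
qed

lemma mono_off_face:
  assumes "u \<in> M" "u \<notin> face" "s \<in> S"
  shows "(monomial u s, 0) \<in> P"
proof -
  have "(monomial 0 s * monomial u 1, monomial 0 s * 0) \<in> P"
    using assms M by (intro P_mult P_refl mono_A) (auto simp: face_def additive_submonoid_def)
  then show ?thesis by (simp add: mult_single)
qed

text \<open>The terms that are strictly below \<open>1\<close> modulo \<open>P\<close>, together with the negative constants. The latter
  matter when \<open>P\<close> identifies constants of \<open>S\<close> with \<open>1\<close>: they make the original valuation break the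
  ties that \<open>P\<close> leaves.\<close>

definition prime_cone :: "(real \<times> 'm) set"
  where "prime_cone = {(t, w). (\<exists>s u u'. s \<in> S \<and> s \<noteq> 0 \<and> u \<in> face \<and> u' \<in> face \<and> w = u - u' \<and>
      t \<le> trop_real s \<and> \<not> le (monomial u' 1) (monomial u s)) \<or> (w = 0 \<and> t < 0)}"

definition face_group :: "'m set"
  where "face_group = {u - w | u w. u \<in> face \<and> w \<in> face}"

lemma face_add: "u \<in> face \<Longrightarrow> w \<in> face \<Longrightarrow> u + w \<in> face"
  using face_add_iff face_subset by blast

lemma face_group_subgroup: "add_subgroup face_group"
  unfolding add_subgroup_def face_group_def
proof (intro conjI ballI)
  show "0 \<in> {u - w | u w. u \<in> face \<and> w \<in> face}" using zero_face by force
  fix x assume "x \<in> {u - w | u w. u \<in> face \<and> w \<in> face}"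
  then obtain u w where x: "x = u - w" "u \<in> face" "w \<in> face" by blast
  then have "- x = w - u" by simp
  then show "- x \<in> {u - w | u w. u \<in> face \<and> w \<in> face}" using x by blast
  fix y assume "y \<in> {u - w | u w. u \<in> face \<and> w \<in> face}"
  then obtain u' w' where y: "y = u' - w'" "u' \<in> face" "w' \<in> face" by blast
  have "x + y = (u + u') - (w + w')" using x y by simp
  then show "x + y \<in> {u - w | u w. u \<in> face \<and> w \<in> face}" using face_add x y by blast
qed

lemma prime_cone_snd: "q \<in> prime_cone \<Longrightarrow> snd q \<in> face_group"
  using add_subgroupD(1)[OF face_group_subgroup] unfolding prime_cone_def face_group_def by auto blast

lemma prime_cone_value_closed: "value_closed prime_cone"
  unfolding value_closed_def prime_cone_def by (auto intro: order_trans)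

lemma prime_cone_neg: "t < 0 \<Longrightarrow> (t, 0) \<in> prime_cone"
  by (simp add: prime_cone_def)

lemma prime_cone_zero:
  assumes "(t, 0) \<in> prime_cone"
  shows "t < 0"
proof (rule ccontr)
  assume t: "\<not> t < 0"
  then obtain s u where s: "s \<in> S" "s \<noteq> 0" "u \<in> face" "t \<le> trop_real s" "\<not> le (monomial u 1) (monomial u s)"
    using assms by (auto simp: prime_cone_def)
  have "trop_real 1 \<le> trop_real s" using t s(4) by (simp add: trop_real_1)
  then have "1 \<le> s" using trop_real_le_iff[of 1 s] s(2) trop_log_0 trop_log_1
    by (metis MInfty_neq_ereal(1) zero_ereal_def)
  then show False using le_mono[of u s 1] s face_subset by blast
qed

lemma prime_cone_add:
  assumes "q \<in> prime_cone" "r \<in> prime_cone"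
  shows "q + r \<in> prime_cone"
proof -
  obtain t w t' w' where qr: "q = (t, w)" "r = (t', w')" by (cases q, cases r)
  have down: "(t + t', w) \<in> prime_cone" if "(t, w) \<in> prime_cone" "t' < 0" for t t' w
    using that prime_cone_value_closed unfolding value_closed_def by (metis add_le_same_cancel1 less_imp_le)
  show ?thesis
  proof (cases "(w = 0 \<and> t < 0) \<or> (w' = 0 \<and> t' < 0)")
    case True
    then show ?thesis using down[of t w t'] down[of t' w' t] assms by (auto simp: qr add.commute)
  next
    case False
    then obtain s u u' s' y y' where
      1: "s \<in> S" "s \<noteq> 0" "u \<in> face" "u' \<in> face" "w = u - u'" "t \<le> trop_real s" "\<not> le (monomial u' 1) (monomial u s)"
      and 2: "s' \<in> S" "s' \<noteq> 0" "y \<in> face" "y' \<in> face" "w' = y - y'" "t' \<le> trop_real s'" "\<not> le (monomial y' 1) (monomial y s')"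
      using assms unfolding qr prime_cone_def by auto
    have in_A: "monomial u s \<in> A" "monomial u' 1 \<in> A" "monomial y s' \<in> A" "monomial y' 1 \<in> A"
      using 1 2 face_subset one_S by auto
    have nle: "\<not> le (monomial (u' + y') 1) (monomial (u + y) (s * s'))"
    proof
      assume "le (monomial (u' + y') 1) (monomial (u + y) (s * s'))"
      then have *: "le (monomial u' 1 * monomial y' 1) (monomial u s * monomial y s')" by (simp add: mult_single)
      have "le (monomial u s) (monomial u' 1)" using le_total in_A 1 by blast
      then have "le (monomial y s' * monomial u s) (monomial y s' * monomial u' 1)" using le_mult in_A by blast
      then have "le (monomial u' 1 * monomial y' 1) (monomial u' 1 * monomial y s')"
        using le_trans[OF _ *] in_A by (auto simp: mult.commute)
      then have "le (monomial y' 1) (monomial y s')"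
        using le_cancel[of "monomial u' 1"] in_A 1(4) by (auto simp: face_def)
      then show False using 2 by blast
    qed
    have "(t + t', w + w') \<in> prime_cone"
      unfolding prime_cone_def mem_Collect_eq split
    proof (intro disjI1 exI conjI)
      show "s * s' \<in> S" "u + y \<in> face" "u' + y' \<in> face" using 1 2 face_add S_mult by blast+
      show "s * s' \<noteq> 0" using 1 2 by (simp add: trop_no_zero_divisors)
      show "t + t' \<le> trop_real (s * s')" using 1 2 by (simp add: trop_real_mult)
      show "w + w' = (u + y) - (u' + y')" using 1 2 by simp
    qed (rule nle)
    then show ?thesis by (simp add: qr)
  qed
qed

end

section \<open>Localizing an ideal at the face of a prime congruence\<close>

definition monoid_ideal :: "'m::ab_group_add set \<Rightarrow> ('m \<Rightarrow>\<^sub>0 'k::field) set \<Rightarrow> bool"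
  where "monoid_ideal M J \<longleftrightarrow> 0 \<in> J \<and> (\<forall>F\<in>J. supp F \<subseteq> M) \<and> (\<forall>F\<in>J. \<forall>G\<in>J. F + G \<in> J) \<and>
    (\<forall>F\<in>J. \<forall>u\<in>M. \<forall>x. monomial u x * F \<in> J)"

lemma monoid_idealD:
  assumes "monoid_ideal M J"
  shows "0 \<in> J" "F \<in> J \<Longrightarrow> coeff F u \<noteq> 0 \<Longrightarrow> u \<in> M" "F \<in> J \<Longrightarrow> G \<in> J \<Longrightarrow> F + G \<in> J"
    "F \<in> J \<Longrightarrow> u \<in> M \<Longrightarrow> monomial u x * F \<in> J"
  using assms unfolding monoid_ideal_def by (auto simp flip: in_keys_iff)

lemma monoid_ideal_of_ideal:
  assumes J: "ideal J (monoid_algebra UNIV M)"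
  shows "monoid_ideal M J"
proof -
  interpret ideal J "monoid_algebra UNIV M" by (rule J)
  have "F + G \<in> J" if "F \<in> J" "G \<in> J" for F G
    using additive_subgroup.a_closed[OF additive_subgroup_axioms that] by (simp add: monoid_algebra_sel(5))
  moreover have "monomial u x * F \<in> J" if "F \<in> J" "u \<in> M" for F u x
    using I_l_closed[OF that(1), of "monomial u x"] that(2)
    by (simp add: monoid_algebra_sel)
  moreover have "0 \<in> J" using additive_subgroup.zero_closed[OF additive_subgroup_axioms] by (simp add: monoid_algebra_sel(4))
  moreover have "supp F \<subseteq> M" if "F \<in> J" for F
    using additive_subgroup.a_subset[OF additive_subgroup_axioms] that by (auto simp: monoid_algebra_sel(1))
  ultimately show ?thesis unfolding monoid_ideal_def by simp
qed

context tropical_prime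
begin

text \<open>Modulo \<open>P\<close> only the part of a polynomial on the face matters, and monomials on the face may be
inverted. So \<open>F\<close> belongs to the localization if some monomial multiple of \<open>F\<close> is supported on the face
and is the part on the face of an element \<open>G\<close> of the ideal.\<close>

definition face_localization :: "('m \<Rightarrow>\<^sub>0 'k::field) set \<Rightarrow> ('m \<Rightarrow>\<^sub>0 'k) set"
  where "face_localization J = {F. \<exists>h\<in>face. (\<forall>w. coeff F w \<noteq> 0 \<longrightarrow> w + h \<in> face) \<and>
    (\<exists>G\<in>J. \<forall>w\<in>face. coeff G w = coeff F (w - h))}"

text \<open>Shifting by \<open>t\<close> can leave the face only by leaving the monoid, where both sides vanish.\<close>

lemma face_shift:
  assumes J: "monoid_ideal M J" and G: "G \<in> J" "\<forall>w\<in>face. coeff G w = coeff F (w - h)"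
    and F: "\<forall>w. coeff F w \<noteq> 0 \<longrightarrow> w + h \<in> face" and t: "t \<in> face" and w: "w \<in> face"
  shows "coeff G (w - t) = coeff F (w - t - h)"
proof (cases "w - t \<in> face")
  case True
  then show ?thesis using G(2) by blast
next
  case False
  have "w - t \<notin> M" using face_add_iff[of "w - t" t] w t False face_subset by auto
  then have "coeff G (w - t) = 0" using monoid_idealD(2)[OF J G(1)] by blast
  moreover have "coeff F (w - t - h) = 0"
    using F[rule_format, of "w - t - h"] False by auto
  ultimately show ?thesis by simp
qed

lemma face_localization_laurent_ideal:
  assumes J: "monoid_ideal M (J :: ('m \<Rightarrow>\<^sub>0 'k::field) set)"
  shows "laurent_ideal face_group (face_localization J)"
  unfolding laurent_ideal_def
proof (intro conjI ballI allI)
  show "0 \<in> face_localization J"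
    unfolding face_localization_def using zero_face monoid_idealD(1)[OF J] by force
  fix F assume "F \<in> face_localization J"
  then obtain h G where h: "h \<in> face" "\<forall>w. coeff F w \<noteq> 0 \<longrightarrow> w + h \<in> face"
    and G: "G \<in> J" "\<forall>w\<in>face. coeff G w = coeff F (w - h)"
    unfolding face_localization_def by blast
  note shift = face_shift[OF J G h(2)]
  show "supp F \<subseteq> face_group"
  proof
    fix w assume "w \<in> supp F"
    then have "w + h \<in> face" using h(2) by (simp add: in_keys_iff)
    then have "w = (w + h) - h \<and> w + h \<in> face \<and> h \<in> face" using h(1) by simp
    then show "w \<in> face_group" unfolding face_group_def by blast
  qed
  show "F + F' \<in> face_localization J" if "F' \<in> face_localization J" for F'
  proof -
    obtain h' G' where h': "h' \<in> face" "\<forall>w. coeff F' w \<noteq> 0 \<longrightarrow> w + h' \<in> face"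
      and G': "G' \<in> J" "\<forall>w\<in>face. coeff G' w = coeff F' (w - h')"
      using \<open>F' \<in> face_localization J\<close> unfolding face_localization_def by blast
    note shift' = face_shift[OF J G' h'(2)]
    let ?G = "monomial h' 1 * G + monomial h 1 * G'"
    have "?G \<in> J" using monoid_idealD(3,4)[OF J] G(1) G'(1) h(1) h'(1) face_subset by blast
    moreover have "coeff ?G w = coeff (F + F') (w - (h + h'))" if "w \<in> face" for w
      using shift[OF h'(1) that] shift'[OF h(1) that]
      unfolding lookup_add lookup_single_mult by (simp add: algebra_simps)
    moreover have "w + (h + h') \<in> face" if "coeff (F + F') w \<noteq> 0" for w
    proof -
      have "w + h \<in> face \<or> w + h' \<in> face" using that h(2) h'(2)
        by (cases "coeff F w = 0") (auto simp: lookup_add)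
      then have "(w + h) + h' \<in> face \<or> (w + h') + h \<in> face" using face_add h(1) h'(1) by blast
      then show ?thesis by (simp add: algebra_simps)
    qed
    ultimately show ?thesis unfolding face_localization_def using face_add[OF h(1) h'(1)] by blast
  qed
  fix u x assume "u \<in> face_group"
  then obtain a b where u: "u = a - b" "a \<in> face" "b \<in> face" unfolding face_group_def by blast
  let ?G = "monomial a x * G"
  have "?G \<in> J" using monoid_idealD(4)[OF J G(1)] u(2) face_subset by blast
  moreover have "coeff ?G w = coeff (monomial u x * F) (w - (h + b))"
    if "w \<in> face" for w
  proof -
    have "w - (h + b) - u = w - a - h" by (simp add: u(1) algebra_simps)
    then show ?thesis using shift[OF u(2) that] by (simp only: lookup_single_mult)
  qed
  moreover have "w + (h + b) \<in> face" if "coeff (monomial u x * F) w \<noteq> 0" for w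
  proof -
    have "(w - u) + h \<in> face" using that h(2) by (simp add: lookup_single_mult)
    then have "((w - u) + h) + a \<in> face" using face_add u(2) by blast
    then show ?thesis by (simp add: u(1) algebra_simps)
  qed
  ultimately show "monomial u x * F \<in> face_localization J"
    unfolding face_localization_def using face_add[OF h(1) u(3)] by blast
qed

lemma restrict_in_face_localization:
  assumes "F \<in> J"
  shows "restrict_poly face F \<in> face_localization J"
  unfolding face_localization_def mem_Collect_eq using zero_face assms
  by (intro bexI[of _ 0] conjI bexI[of _ F]) (auto simp: restrict_poly.rep_eq)

lemma keys_A: "f \<in> A \<Longrightarrow> u \<in> supp f \<Longrightarrow> u \<in> M"
  and lookup_A: "f \<in> A \<Longrightarrow> coeff f u \<in> S"
  by (auto simp: monoid_algebra_sel(1))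

lemma mono_lookup_A: "f \<in> A \<Longrightarrow> u \<in> supp f \<Longrightarrow> monomial u (coeff f u) \<in> A"
  using keys_A lookup_A by blast

lemma lookup_trop: "v 0 = 0 \<Longrightarrow> coeff (Poly_Mapping.map v F) u = v (coeff F u)"
  by (simp add: Poly_Mapping.map.rep_eq when_def)

text \<open>An element of the localization of the form \<open>1\<close> plus terms in the cone would give an element of the
  ideal whose tropicalization has a coefficient \<open>1\<close> at some \<open>h\<close> on the face, and all of whose other terms
  are strictly below the monomial \<open>h\<close> modulo \<open>P\<close>. Its bend relation at \<open>h\<close> then fails in \<open>P\<close>. The constant
  coefficient causes no trouble: the cone bounds its deviation from \<open>1\<close> by a value below that of \<open>1\<close>.\<close>

lemma prime_cone_admissible:
  fixes v :: "'k::field \<Rightarrow> trop"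
  assumes v: "valuation_into S v" and J: "monoid_ideal M J"
    and bend: "\<And>f. f \<in> trop_ideal v J \<Longrightarrow> bend_relations f \<subseteq> P"
  shows "nonarchimedean.admissible (\<lambda>x. trop_real (v x)) face_group (face_localization J) prime_cone"
proof -
  interpret nonarchimedean "\<lambda>x. trop_real (v x)" by (rule nonarchimedean_valuation[OF v])
  have v0: "v 0 = 0" and vnz: "\<And>x. v x = 0 \<longleftrightarrow> x = 0" and vS: "\<And>x. v x \<in> S"
    using v unfolding valuation_into_def by auto
  have "\<not> terms_in prime_cone (F - 1)" if F: "F \<in> face_localization J" for F
  proof
    assume ti: "terms_in prime_cone (F - 1)"
    obtain h G where h: "h \<in> face" "\<forall>w. coeff F w \<noteq> 0 \<longrightarrow> w + h \<in> face"
      and G: "G \<in> J" "\<forall>w\<in>face. coeff G w = coeff F (w - h)"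
      using F unfolding face_localization_def by blast
    define f where "f = Poly_Mapping.map v G"
    have lf: "coeff f u = v (coeff G u)" for u
      unfolding f_def by (rule lookup_trop[of v, OF v0])
    have fA: "f \<in> A" using monoid_idealD(2)[OF J G(1)] vS
      by (auto simp: monoid_algebra_sel(1) in_keys_iff lf vnz)
    have hM: "h \<in> M" using h(1) face_subset by blast
    let ?X = "monomial h 1"
    have XA: "?X \<in> A" and Xnz: "(?X, 0) \<notin> P" using h(1) hM one_S by (auto simp: face_def)
    have n: "coeff (F - 1) w = coeff F w - (1 when w = 0)" for w
      by (simp add: lookup_minus lookup_one)
    have fh: "coeff f h = 1"
    proof -
      let ?n = "coeff (F - 1) 0"
      have "below ?n (trop_real (v 1))"
      proof (cases "?n = 0")
        case False
        then have "(trop_real (v ?n), 0) \<in> prime_cone" using ti by (auto simp: terms_in_def tterm_def in_keys_iff)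
        then show ?thesis using prime_cone_zero by (simp add: below_def)
      qed (simp add: below_def)
      from lv_add_below[OF _ this] have "1 + ?n \<noteq> 0" "trop_real (v (1 + ?n)) = trop_real (v 1)" by auto
      moreover have "v 1 = 1" using v unfolding valuation_into_def by blast
      moreover have "coeff f h = v (1 + ?n)" using G(2) h(1) n[of 0] by (simp add: lf)
      ultimately have "coeff f h \<noteq> 0" "trop_real (coeff f h) = 0"
        by (auto simp: vnz trop_real_1)
      then have "trop_log (coeff f h) = trop_log 1"
        using trop_log_real by (metis trop_log_1 zero_ereal_def)
      then show ?thesis by (simp add: trop_log_inject)
    qed
    let ?D = "delete_term h f"
    have hk: "h \<in> supp f" using fh trop_log_0 trop_log_1
      by (metis in_keys_iff MInfty_neq_ereal(1) zero_ereal_def)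
    have DA: "?D \<in> A" using fA sub_semifieldD(1)[OF S]
      by (auto simp: monoid_algebra_sel(1) keys_delete_term lookup_delete_term)
    have "(f, ?D) \<in> P" using bend[of f] G(1) hk by (auto simp: trop_ideal_def f_def bend_relations_def)
    moreover have "f = ?X + ?D"
      by (rule poly_mapping_eqI) (simp add: lookup_add lookup_delete_term lookup_single when_def fh)
    then have "le ?X f" using le_add1[OF XA DA] by simp
    ultimately have "le ?X ?D" using le_trans[OF XA _ le_of_P] by blast
    moreover have "\<not> le ?X (monomial u (coeff ?D u))" if u: "u \<in> supp ?D" for u
    proof
      let ?c = "coeff f u"
      have uf: "u \<in> supp f" "u \<noteq> h" using u by (auto simp: keys_delete_term)
      have uM: "u \<in> M" "?c \<in> S" using keys_A[OF fA uf(1)] lookup_A[OF fA] by blast+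
      assume "le ?X (monomial u (coeff ?D u))"
      then have le: "le ?X (monomial u ?c)" using uf(2) by (simp add: lookup_delete_term)
      show False
      proof (cases "u \<in> face")
        case False
        then have "le ?X 0" using le_trans[OF XA le le_of_P[OF mono_off_face]] uM by blast
        then show False using not_le_zero[OF Xnz XA] by blast
      next
        case True
        define w where "w = u - h"
        have w0: "w \<noteq> 0" using uf(2) by (simp add: w_def)
        have c: "?c = v (coeff (F - 1) w)"
          using G(2) True w0 by (simp add: lf n w_def)
        then have "coeff (F - 1) w \<noteq> 0" using uf(1) by (auto simp: in_keys_iff vnz v0)
        then have "(trop_real ?c, w) \<in> prime_cone"
          using ti c by (auto simp: terms_in_def tterm_def in_keys_iff)
        then obtain s y y' where s: "s \<in> S" "s \<noteq> 0" "y \<in> face" "y' \<in> face" "w = y - y'"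
          "trop_real ?c \<le> trop_real s" "\<not> le (monomial y' 1) (monomial y s)"
          using w0 unfolding prime_cone_def by auto
        have yM: "y \<in> M" "y' \<in> M" using s face_subset by auto
        have cs: "?c \<le> s" using trop_real_le_iff[of ?c s] s uf(1) by (simp add: in_keys_iff)
        have uy: "u + y' = h + y" using s(5) by (simp add: w_def algebra_simps)
        have "le (monomial y' 1 * ?X) (monomial y' 1 * monomial u ?c)"
          using le_mult[OF _ le] yM one_S by blast
        then have "le (?X * monomial y' 1) (monomial (h + y) ?c)"
          using uy by (simp add: mult_single add.commute)
        moreover have "le (monomial (h + y) ?c) (monomial (h + y) s)" using le_mono cs s(1) M_add hM yM by blast
        moreover have "?X * monomial y' 1 \<in> A" using XA yM one_S by blast
        ultimately have "le (?X * monomial y' 1) (?X * monomial y s)"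
          using le_trans by (simp add: mult_single)
        then have "le (monomial y' 1) (monomial y s)"
          using le_cancel[OF Xnz XA] yM one_S s(1) by blast
        then show False using s(7) by blast
      qed
    qed
    then have "\<not> le ?X ?D"
      using not_le_sum[of "supp ?D" "\<lambda>u. monomial u (coeff ?D u)" ?X]
        mono_lookup_A[OF DA] XA not_le_zero[OF Xnz XA] poly_mapping_sum_monomials[of ?D] by simp
    ultimately show False by blast
  qed
  then show ?thesis
    unfolding admissible_def
    using prime_cone_snd prime_cone_add prime_cone_neg prime_cone_value_closed by blast
qed

end

section \<open>The tropical Nullstellensatz for tropicalized ideals\<close>

lemma trop_eval_le:
  assumes "\<And>u. u \<in> supp f \<Longrightarrow> trop_log (coeff f u) + a u \<le> z"
  shows "trop_eval f a \<le> z"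
  using assms by (auto simp: trop_eval_def)

lemma trop_eval_less:
  assumes "\<And>u. u \<in> supp f \<Longrightarrow> trop_log (coeff f u) + a u < z" "- \<infinity> < z"
  shows "trop_eval f a < z"
  using assms by (auto simp: trop_eval_def)

lemma le_trop_eval:
  assumes "u \<in> supp f"
  shows "trop_log (coeff f u) + a u \<le> trop_eval f a"
  using assms by (auto simp: trop_eval_def)

definition face_point :: "'m set \<Rightarrow> 'm set \<Rightarrow> ('m \<Rightarrow> real) \<Rightarrow> 'm \<Rightarrow> ereal"
  where "face_point M D a = (\<lambda>u\<in>M. if u \<in> D then ereal (a u) else - \<infinity>)"

text \<open>The cone of \<open>P\<close> is extended to an order for which the localized ideal bends, this order is
approximated by a real functional, and the point is the functional on the face and minus infinity
elsewhere. Besides the finitely many conditions that guarantee bending, the functional has to keep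
each term of \<open>f\<close> on the face strictly below the dominant monomial of \<open>g\<close> modulo \<open>P\<close>.\<close>

lemma nullstellensatz_separation:
  fixes v :: "'k::field \<Rightarrow> trop" and \<sigma> :: "('m::ab_group_add \<Rightarrow> real) set"
  assumes "tropical_prime S (toric_monoid \<sigma>) P" and c: "coordinates n (c :: 'm \<Rightarrow> nat \<Rightarrow> int)"
    and v: "valuation_into S v" and J: "monoid_ideal (toric_monoid \<sigma>) J"
    and bend: "\<And>f. f \<in> trop_ideal v J \<Longrightarrow> bend_relations f \<subseteq> P"
    and fg: "f \<in> carrier (monoid_algebra S (toric_monoid \<sigma>))" "g \<in> carrier (monoid_algebra S (toric_monoid \<sigma>))"
    and less: "\<not> tropical_prime.le P g f"
  shows "\<exists>x\<in>trop_vanishing_locus \<sigma> (trop_ideal v J). trop_eval f x < trop_eval g x"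
proof -
  let ?M = "toric_monoid \<sigma>"
  interpret tropical_prime S ?M P by fact
  interpret nonarchimedean "\<lambda>x. trop_real (v x)" by (rule nonarchimedean_valuation[OF v])
  have v0: "v 0 = 0" and vnz: "\<And>x. v x = 0 \<longleftrightarrow> x = 0" and vS: "\<And>x. v x \<in> S"
    using v unfolding valuation_into_def by auto
  note Hsub = face_group_subgroup
  note JH = face_localization_laurent_ideal[OF J]
  obtain W where W: "tropical_order face_group W" and strictW: "\<And>q. q \<in> prime_cone \<Longrightarrow> strict W q"
    and bendW: "\<And>F. F \<in> face_localization J \<Longrightarrow> bends W F"
    using admissible_extends_to_bending_order[OF Hsub JH prime_cone_admissible[OF v J bend]] by metis
  obtain E where E: "finite E" "E \<subseteq> face_group" "0 \<in> E"
    "\<And>u. u \<in> face_group \<Longrightarrow> \<exists>A. set_mset A \<subseteq> E \<and> u = sum_mset A"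
    using subgroup_finitely_generated[OF c Hsub] by metis
  obtain X where X: "finite X" "\<And>q. q \<in> X \<Longrightarrow> satisfies W q"
    and detX: "\<And>W' F. tropical_order face_group W' \<Longrightarrow> (\<And>q. q \<in> X \<Longrightarrow> satisfies W' q) \<Longrightarrow>
      F \<in> face_localization J \<Longrightarrow> bends W' F"
    using bending_finitely_determined[OF Hsub W lexicographic_tie_breaker[OF c] E JH bendW] by metis
  have g_not_0: "\<not> le g 0" using le_trans[of g 0 f] zero_le[OF fg(1)] fg(2) less by blast
  \<comment> \<open>the dominant monomial of \<open>g\<close> modulo \<open>P\<close>\<close>
  obtain m where m: "m \<in> supp g" "le g (monomial m (coeff g m))"
  proof (rule ccontr)
    assume "\<not> thesis"
    then have "\<not> le g (monomial u (coeff g u))" if "u \<in> supp g" for u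
      using \<open>\<And>m. m \<in> supp g \<Longrightarrow> le g (monomial m (coeff g m)) \<Longrightarrow> thesis\<close> that by blast
    then have "\<not> le g g"
      using not_le_sum[of "supp g" "\<lambda>u. monomial u (coeff g u)" g]
        mono_lookup_A[OF fg(2)] fg(2) g_not_0 poly_mapping_sum_monomials[of g] by simp
    then show False using le_refl[OF fg(2)] by blast
  qed
  let ?d = "coeff g m"
  have d: "?d \<in> S" "?d \<noteq> 0" using m(1) lookup_A[OF fg(2)] by (auto simp: in_keys_iff)
  have mM: "m \<in> ?M" using keys_A[OF fg(2) m(1)] .
  have mface: "m \<in> face"
  proof (rule ccontr)
    assume "m \<notin> face"
    then show False using le_trans[OF fg(2) m(2) le_of_P[OF mono_off_face[OF mM _ d(1)]]] g_not_0 by blast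
  qed
  obtain e where e: "e \<in> S" "?d * e = 1" using sub_semifieldD(5)[OF S d] by blast
  have enz: "e \<noteq> 0" using e(2) by (metis mult_zero_right trop_log_0 trop_log_1 MInfty_neq_ereal(1) zero_ereal_def)
  have real_e: "trop_real e = - trop_real ?d"
    using trop_real_mult[OF d(2) enz] e(2) trop_real_1 by simp
  have zM: "0 \<in> ?M" using zero_face face_subset by blast
  have fcone: "(trop_real (coeff f u) - trop_real ?d, u - m) \<in> prime_cone"
    if u: "u \<in> supp f" "u \<in> face" for u
  proof -
    let ?b = "coeff f u"
    have b: "?b \<in> S" "?b \<noteq> 0" using u(1) lookup_A[OF fg(1)] by (auto simp: in_keys_iff)
    have bA: "monomial u ?b \<in> A" "monomial m ?d \<in> A" using mono_lookup_A[OF fg(1) u(1)] mono_lookup_A[OF fg(2) m(1)] .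
    have "f = monomial u ?b + delete_term u f"
      by (rule poly_mapping_eqI) (simp add: lookup_add lookup_delete_term lookup_single when_def)
    moreover have "delete_term u f \<in> A" using fg(1) sub_semifieldD(1)[OF S]
      by (auto simp: monoid_algebra_sel(1) keys_delete_term lookup_delete_term)
    ultimately have "le (monomial u ?b) f" using le_add1[OF bA(1)] by metis
    then have nle: "\<not> le (monomial m ?d) (monomial u ?b)" using less le_trans fg bA m(2) by blast
    have nle': "\<not> le (monomial m 1) (monomial u (?b * e))"
    proof
      assume *: "le (monomial m 1) (monomial u (?b * e))"
      have "le (monomial 0 ?d * monomial m 1) (monomial 0 ?d * monomial u (?b * e))"
        using le_mult[OF _ *] mono_A[OF zM d(1)] by blast
      moreover have "?d * (?b * e) = ?b" using e(2) by (simp add: mult.left_commute)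
      ultimately show False using nle by (simp add: mult_single)
    qed
    show ?thesis
      unfolding prime_cone_def mem_Collect_eq split
    proof (intro disjI1 exI conjI)
      show "?b * e \<in> S" by (rule S_mult[OF b(1) e(1)])
      show "?b * e \<noteq> 0" using b enz by (simp add: trop_no_zero_divisors)
      show "trop_real ?b - trop_real ?d \<le> trop_real (?b * e)"
        using trop_real_mult[OF b(2) enz] real_e by simp
    qed (rule u(2) mface refl nle')+
  qed
  define Y where "Y = (\<lambda>u. ((trop_real (coeff f u) - trop_real ?d, u - m), True)) ` (supp f \<inter> face)"
  have "satisfies W q" if "q \<in> Y" for q
    using that strictW[OF fcone] by (auto simp: Y_def satisfies_def strict_def)
  then have satW: "satisfies W q" if "q \<in> X \<union> Y" for q using that X(2) by blast
  have finXY: "finite (X \<union> Y)" using X(1) by (simp add: Y_def)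
  obtain a :: "'m \<Rightarrow> real" where a: "\<And>u w. a (u + w) = a u + a w"
    "\<And>s u b. ((s, u), b) \<in> X \<union> Y \<Longrightarrow> nonpos (s + a u) b"
  proof (rule fourier_motzkin[OF W c finXY satW])
    fix a :: "'m \<Rightarrow> real"
    assume 1: "\<And>u w. a (u + w) = a u + a w"
      and 2: "\<And>s u b. ((s, u), b) \<in> X \<union> Y \<Longrightarrow> nonpos (s + a u) b"
    show thesis by (rule that[of a, OF 1 2])
  qed
  have a0: "a 0 = 0" using a(1)[of 0 0] by simp
  have adiff: "a (u - w) = a u - a w" for u w using a(1)[of "u - w" w] by simp
  let ?W = "order_of_functional face_group a"
  have W': "tropical_order face_group ?W" by (rule tropical_order_of_functional[OF Hsub a(1)])
  note strict' = strict_order_of_functional[OF Hsub a(1)]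
  have "satisfies ?W q" if q: "q \<in> X" for q
  proof -
    obtain s u b where qe: "q = ((s, u), b)" by (metis prod.exhaust)
    have "u \<in> face_group" using X(2)[OF q] tropical_orderD(1)[OF W, of "(s, u)"] by (simp add: qe satisfies_def)
    then show ?thesis using a(2)[of s u b] q strict'[of s u]
      by (auto simp: qe satisfies_def nonpos_def order_of_functional_def strict_def split: if_splits)
  qed
  then have bend': "bends ?W F" if "F \<in> face_localization J" for F using detX[OF W' _ that] by blast
  define x where "x = face_point ?M face a"
  have x_on: "x u = ereal (a u)" if "u \<in> face" for u
    using that face_subset by (simp add: x_def face_point_def)
  have x_off: "x u = - \<infinity>" if "u \<in> ?M" "u \<notin> face" for u
    using that by (simp add: x_def face_point_def)
  have variety: "x \<in> trop_toric_variety \<sigma>"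
    unfolding trop_toric_variety_def
  proof (intro CollectI conjI ballI)
    show "x \<in> ?M \<rightarrow>\<^sub>E {y. y \<noteq> \<infinity>}" by (auto simp: x_def face_point_def)
    show "x 0 = 0" using x_on[OF zero_face] a0 by (simp add: zero_ereal_def)
    show "x (u + w) = x u + x w" if "u \<in> ?M" "w \<in> ?M" for u w
    proof (cases "u \<in> face \<and> w \<in> face")
      case True
      then show ?thesis using x_on face_add a(1) by simp
    next
      case False
      have "x u \<noteq> \<infinity>" "x w \<noteq> \<infinity>" using x_on x_off that by (cases "u \<in> face"; cases "w \<in> face"; simp)+
      moreover have "x u = - \<infinity> \<or> x w = - \<infinity>" using x_off that False by blast
      moreover have "x (u + w) = - \<infinity>" using x_off M_add face_add_iff that False by blast
      ultimately show ?thesis by auto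
    qed
  qed
  have val_on: "trop_log (coeff h u) + x u = ereal (trop_real (coeff h u) + a u)"
    if "u \<in> supp h" "u \<in> face" for h u
    using x_on[OF that(2)] trop_log_real[of "coeff h u"] that(1)
    by (metis in_keys_iff plus_ereal.simps(1))
  have val_off: "trop_log (coeff h u) + x u = - \<infinity>" if "u \<in> ?M" "u \<notin> face" for h u
    using x_off[OF that] trop_log_not_PInf[of "coeff h u"] by simp
  have "trop_eval f x < trop_eval g x"
  proof -
    have "trop_eval f x < ereal (trop_real ?d + a m)"
    proof (rule trop_eval_less)
      fix u assume u: "u \<in> supp f"
      show "trop_log (coeff f u) + x u < ereal (trop_real ?d + a m)"
      proof (cases "u \<in> face")
        case True
        then have "((trop_real (coeff f u) - trop_real ?d, u - m), True) \<in> X \<union> Y"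
          using u by (auto simp: Y_def)
        from a(2)[OF this] show ?thesis using val_on[OF u True] by (simp add: nonpos_def adiff)
      next
        case False
        show ?thesis unfolding val_off[OF keys_A[OF fg(1) u] False] by simp
      qed
    qed simp
    also have "\<dots> \<le> trop_eval g x" using le_trop_eval[OF m(1), of x] val_on[OF m(1) mface] by simp
    finally show ?thesis .
  qed
  moreover have "trop_eval h x = trop_eval (delete_term i h) x"
    if h: "h \<in> trop_ideal v J" and i: "i \<in> supp h" for h i
  proof (rule antisym)
    let ?D = "delete_term i h"
    obtain G where G: "G \<in> J" "h = Poly_Mapping.map v G" using h by (auto simp: trop_ideal_def)
    have lh: "coeff h u = v (coeff G u)" for u
      unfolding G(2) by (rule lookup_trop[of v, OF v0])
    have keysh: "u \<in> ?M" if "u \<in> supp h" for u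
      using that monoid_idealD(2)[OF J G(1), of u] by (simp add: in_keys_iff lh vnz)
    have D_ge: "trop_log (coeff h u) + x u \<le> trop_eval ?D x"
      if "u \<in> supp h" "u \<noteq> i" for u
      using le_trop_eval[of u ?D x] that by (simp add: keys_delete_term lookup_delete_term)
    show "trop_eval ?D x \<le> trop_eval h x"
      using le_trop_eval[of _ h x] by (intro trop_eval_le) (auto simp: keys_delete_term lookup_delete_term)
    show "trop_eval h x \<le> trop_eval ?D x"
    proof (rule trop_eval_le)
      fix u assume u: "u \<in> supp h"
      show "trop_log (coeff h u) + x u \<le> trop_eval ?D x"
      proof (cases "u = i \<and> u \<in> face")
        case False
        show ?thesis
        proof (cases "u \<in> face")
          case True
          then show ?thesis using D_ge[OF u] False by blast
        next
          case False
          show ?thesis unfolding val_off[OF keysh[OF u] False] by simp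
        qed
      next
        case True
        let ?F = "restrict_poly face G"
        have lF: "coeff ?F w = (if w \<in> face then coeff G w else 0)" for w
          by (simp add: restrict_poly.rep_eq)
        have kF: "w \<in> supp ?F \<longleftrightarrow> w \<in> supp h \<and> w \<in> face" for w
          by (simp add: in_keys_iff lF lh vnz)
        have "bends ?W ?F" by (rule bend'[OF restrict_in_face_localization[OF G(1)]])
        then obtain w where w: "w \<in> supp ?F" "w \<noteq> u"
          and ns: "\<not> strict ?W (tterm ?F w - tterm ?F u)"
          using kF[of u] u True unfolding bends_def by blast
        have wf: "w \<in> face" "w \<in> supp h" using w(1) kF by auto
        have "w - u \<in> face_group" using wf(1) True by (auto simp: face_group_def)
        then have "trop_real (coeff h u) + a u \<le> trop_real (coeff h w) + a w"
          using ns strict' wf(1) conjunct2[OF True] by (simp add: tterm_def lF lh adiff)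
        then have "trop_log (coeff h u) + x u \<le> trop_log (coeff h w) + x w"
          unfolding val_on[OF u conjunct2[OF True]] val_on[OF wf(2,1)] by simp
        also have "\<dots> \<le> trop_eval ?D x" using D_ge[OF wf(2)] w(2) True by simp
        finally show ?thesis .
      qed
    qed
  qed
  ultimately show ?thesis using variety unfolding trop_vanishing_locus_def by blast
qed

text \<open>The congruences of points of the vanishing locus are among the primes that define the radical,
and every prime that separates \<open>f\<close> from \<open>g\<close> can be replaced by such a point.\<close>

theorem tropical_nullstellensatz:
  fixes v :: "'k::field \<Rightarrow> trop" and \<sigma> :: "('m::ab_group_add \<Rightarrow> real) set"
  assumes S: "sub_semifield S" and M: "fg_free_abelian TYPE('m)" and \<sigma>: "rational_polyhedral_cone \<sigma>"
    and v: "valuation_into S v" and J: "ideal J (monoid_algebra UNIV (toric_monoid \<sigma>))"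
    and fg: "f \<in> carrier (monoid_algebra S (toric_monoid \<sigma>))" "g \<in> carrier (monoid_algebra S (toric_monoid \<sigma>))"
  shows "(f, g) \<in> radical_congruence (monoid_algebra S (toric_monoid \<sigma>)) (Bend S (toric_monoid \<sigma>) (trop_ideal v J)) \<longleftrightarrow>
    (\<forall>x\<in>trop_vanishing_locus \<sigma> (trop_ideal v J). trop_eval f x = trop_eval g x)"
proof -
  let ?M = "toric_monoid \<sigma>"
  let ?A = "monoid_algebra S ?M" and ?I = "trop_ideal v J"
  let ?V = "trop_vanishing_locus \<sigma> ?I"
  have M': "additive_submonoid ?M" by (rule toric_monoid_submonoid[OF \<sigma>])
  obtain n and c :: "'m \<Rightarrow> nat \<Rightarrow> int" where c: "coordinates n c"
    using fg_free_abelian_coordinates[OF M] by blast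
  have J': "monoid_ideal ?M J" by (rule monoid_ideal_of_ideal[OF J])
  have IA: "h \<in> carrier ?A" if h: "h \<in> ?I" for h
  proof -
    obtain G where G: "G \<in> J" "h = Poly_Mapping.map v G" using h by (auto simp: trop_ideal_def)
    have v': "v 0 = 0" "range v \<subseteq> S" using v unfolding valuation_into_def by auto
    show ?thesis using monoid_idealD(2)[OF J' G(1)] v'
      by (auto simp: monoid_algebra_sel(1) G(2) in_keys_iff Poly_Mapping.map.rep_eq when_def split: if_splits)
  qed
  have prime: "\<exists>x\<in>?V. trop_eval f x \<noteq> trop_eval g x"
    if P: "prime_congruence ?A P" "Bend S ?M ?I \<subseteq> P" and nP: "(f, g) \<notin> P" for P
  proof -
    have tp: "tropical_prime S ?M P" by standard (use S M' P in auto)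
    have C: "congruence ?A P" using P(1) by (simp add: prime_congruence_def)
    have bend: "bend_relations h \<subseteq> P" if "h \<in> ?I" for h
      using P(2) that Bend_subset_iff[OF C] by blast
    have "\<not> tropical_prime.le P g f \<or> \<not> tropical_prime.le P f g"
      using tropical_prime.le_antisym[OF tp] nP by blast
    then show ?thesis
      using nullstellensatz_separation[OF tp c v J' bend fg] nullstellensatz_separation[OF tp c v J' bend fg(2,1)]
      by (metis less_irrefl)
  qed
  have point: "prime_congruence ?A (point_congruence S ?M x) \<and> Bend S ?M ?I \<subseteq> point_congruence S ?M x"
    if x: "x \<in> ?V" for x
  proof -
    have xv: "x \<in> trop_toric_variety \<sigma>"
      and bend: "\<And>h i. h \<in> ?I \<Longrightarrow> i \<in> supp h \<Longrightarrow> trop_eval h x = trop_eval (delete_term i h) x"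
      using x unfolding trop_vanishing_locus_def by blast+
    have p: "prime_congruence ?A (point_congruence S ?M x)" by (rule prime_point_congruence[OF S M' xv])
    then have C: "congruence ?A (point_congruence S ?M x)" by (simp add: prime_congruence_def)
    have DA: "delete_term i h \<in> carrier ?A" if "h \<in> carrier ?A" for i h
      using that sub_semifieldD(1)[OF S]
      by (auto simp: monoid_algebra_sel(1) keys_delete_term lookup_delete_term)
    have "Bend S ?M ?I \<subseteq> point_congruence S ?M x"
      unfolding Bend_subset_iff[OF C] using bend IA DA
      by (auto simp: bend_relations_def point_congruence_def)
    then show ?thesis using p by blast
  qed
  show ?thesis
  proof
    assume r: "(f, g) \<in> radical_congruence ?A (Bend S ?M ?I)"
    then have "(f, g) \<in> point_congruence S ?M x" if "x \<in> ?V" for x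
      using point[OF that] unfolding radical_congruence_def by blast
    then show "\<forall>x\<in>?V. trop_eval f x = trop_eval g x" by (simp add: point_congruence_def)
  next
    assume "\<forall>x\<in>?V. trop_eval f x = trop_eval g x"
    then show "(f, g) \<in> radical_congruence ?A (Bend S ?M ?I)"
      unfolding radical_congruence_def using prime fg by blast
  qed
qed

text \<open>Cancellation of \<open>h\<close> is possible at the points of the torus, where a nonzero element never takes the
value minus infinity, and density carries the resulting equality to the whole vanishing locus.\<close>

theorem corollary1p5:
  fixes S :: "trop set"
    and \<sigma> :: "('m::ab_group_add \<Rightarrow> real) set"
    and v :: "'k::field \<Rightarrow> trop"
    and J :: "('m \<Rightarrow>\<^sub>0 'k) set"
    and I :: "('m \<Rightarrow>\<^sub>0 trop) set"
  assumes "sub_semifield S"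
    and "fg_free_abelian TYPE('m)"
    and "rational_polyhedral_cone \<sigma>"
    and "strongly_convex \<sigma>"
    and "valuation_into S v"
    and "ideal J (monoid_algebra UNIV (toric_monoid \<sigma>))"
    and "I = trop_ideal v J"
    and "trop_vanishing_locus \<sigma> I =
      (trop_toric_topology \<sigma>) closure_of (trop_vanishing_locus \<sigma> I \<inter> trop_torus \<sigma>)"
  shows "cancellative (quotient_semiring (monoid_algebra S (toric_monoid \<sigma>))
    (radical_congruence (monoid_algebra S (toric_monoid \<sigma>)) (Bend S (toric_monoid \<sigma>) I)))"
proof -
  let ?M = "toric_monoid \<sigma>"
  let ?A = "monoid_algebra S ?M" and ?V = "trop_vanishing_locus \<sigma> I"
  let ?R = "radical_congruence ?A (Bend S ?M I)"
  note S = assms(1)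
  have M: "additive_submonoid ?M" by (rule toric_monoid_submonoid[OF assms(3)])
  have A: "closed_structure ?A" by (rule monoid_algebra_closed[OF S M])
  have R: "congruence ?A ?R"
    unfolding radical_congruence_def by (rule congruence_Inter[OF _ A]) (simp add: prime_congruence_def)
  have R_iff: "(f, g) \<in> ?R \<longleftrightarrow> (\<forall>x\<in>?V. trop_eval f x = trop_eval g x)"
    if "f \<in> carrier ?A" "g \<in> carrier ?A" for f g
    unfolding assms(7) by (rule tropical_nullstellensatz[OF S assms(2,3,5,6) that])
  show ?thesis
    unfolding cancellative_quotient_iff[OF R A] monoid_algebra_sel(2,4)
  proof (intro ballI impI)
    fix h f g assume hfg: "h \<in> carrier ?A" "f \<in> carrier ?A" "g \<in> carrier ?A"
      and h0: "(h, 0) \<notin> ?R" and eq: "(h * f, h * g) \<in> ?R"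
    have keys: "supp p \<subseteq> ?M" if "p \<in> carrier ?A" for p
      using that by (simp add: monoid_algebra_sel(1))
    have mult: "h * p \<in> carrier ?A" if "p \<in> carrier ?A" for p
      using A hfg(1) that by (simp add: closed_structure_def monoid_algebra_sel(2))
    have hz: "h \<noteq> 0" using h0 congruenceD(4)[OF R hfg(1)] by auto
    have torus: "trop_eval f x = trop_eval g x" if x: "x \<in> ?V \<inter> trop_torus \<sigma>" for x
    proof -
      have xv: "x \<in> trop_toric_variety \<sigma>" and fin: "\<And>u. u \<in> ?M \<Longrightarrow> x u \<noteq> - \<infinity>"
        using x unfolding trop_torus_def by auto
      let ?e = "eval_trop (point_values x)"
      have ev: "trop_eval p x = trop_log (?e p)" if "p \<in> carrier ?A" for p
        using trop_eval_eq[OF keys[OF that], of x] trop_toric_varietyD(1)[OF xv] by blast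
      have emult: "?e (h * p) = ?e h * ?e p" if "p \<in> carrier ?A" for p
        by (rule eval_trop_mult[OF M point_values_mult[OF xv] keys[OF hfg(1)] keys[OF that]])
      have "trop_eval (h * f) x = trop_eval (h * g) x"
        using eq x R_iff[OF mult mult] hfg by blast
      then have "?e h * ?e f = ?e h * ?e g"
        using ev[OF mult] emult hfg by (simp add: trop_log_inject)
      moreover have "?e h \<noteq> 0"
      proof -
        obtain u where u: "u \<in> supp h" using hz by (metis ex_in_conv keys_eq_empty)
        have "trop_log (coeff h u) \<noteq> - \<infinity>" using u by (simp add: in_keys_iff trop_log_eq_MInf)
        moreover have "x u \<noteq> - \<infinity>" using fin keys[OF hfg(1)] u by blast
        ultimately have "trop_log (coeff h u) + x u \<noteq> - \<infinity>" by simp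
        then have "trop_eval h x \<noteq> - \<infinity>" using le_trop_eval[OF u, of x] by auto
        then show ?thesis using ev[OF hfg(1)] by (auto simp: trop_log_0)
      qed
      ultimately have "?e f = ?e g" using trop_cancel by blast
      then show ?thesis using ev hfg by simp
    qed
    have "trop_eval f x = trop_eval g x" if "x \<in> ?V" for x
    proof (rule trop_eval_eq_on_closure[OF keys[OF hfg(2)] keys[OF hfg(3)] torus])
      show "?V \<inter> trop_torus \<sigma> \<subseteq> trop_toric_variety \<sigma>" unfolding trop_torus_def by blast
      show "x \<in> trop_toric_topology \<sigma> closure_of (?V \<inter> trop_torus \<sigma>)" using that assms(8) by blast
    qed
    then show "(f, g) \<in> ?R" using R_iff hfg by blast
  qed
qed

end
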